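(* Let $\ell\in\mathbb{N}$ and $\vec\phi=(\phi_1,\dots,\phi_\ell):[0,\infty)\to\mathbb{R}^\ell$. For each $1\le k\le\ell$ suppose there are a constant $y_0\ge0$ with $\phi_k$ square-integrable on $[0,y_0]$, an increasing sequence $(\lambda_{k,n})_n$ of positive reals tending to infinity, complex numbers $(r_{k,n})_n$, $c_k\in\mathbb{R}$ and $X_0>0$ such that for all $y\ge y_0$, $X\ge X_0$, $$\phi_k(y)=c_k+\Re\Big(\sum_{\lambda_{k,n}\le X}r_{k,n}e^{i\lambda_{k,n}y}\Big)+\mathcal{E}_k(y,X),\qquad\lim_{Y\to\infty}\frac1Y\int_{y_0}^Y|\mathcal{E}_k(y,e^Y)|^2dy=0,$$ and at least one of the following holds (with $\lambda_n=\lambda_{k,n}$, $r_n=r_{k,n}$): (A) for some $\beta>1/2,\gamma\ge0$, $\sum_{T<\lambda_n\le T+1}|r_n|\ll(\log T)^\gamma/T^\beta$; (B) for some $\alpha,\beta>0,\gamma\ge0$ with $\beta\le\min\{1,\alpha\}$, $\alpha^2+\alpha/2<\beta^2+\beta$, $\sum_{S<\lambda_n\le T}|r_n|\ll(T-S)^\alpha(\log T)^\gamma/S^\beta$ for $T>S>0$; (C) $r_n\ll\lambda_n^{-\beta}$ for some $\beta>1/2$ and $\sum_{T<\lambda_n\le T+1}1\ll\log T$; (D) for some $0\le\theta<3-\sqrt3$, $\sum_{T<\lambda_n\le T+1}1\ll\log T$ and $\sum_{\lambda_n\le T}\lambda_n^2|r_n|^2\ll T^\theta$. Then $\vec\phi$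 has a limiting distribution $\mu$. Let $(\lambda_m)_{m\in\mathbb{N}}$ be the increasing enumeration of the set $\bigcup_{k=1}^\ell\bigcup_{n\ge1}\{\lambda_{k,n}\}$, and for $1\le k\le\ell$ put $r_k(\lambda_m)=r_{k,n}$ if $\lambda_m=\lambda_{k,n}$ for some $n$, and $r_k(\lambda_m)=0$ otherwise. Suppose that $\{\lambda_m\}_{m\in\mathbb{N}}$ is linearly independent over $\mathbb{Q}$. Then for every $\vec\xi=(\xi_1,\dots,\xi_\ell)\in\mathbb{R}^\ell$ the Fourier transform $\hat\mu(\vec\xi)=\int_{\mathbb{R}^\ell}e^{-i\sum_{j=1}^\ell\xi_jt_j}d\mu(t_1,\dots,t_\ell)$ exists and $$\hat\mu(\vec\xi)=\exp\Big(-i\sum_{k=1}^\ell c_k\xi_k\Big)\prod_{m=1}^\infty J_0\Big(\Big|\sum_{k=1}^\ell r_k(\lambda_m)\xi_k\Big|\Big),$$ where $J_0(z)=\int_0^1e^{-iz\cos(2\pi t)}dt$.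
   Context: Notation: $f\ll g$ means $|f|\le M|g|$ for some $M>0$ and all sufficiently large values of the variable. A function $\vec\phi:[0,\infty)\to\mathbb{R}^\ell$ has a limiting distribution $\mu$ if $\mu$ is a probability measure on $\mathbb{R}^\ell$ and $\lim_{Y\to\infty}\frac1Y\int_0^Yf(\vec\phi(y))dy=\int f\,d\mu$ for every bounded continuous $f:\mathbb{R}^\ell\to\mathbb{R}$. *)

theory Defs
  imports "HOL-Probability.Probability" "HOL-Library.Landau_Symbols"
begin

definition has_limiting_distribution :: "(real \<Rightarrow> 'a::euclidean_space) \<Rightarrow> 'a measure \<Rightarrow> bool" where
  "has_limiting_distribution phi mu \<longleftrightarrow>
     prob_space mu \<and> sets mu = sets borel \<and>
     (\<forall>f :: 'a \<Rightarrow> real. continuous_on UNIV f \<and> bounded (range f) \<longrightarrow>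
        ((\<lambda>Y. (1 / Y) * (LINT y:{0..Y}|lebesgue. f (phi y))) \<longlongrightarrow> (\<integral>x. f x \<partial>mu)) at_top)"

definition Q_linearly_independent :: "real set \<Rightarrow> bool" where
  "Q_linearly_independent S \<longleftrightarrow>
     (\<forall>F q. finite F \<and> F \<subseteq> S \<and> (\<Sum>x\<in>F. real_of_rat (q x) * x) = 0 \<longrightarrow> (\<forall>x\<in>F. q x = 0))"

definition incr_enum :: "real set \<Rightarrow> nat \<Rightarrow> real" where
  "incr_enum S = (SOME e. strict_mono e \<and> range e = S)"

definition coef_at :: "(nat \<Rightarrow> real) \<Rightarrow> (nat \<Rightarrow> complex) \<Rightarrow> real \<Rightarrow> complex" where
  "coef_at lam r x = (if \<exists>n. lam n = x then r (THE n. lam n = x) else 0)"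

definition J0 :: "real \<Rightarrow> complex" where
  "J0 z = integral {0..1} (\<lambda>t. exp (- \<i> * complex_of_real (z * cos (2 * pi * t))))"

definition cond_A :: "(nat \<Rightarrow> real) \<Rightarrow> (nat \<Rightarrow> complex) \<Rightarrow> bool" where
  "cond_A lam r \<longleftrightarrow> (\<exists>\<beta> \<gamma>. \<beta> > 1/2 \<and> \<gamma> \<ge> 0 \<and>
     (\<lambda>T. \<Sum>n\<in>{n. T < lam n \<and> lam n \<le> T + 1}. norm (r n)) \<in> O(\<lambda>T. ln T powr \<gamma> / T powr \<beta>))"

definition cond_B :: "(nat \<Rightarrow> real) \<Rightarrow> (nat \<Rightarrow> complex) \<Rightarrow> bool" where
  "cond_B lam r \<longleftrightarrow> (\<exists>\<alpha> \<beta> \<gamma>. \<alpha> > 0 \<and> \<beta> > 0 \<and> \<gamma> \<ge> 0 \<and> \<beta> \<le> min 1 \<alpha> \<and>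
     \<alpha>\<^sup>2 + \<alpha> / 2 < \<beta>\<^sup>2 + \<beta> \<and>
     (\<exists>M S0. \<forall>S T. S0 \<le> S \<and> 0 < S \<and> S < T \<longrightarrow>
        \<bar>\<Sum>n\<in>{n. S < lam n \<and> lam n \<le> T}. norm (r n)\<bar>
          \<le> M * \<bar>(T - S) powr \<alpha> * ln T powr \<gamma> / S powr \<beta>\<bar>))"

definition cond_C :: "(nat \<Rightarrow> real) \<Rightarrow> (nat \<Rightarrow> complex) \<Rightarrow> bool" where
  "cond_C lam r \<longleftrightarrow> (\<exists>\<beta>. \<beta> > 1/2 \<and>
     (\<lambda>n. norm (r n)) \<in> O(\<lambda>n. lam n powr (- \<beta>))) \<and>
     (\<lambda>T. real (card {n. T < lam n \<and> lam n \<le> T + 1})) \<in> O(\<lambda>T. ln T)"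

definition cond_D :: "(nat \<Rightarrow> real) \<Rightarrow> (nat \<Rightarrow> complex) \<Rightarrow> bool" where
  "cond_D lam r \<longleftrightarrow> (\<exists>\<theta>. 0 \<le> \<theta> \<and> \<theta> < 3 - sqrt 3 \<and>
     (\<lambda>T. real (card {n. T < lam n \<and> lam n \<le> T + 1})) \<in> O(\<lambda>T. ln T) \<and>
     (\<lambda>T. \<Sum>n\<in>{n. lam n \<le> T}. (lam n)\<^sup>2 * (norm (r n))\<^sup>2) \<in> O(\<lambda>T. T powr \<theta>))"

end

theory Submission
  imports Defs "HOL-Real_Asymp.Real_Asymp"
begin

text \<open>
  Each of the conditions (A)--(D) gives \<open>\<Sum>j. b j ^ 2 < \<infinity>\<close> for the block sums \<open>b j\<close> of the
  \<open>\<bar>r n\<bar>\<close> over \<open>j < \<lambda> n \<le> j + 1\<close>; the exponents enter through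
  \<open>\<alpha> < 2 * \<beta>\<close> in (B) and \<open>\<theta> < 2\<close> in (D). A large sieve inequality bounds the mean square over
  \<open>[0, Y]\<close> of the part of the expansion with frequencies above \<open>T\<close> by a tail of this series. So, off
  sets of small upper density, the components of \<open>\<phi>\<close> are uniformly close to trigonometric
  polynomials \<open>P T\<close>.

  For continuous \<open>f\<close> the function \<open>f \<circ> P T\<close> is uniformly almost periodic by Stone--Weierstrass, hence has
  a mean value, and the means of \<open>f \<circ> \<phi>\<close> converge to the limit of these. The limiting measure comes
  from Prokhorov's theorem, reduced to Helly's theorem on the line: \<open>\<real> ^ l\<close> has a Borel injection into
  \<open>\<real>\<close> whose inverse is uniformly continuous and therefore extends to a continuous map on \<open>\<real>\<close>.

  For linearly independent frequencies the mean value is multiplicative over distinct frequencies,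
  and one frequency contributes a factor \<open>J0\<close>.
\<close>

section \<open>Mean squares of trigonometric sums\<close>

text \<open>The error term is controlled only along \<open>X = exp Y\<close>, so the truncation
  moves with the length of the averaging interval, and frequencies from a fixed \<open>T\<close> up
  to \<open>exp Y\<close> must be handled together. Their bound has to be uniform in the set of
  frequencies; this is why it involves block sums only, with an absolute constant. Smallness in mean
  square gives no pointwise control, and the bound for \<open>P T\<close> may grow with
  \<open>T\<close>. A continuous test function is uniformly continuous only on compact sets, so
  comparing averages takes both an exceptional set of small density and tightness of
  \<open>phi\<close> itself. The four conditions may be mixed among the components, since each leads
  to the same summability. The almost periodic class carries its set of frequencies as a parameter:
  existence puts no restriction on it, the product formula exploits its structure. Convergence of
  the infinite product is a by-product: its partial products are mean values already known to
  converge.\<close>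

lemma exp_neg_half_square_le: "exp (- (x::real)\<^sup>2 / 2) \<le> exp (1 / 2) * exp (- \<bar>x\<bar>)"
proof -
  have "0 \<le> (\<bar>x\<bar> - 1)\<^sup>2" by simp
  then have "- x\<^sup>2 / 2 \<le> 1 / 2 + - \<bar>x\<bar>"
    by (simp add: power2_diff)
  then show ?thesis by (simp flip: exp_add)
qed

text \<open>On either side of \<open>j\<close> a geometric series of ratio 1/2 dominates the kernel,
  because \<open>exp (- 1)\<close> is at most 1/2; each side contributes at most 2. The diagonal is
  counted on both sides, which only enlarges the bound.\<close>

lemma sum_exp_neg_abs_diff_le:
  assumes "finite J"
  shows "(\<Sum>j'\<in>J. exp (- \<bar>real j - real j'\<bar>)) \<le> 4"
proof -
  have half: "exp (- 1) \<le> (1/2 :: real)"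
    using exp_ge_add_one_self[of 1] by (simp add: exp_minus field_simps)
  have e: "exp (- real n) \<le> (1/2) ^ n" for n
    using power_mono[OF half, of n] by (simp flip: exp_of_nat_mult)
  have geo: "(\<Sum>n\<in>A. (1/2 :: real) ^ n) \<le> 2" if "finite A" for A :: "nat set"
    using sum_le_suminf[of "\<lambda>n. (1/2 :: real) ^ n" A] that by (simp add: suminf_geometric)
  have "(\<Sum>j'\<in>J. exp (- \<bar>real j - real j'\<bar>)) \<le>
        (\<Sum>j'\<in>J \<inter> {..j}. (1/2) ^ (j - j')) + (\<Sum>j'\<in>J \<inter> {j..}. (1/2) ^ (j' - j))"
  proof -
    have "(\<Sum>j'\<in>J. exp (- \<bar>real j - real j'\<bar>)) \<le> (\<Sum>j'\<in>J \<inter> {..j}. exp (- \<bar>real j - real j'\<bar>)) + (\<Sum>j'\<in>J \<inter> {j..}. exp (- \<bar>real j - real j'\<bar>))"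
    proof -
      have "J = (J \<inter> {..j}) \<union> (J \<inter> {j..})" by auto
      then have "(\<Sum>j'\<in>J. exp (- \<bar>real j - real j'\<bar>)) = (\<Sum>j'\<in>(J \<inter> {..j}) \<union> (J \<inter> {j..}). exp (- \<bar>real j - real j'\<bar>))"
        by simp
      also have "\<dots> \<le> (\<Sum>j'\<in>J \<inter> {..j}. exp (- \<bar>real j - real j'\<bar>)) + (\<Sum>j'\<in>J \<inter> {j..}. exp (- \<bar>real j - real j'\<bar>))"
        using assms by (subst sum.union_inter[symmetric]) (auto intro: sum_nonneg)
      finally show ?thesis .
    qed
    also have "\<dots> \<le> (\<Sum>j'\<in>J \<inter> {..j}. (1/2) ^ (j - j')) + (\<Sum>j'\<in>J \<inter> {j..}. (1/2) ^ (j' - j))"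
    proof (intro add_mono sum_mono)
      show "exp (- \<bar>real j - real j'\<bar>) \<le> (1/2) ^ (j - j')" if "j' \<in> J \<inter> {..j}" for j'
        using e[of "j - j'"] that by (simp add: of_nat_diff)
      show "exp (- \<bar>real j - real j'\<bar>) \<le> (1/2) ^ (j' - j)" if "j' \<in> J \<inter> {j..}" for j'
        using e[of "j' - j"] that by (simp add: of_nat_diff)
    qed
    finally show ?thesis .
  qed
  also have "(\<Sum>j'\<in>J \<inter> {..j}. (1/2 :: real) ^ (j - j')) = (\<Sum>n\<in>(\<lambda>j'. j - j') ` (J \<inter> {..j}). (1/2) ^ n)"
    by (rule sum.reindex_cong[symmetric, OF _ refl]) (auto simp: inj_on_def)
  also have "(\<Sum>j'\<in>J \<inter> {j..}. (1/2 :: real) ^ (j' - j)) = (\<Sum>n\<in>(\<lambda>j'. j' - j) ` (J \<inter> {j..}). (1/2) ^ n)"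
    by (rule sum.reindex_cong[symmetric, OF _ refl]) (auto simp: inj_on_def)
  finally show ?thesis
    using geo[of "(\<lambda>j'. j - j') ` (J \<inter> {..j})"] geo[of "(\<lambda>j'. j' - j) ` (J \<inter> {j..})"] assms by simp
qed

text \<open>The product \<open>b j * b j'\<close> is split by the arithmetic-geometric mean
  inequality, symmetry of the kernel makes the two halves equal, and only row sums remain.\<close>

lemma schur_test_exp:
  fixes b :: "nat \<Rightarrow> real"
  assumes "finite J"
  shows "(\<Sum>j\<in>J. \<Sum>j'\<in>J. b j * b j' * exp (- \<bar>real j - real j'\<bar>)) \<le> 4 * (\<Sum>j\<in>J. (b j)\<^sup>2)"
proof -
  let ?k = "\<lambda>j j'. exp (- \<bar>real j - real j'\<bar>)"
  have "(\<Sum>j\<in>J. \<Sum>j'\<in>J. b j * b j' * ?k j j')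
      \<le> (\<Sum>j\<in>J. \<Sum>j'\<in>J. ((b j)\<^sup>2 / 2 + (b j')\<^sup>2 / 2) * ?k j j')"
  proof (intro sum_mono mult_right_mono)
    show "b j * b j' \<le> (b j)\<^sup>2 / 2 + (b j')\<^sup>2 / 2" for j j'
      using sum_squares_bound[of "b j" "b j'"] by simp
  qed auto
  also have "\<dots> = (\<Sum>j\<in>J. \<Sum>j'\<in>J. (b j)\<^sup>2 / 2 * ?k j j') + (\<Sum>j\<in>J. \<Sum>j'\<in>J. (b j')\<^sup>2 / 2 * ?k j j')"
    by (simp add: sum.distrib distrib_right)
  also have "(\<Sum>j\<in>J. \<Sum>j'\<in>J. (b j')\<^sup>2 / 2 * ?k j j') = (\<Sum>j\<in>J. \<Sum>j'\<in>J. (b j)\<^sup>2 / 2 * ?k j j')"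
    by (subst sum.swap) (simp add: abs_minus_commute)
  also have "(\<Sum>j\<in>J. \<Sum>j'\<in>J. (b j)\<^sup>2 / 2 * ?k j j') + \<dots> = (\<Sum>j\<in>J. (b j)\<^sup>2 * (\<Sum>j'\<in>J. ?k j j'))"
    by (simp add: sum_distrib_left flip: sum.distrib)
  also have "\<dots> \<le> (\<Sum>j\<in>J. (b j)\<^sup>2 * 4)"
    using assms by (intro sum_mono mult_left_mono sum_exp_neg_abs_diff_le) auto
  finally show ?thesis by (simp add: sum_distrib_left mult_ac)
qed

section \<open>The large sieve inequality\<close>

definition trig_sum :: "(nat \<Rightarrow> real) \<Rightarrow> (nat \<Rightarrow> complex) \<Rightarrow> nat set \<Rightarrow> real \<Rightarrow> complex" where
  "trig_sum lam r F y = (\<Sum>n\<in>F. r n * exp (\<i> * complex_of_real (lam n * y)))"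

lemma continuous_on_trig_sum [continuous_intros]: "continuous_on S (trig_sum lam r F)"
  unfolding trig_sum_def by (intro continuous_intros)

lemma borel_measurable_trig_sum [measurable]: "trig_sum lam r F \<in> borel_measurable borel"
  by (intro borel_measurable_continuous_onI continuous_intros)

lemma norm_trig_sum_le: "norm (trig_sum lam r F y) \<le> (\<Sum>n\<in>F. norm (r n))"
  unfolding trig_sum_def by (rule order_trans[OF norm_sum]) (simp add: norm_mult)

text \<open>After expansion of the square each cross term is the characteristic function of the
  normal law at \<open>Y * (lam m - lam n)\<close>. A Gaussian weight makes distant frequencies
  nearly orthogonal; a sharp cutoff would leave a decay of only one over the distance.\<close>

lemma gaussian_mean_square_trig_sum:
  assumes "finite F"
  shows "(\<integral>z. (norm (trig_sum lam r F (Y * z)))\<^sup>2 \<partial>std_normal_distribution) \<le>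
    (\<Sum>m\<in>F. \<Sum>n\<in>F. norm (r m) * norm (r n) * exp (- (Y * (lam m - lam n))\<^sup>2 / 2))"
proof -
  interpret real_distribution std_normal_distribution by (rule real_dist_normal_dist)
  have int: "integrable std_normal_distribution (\<lambda>z. iexp (t * z))" for t
    by (rule integrable_const_bound[of _ 1]) auto
  have "complex_of_real ((norm (trig_sum lam r F (Y * z)))\<^sup>2) =
      (\<Sum>m\<in>F. \<Sum>n\<in>F. (r m * cnj (r n)) * iexp (Y * (lam m - lam n) * z))" for z
  proof -
    have "complex_of_real ((norm (trig_sum lam r F (Y * z)))\<^sup>2) = trig_sum lam r F (Y * z) * cnj (trig_sum lam r F (Y * z))"
      using complex_norm_square[of "trig_sum lam r F (Y * z)"] by simp
    also have "\<dots> = (\<Sum>m\<in>F. \<Sum>n\<in>F. (r m * cnj (r n)) * (iexp (lam m * (Y * z)) * cnj (iexp (lam n * (Y * z)))))"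
      by (simp add: trig_sum_def sum_product mult_ac)
    also have "\<dots> = (\<Sum>m\<in>F. \<Sum>n\<in>F. (r m * cnj (r n)) * iexp (Y * (lam m - lam n) * z))"
      by (simp add: exp_cnj flip: exp_add) (simp add: algebra_simps)
    finally show ?thesis .
  qed
  then have "complex_of_real (\<integral>z. (norm (trig_sum lam r F (Y * z)))\<^sup>2 \<partial>std_normal_distribution)
      = (\<integral>z. (\<Sum>m\<in>F. \<Sum>n\<in>F. (r m * cnj (r n)) * iexp (Y * (lam m - lam n) * z)) \<partial>std_normal_distribution)"
    by (simp flip: integral_complex_of_real)
  also have "\<dots> = (\<Sum>m\<in>F. \<Sum>n\<in>F. (r m * cnj (r n)) * char std_normal_distribution (Y * (lam m - lam n)))"
    unfolding char_def using int
    by (simp add: Bochner_Integration.integral_sum Bochner_Integration.integrable_sum del: of_real_mult of_real_diff)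
  also have "norm \<dots> \<le> (\<Sum>m\<in>F. \<Sum>n\<in>F. norm (r m) * norm (r n) * exp (- (Y * (lam m - lam n))\<^sup>2 / 2))"
    unfolding char_std_normal_distribution
    by (intro order_trans[OF norm_sum] sum_mono) (simp add: norm_mult)
  finally show ?thesis by simp
qed

definition unit_block :: "(nat \<Rightarrow> real) \<Rightarrow> (nat \<Rightarrow> complex) \<Rightarrow> real \<Rightarrow> real" where
  "unit_block lam r T = (\<Sum>n\<in>{n. T < lam n \<and> lam n \<le> T + 1}. norm (r n))"

text \<open>The Gaussian majorant of the indicator of [0,1] turns the mean square into a quadratic form
  with rapidly decaying kernel, to which Schur's test applies.\<close>

lemma mean_square_trig_sum_le:
  assumes F: "finite F" and pos: "\<And>n. n \<in> F \<Longrightarrow> lam n > 0" and Y: "Y \<ge> 1"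
    and block: "\<And>T. finite {n. T < lam n \<and> lam n \<le> T + 1}"
    and J: "finite J" "\<And>n. n \<in> F \<Longrightarrow> nat \<lceil>lam n\<rceil> - 1 \<in> J"
  shows "(\<integral>\<^sup>+y\<in>{0..Y}. ennreal ((norm (trig_sum lam r F y))\<^sup>2) \<partial>lborel)
     \<le> ennreal (Y * (108 * (\<Sum>j\<in>J. (unit_block lam r (real j))\<^sup>2)))"
proof -
  \<comment> \<open>The ceiling minus one matches blocks open on the left and closed on the right;
    \<open>lam n > 0\<close> keeps the subtraction on \<open>nat\<close> from truncating.\<close>
  define idx where "idx n = nat \<lceil>lam n\<rceil> - 1" for n
  define b where "b j = (\<Sum>n\<in>{n\<in>F. idx n = j}. norm (r n))" for j
  have idx: "real (idx n) < lam n" "lam n \<le> real (idx n) + 1" if "n \<in> F" for n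
  proof -
    have "\<lceil>lam n\<rceil> \<ge> 1" using pos[OF that] by simp
    then have "real (idx n) = real_of_int \<lceil>lam n\<rceil> - 1" unfolding idx_def by linarith
    then show "real (idx n) < lam n" "lam n \<le> real (idx n) + 1" by linarith+
  qed
  have b_le: "0 \<le> b j" "b j \<le> unit_block lam r (real j)" for j
    unfolding b_def unit_block_def by (auto intro!: sum_nonneg sum_mono2 block idx)
  \<comment> \<open>\<open>Y \<ge> 1\<close> allows the factor \<open>Y\<close> to be dropped, and
    replacing frequencies by block numbers changes their distance by at most 1, which turns
    \<open>1/2\<close> into \<open>3/2\<close> in the exponent.\<close>
  have ker: "exp (- (Y * (lam m - lam n))\<^sup>2 / 2) \<le> exp (3/2) * exp (- \<bar>real (idx m) - real (idx n)\<bar>)"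
    if "m \<in> F" "n \<in> F" for m n
  proof -
    have "\<bar>lam m - lam n\<bar> \<le> \<bar>Y * (lam m - lam n)\<bar>"
      using Y mult_right_mono[of 1 Y "\<bar>lam m - lam n\<bar>"] by (simp add: abs_mult)
    then have "1/2 + - \<bar>Y * (lam m - lam n)\<bar> \<le> 3/2 + - \<bar>real (idx m) - real (idx n)\<bar>"
      using idx[OF that(1)] idx[OF that(2)] by linarith
    then have "exp (1/2) * exp (- \<bar>Y * (lam m - lam n)\<bar>) \<le> exp (3/2) * exp (- \<bar>real (idx m) - real (idx n)\<bar>)"
      by (simp flip: exp_add)
    then show ?thesis using exp_neg_half_square_le[of "Y * (lam m - lam n)"] by linarith
  qed
  have "(\<Sum>m\<in>F. \<Sum>n\<in>F. norm (r m) * norm (r n) * exp (- (Y * (lam m - lam n))\<^sup>2 / 2))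
      \<le> (\<Sum>m\<in>F. \<Sum>n\<in>F. norm (r m) * norm (r n) * (exp (3/2) * exp (- \<bar>real (idx m) - real (idx n)\<bar>)))"
    by (intro sum_mono mult_left_mono ker) auto
  also have "\<dots> = exp (3/2) * (\<Sum>m\<in>F. \<Sum>n\<in>F. norm (r m) * norm (r n) * exp (- \<bar>real (idx m) - real (idx n)\<bar>))"
    by (simp add: sum_distrib_left mult_ac)
  also have "(\<Sum>m\<in>F. \<Sum>n\<in>F. norm (r m) * norm (r n) * exp (- \<bar>real (idx m) - real (idx n)\<bar>))
      = (\<Sum>j\<in>J. \<Sum>j'\<in>J. b j * b j' * exp (- \<bar>real j - real j'\<bar>))"
  proof -
    have grp: "(\<Sum>n\<in>F. g n) = (\<Sum>j\<in>J. \<Sum>n\<in>{n\<in>F. idx n = j}. g n)" for g :: "nat \<Rightarrow> real"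
      using J F by (intro sum.group[symmetric]) (auto simp: idx_def)
    have "(\<Sum>m\<in>F. \<Sum>n\<in>F. norm (r m) * norm (r n) * exp (- \<bar>real (idx m) - real (idx n)\<bar>))
       = (\<Sum>j\<in>J. \<Sum>m\<in>{m\<in>F. idx m = j}. \<Sum>j'\<in>J. \<Sum>n\<in>{n\<in>F. idx n = j'}. norm (r m) * norm (r n) * exp (- \<bar>real j - real j'\<bar>))"
      unfolding grp by (intro sum.cong) auto
    also have "\<dots> = (\<Sum>j\<in>J. \<Sum>j'\<in>J. b j * b j' * exp (- \<bar>real j - real j'\<bar>))"
      unfolding b_def sum_product sum_distrib_right
      by (intro sum.cong[OF refl], subst sum.swap) (simp add: sum_distrib_right sum_distrib_left)
    finally show ?thesis .
  qed
  also have "exp (3/2) * \<dots> \<le> exp (3/2) * (4 * (\<Sum>j\<in>J. (unit_block lam r (real j))\<^sup>2))"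
    using J b_le by (intro mult_left_mono order_trans[OF schur_test_exp] sum_mono power_mono) auto
  finally have quad: "(\<Sum>m\<in>F. \<Sum>n\<in>F. norm (r m) * norm (r n) * exp (- (Y * (lam m - lam n))\<^sup>2 / 2))
      \<le> exp (3/2) * (4 * (\<Sum>j\<in>J. (unit_block lam r (real j))\<^sup>2))" .
  define Q where "Q = (\<Sum>j\<in>J. (unit_block lam r (real j))\<^sup>2)"
  interpret real_distribution std_normal_distribution by (rule real_dist_normal_dist)
  have Q0: "Q \<ge> 0" unfolding Q_def by (intro sum_nonneg) auto
  define f where "f y = (norm (trig_sum lam r F y))\<^sup>2" for y
  have [measurable]: "f \<in> borel_measurable borel" unfolding f_def by measurable
  have f0: "f y \<ge> 0" for y by (simp add: f_def)
  \<comment> \<open>On [0,1] the density is smallest at 1, whence \<open>exp (1/2)\<close>;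
    \<open>sqrt (2 * pi)\<close> removes the normalisation.\<close>
  have dens: "indicator {0..1} z \<le> sqrt (2 * pi) * exp (1/2) * std_normal_density z" for z :: real
  proof (cases "z \<in> {0..1}")
    case True
    then have "z\<^sup>2 \<le> 1" by (simp add: power_le_one)
    then have "1 \<le> exp (1/2) * exp (- z\<^sup>2 / 2)" by (simp flip: exp_add)
    then show ?thesis using True by (simp add: std_normal_density_def)
  qed (simp add: normal_density_nonneg)
  have "(\<integral>\<^sup>+y\<in>{0..Y}. ennreal (f y) \<partial>lborel) = ennreal Y * (\<integral>\<^sup>+z. ennreal (f (Y * z)) * indicator {0..Y} (Y * z) \<partial>lborel)"
    using Y by (subst nn_integral_real_affine[where c=Y and t=0]) auto
  also have "\<dots> \<le> ennreal Y * (\<integral>\<^sup>+z. ennreal (sqrt (2 * pi) * exp (1/2)) * (ennreal (std_normal_density z) * ennreal (f (Y * z))) \<partial>lborel)"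
  proof (intro mult_left_mono nn_integral_mono)
    fix z :: real
    have "indicator {0..Y} (Y * z) = (indicator {0..1} z :: real)"
      using Y by (auto simp: indicator_def zero_le_mult_iff mult_le_cancel_left2)
    then have "f (Y * z) * indicator {0..Y} (Y * z) \<le> f (Y * z) * (sqrt (2 * pi) * exp (1/2) * std_normal_density z)"
      using dens[of z] f0 by (intro mult_left_mono) auto
    then show "ennreal (f (Y * z)) * indicator {0..Y} (Y * z) \<le> ennreal (sqrt (2 * pi) * exp (1/2)) * (ennreal (std_normal_density z) * ennreal (f (Y * z)))"
      using f0 by (simp add: ennreal_indicator[symmetric] mult_ac ennreal_leI flip: ennreal_mult)
  qed simp
  also have "\<dots> = ennreal Y * (ennreal (sqrt (2 * pi) * exp (1/2)) * (\<integral>\<^sup>+z. ennreal (f (Y * z)) \<partial>std_normal_distribution))"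
    by (simp add: nn_integral_cmult nn_integral_density)
  also have "(\<integral>\<^sup>+z. ennreal (f (Y * z)) \<partial>std_normal_distribution) = ennreal (\<integral>z. f (Y * z) \<partial>std_normal_distribution)"
  proof (rule nn_integral_eq_integral)
    have "norm (f (Y * z)) \<le> (\<Sum>n\<in>F. norm (r n))\<^sup>2" for z
      unfolding f_def using norm_trig_sum_le[of lam r F "Y * z"] by (simp add: power_mono)
    then show "integrable std_normal_distribution (\<lambda>z. f (Y * z))"
      by (intro integrable_const_bound[of _ "(\<Sum>n\<in>F. norm (r n))\<^sup>2"]) auto
  qed (simp add: f0)
  also have "\<dots> \<le> ennreal (exp (3/2) * (4 * Q))"
    unfolding f_def Q_def using gaussian_mean_square_trig_sum[OF F, of lam r Y] quad by (intro ennreal_leI) linarith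
  also have "ennreal Y * (ennreal (sqrt (2 * pi) * exp (1/2)) * ennreal (exp (3/2) * (4 * Q)))
      = ennreal (Y * ((sqrt (2 * pi) * (exp (1/2) * exp (3/2)) * 4) * Q))"
    using Y Q0 by (simp add: mult_ac flip: ennreal_mult)
  also have "\<dots> \<le> ennreal (Y * (108 * Q))"
  proof (intro ennreal_leI mult_left_mono mult_right_mono)
    \<comment> \<open>The constant is 108 = 3 * 9 * 4, with 3 for \<open>sqrt (2 * pi)\<close>, 9
      for the square of \<open>exp 1\<close> and 4 from the row sums of the kernel.\<close>
    have "sqrt (2 * pi) \<le> 3"
      using pi_less_4 by (intro real_le_lsqrt) auto
    moreover have "exp (1/2 :: real) * exp (3/2) = (exp 1)\<^sup>2" by (simp add: power2_eq_square flip: exp_add)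
    moreover have "(exp 1 :: real)\<^sup>2 \<le> 3\<^sup>2" using exp_le by (intro power_mono) auto
    ultimately have "sqrt (2 * pi) * (exp (1/2) * exp (3/2)) \<le> 3 * 9"
      by (intro mult_mono) auto
    then show "sqrt (2 * pi) * (exp (1/2) * exp (3/2)) * 4 \<le> 108" by simp
  qed (use Y Q0 in auto)
  finally show ?thesis unfolding f_def Q_def
    by (meson mult_left_mono order_trans zero_le) 
qed

section \<open>Square summability of the block sums\<close>

text \<open>For nonnegative terms it suffices to bound partial sums up to powers of 2, which a
  geometric series does once finitely many terms are set apart. Conditions (B) and (D) give decay in
  this form, for a dyadic range as a whole.\<close>

lemma summable_dyadic_blocks:
  fixes f :: "nat \<Rightarrow> real"
  assumes f: "\<And>j. f j \<ge> 0" and q: "0 \<le> q" "q < 1"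
    and block: "\<And>i. i \<ge> i0 \<Longrightarrow> (\<Sum>j\<in>{2^i..<2^Suc i}. f j) \<le> C * q ^ i"
  shows "summable f"
proof (rule summableI_nonneg_bounded[OF f])
  fix n
  have "(\<Sum>j<2^(i0 + m). f j) \<le> (\<Sum>j<2^i0. f j) + \<bar>C\<bar> * (\<Sum>i<m. q ^ i)" for m
  proof (induction m)
    case (Suc m)
    have "{..<2^(i0 + Suc m)} = {..<2^(i0 + m)} \<union> {2^(i0 + m)..<2^Suc (i0 + m) :: nat}" by auto
    then have "(\<Sum>j<2^(i0 + Suc m). f j) = (\<Sum>j<2^(i0 + m). f j) + (\<Sum>j\<in>{2^(i0 + m)..<2^Suc (i0 + m)}. f j)"
      by (simp add: sum.union_disjoint disjoint_iff del: power_Suc)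
    also have "(\<Sum>j\<in>{2^(i0 + m)..<2^Suc (i0 + m)}. f j) \<le> C * q ^ (i0 + m)"
      by (rule block) simp
    \<comment> \<open>The sign of \<open>C\<close> is unknown; the shift by \<open>i0\<close> is
      absorbed because \<open>q < 1\<close>.\<close>
    also have "\<dots> \<le> \<bar>C\<bar> * q ^ m"
      using q by (intro mult_mono power_decreasing) auto
    finally show ?case using Suc by (simp add: distrib_left)
  qed simp
  note * = this[of n]
  have "n < 2 ^ n" by (rule less_exp)
  also have "(2::nat) ^ n \<le> 2 ^ (i0 + n)" by (rule power_increasing) auto
  finally have "(\<Sum>j<n. f j) \<le> (\<Sum>j<2^(i0 + n). f j)"
    using f by (intro sum_mono2) auto
  also note *
  also have "(\<Sum>i<n. q ^ i) \<le> 1 / (1 - q)"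
    using q sum_le_suminf[of "\<lambda>i. q ^ i" "{..<n}"] by (simp add: summable_geometric suminf_geometric)
  finally show "(\<Sum>j<n. f j) \<le> (\<Sum>j<2^i0. f j) + \<bar>C\<bar> * (1 / (1 - q))"
    by (simp add: mult_left_mono)
qed

lemma two_power_powr: "((2::real) ^ i) powr e = (2 powr e) ^ i"
  by (simp add: powr_realpow[symmetric] powr_powr mult.commute)

lemma eventually_ln_powr_le_powr:
  assumes "\<eta> > 0"
  shows "\<forall>\<^sub>F T in at_top. ln T powr \<gamma> \<le> T powr (\<eta> :: real)"
  using assms by real_asymp

lemma finite_frequencies_le:
  fixes lam :: "nat \<Rightarrow> real"
  assumes "filterlim lam at_top sequentially"
  shows "finite {n. lam n \<le> T}"
proof -
  have "\<forall>\<^sub>F n in sequentially. T < lam n"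
    using assms by (rule filterlim_at_top_dense[THEN iffD1, rule_format])
  then have "finite {n. \<not> T < lam n}"
    by (simp add: eventually_cofinite[symmetric] cofinite_eq_sequentially)
  then show ?thesis by (simp add: not_less)
qed

lemma finite_frequencies_block:
  fixes lam :: "nat \<Rightarrow> real"
  assumes "filterlim lam at_top sequentially"
  shows "finite {n. S < lam n \<and> lam n \<le> T}"
  by (rule finite_subset[OF _ finite_frequencies_le[OF assms, of T]]) auto

lemma unit_block_nonneg: "unit_block lam r T \<ge> 0"
  unfolding unit_block_def by (intro sum_nonneg) auto

lemma sum_unit_blocks:
  fixes lam :: "nat \<Rightarrow> real" and g :: "nat \<Rightarrow> real"
  assumes lim: "filterlim lam at_top sequentially" and "M \<le> N"
  shows "(\<Sum>j\<in>{M..<N}. \<Sum>n\<in>{n. real j < lam n \<and> lam n \<le> real j + 1}. g n)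
    = (\<Sum>n\<in>{n. real M < lam n \<and> lam n \<le> real N}. g n)"
  using assms(2)
proof (induction N rule: dec_induct)
  case (step N)
  have "{n. real M < lam n \<and> lam n \<le> real (Suc N)} =
      {n. real M < lam n \<and> lam n \<le> real N} \<union> {n. real N < lam n \<and> lam n \<le> real N + 1}"
    using step(1) by (auto simp: algebra_simps)
  then have "(\<Sum>n\<in>{n. real M < lam n \<and> lam n \<le> real (Suc N)}. g n) =
     (\<Sum>n\<in>{n. real M < lam n \<and> lam n \<le> real N}. g n) + (\<Sum>n\<in>{n. real N < lam n \<and> lam n \<le> real N + 1}. g n)"
    by (simp add: sum.union_disjoint finite_frequencies_block[OF lim] disjoint_iff)
  then show ?case using step by simp
next
  case base
  have "{n. real M < lam n \<and> lam n \<le> real M} = {}" by auto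
  then show ?case by (simp only: atLeastLessThan_empty_iff2 sum.empty) simp
qed

lemma summable_unit_block_of_powr_bound:
  assumes "\<beta> > 1/2" and ev: "\<forall>\<^sub>F T in at_top. unit_block lam r T \<le> C * T powr (- \<beta>)"
  shows "summable (\<lambda>j. (unit_block lam r (real j))\<^sup>2)"
proof (rule summable_comparison_test_ev)
  have "\<forall>\<^sub>F j in sequentially. unit_block lam r (real j) \<le> C * real j powr (- \<beta>)"
    by (rule eventually_compose_filterlim[OF ev filterlim_real_sequentially])
  then show "\<forall>\<^sub>F j in sequentially. norm ((unit_block lam r (real j))\<^sup>2) \<le> C\<^sup>2 * real j powr (- 2 * \<beta>)"
  proof eventually_elim
    case (elim j)
    have "(unit_block lam r (real j))\<^sup>2 \<le> (C * real j powr (- \<beta>))\<^sup>2"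
      by (intro power_mono elim unit_block_nonneg)
    also have "\<dots> = C\<^sup>2 * real j powr (- 2 * \<beta>)"
      by (simp add: power_mult_distrib power2_eq_square flip: powr_add)
    finally show ?case by simp
  qed
  show "summable (\<lambda>j. C\<^sup>2 * real j powr (- 2 * \<beta>))"
    using assms(1) by (intro summable_mult) (simp add: summable_real_powr_iff)
qed

section \<open>Conditions (A) to (D)\<close>

lemma cond_A_summable:
  assumes "cond_A lam r"
  shows "summable (\<lambda>j. (unit_block lam r (real j))\<^sup>2)"
proof -
  obtain \<beta> \<gamma> where \<beta>: "\<beta> > 1/2" and O: "unit_block lam r \<in> O(\<lambda>T. ln T powr \<gamma> / T powr \<beta>)"
    using assms unfolding cond_A_def unit_block_def[abs_def] by auto
  then obtain C where C: "C > 0" and ev: "\<forall>\<^sub>F T in at_top. norm (unit_block lam r T) \<le> C * norm (ln T powr \<gamma> / T powr \<beta>)"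
    by (elim landau_o.bigE)
  \<comment> \<open>Half of the excess of \<open>\<beta>\<close> over 1/2 is spent on absorbing the
    logarithm.\<close>
  define \<eta> where "\<eta> = (\<beta> - 1/2) / 2"
  have "\<eta> > 0" using \<beta> by (simp add: \<eta>_def)
  show ?thesis
  proof (rule summable_unit_block_of_powr_bound)
    show "\<beta> - \<eta> > 1/2" using \<beta> by (simp add: \<eta>_def field_simps)
    show "\<forall>\<^sub>F T in at_top. unit_block lam r T \<le> C * T powr (- (\<beta> - \<eta>))"
      using ev eventually_ln_powr_le_powr[OF \<open>\<eta> > 0\<close>, of \<gamma>]
    proof eventually_elim
      case (elim T)
      have "unit_block lam r T \<le> C * (ln T powr \<gamma> / T powr \<beta>)" using elim(1) by simp
      also have "\<dots> \<le> C * (T powr \<eta> / T powr \<beta>)"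
        using C elim(2) by (intro mult_left_mono divide_right_mono) auto
      finally show ?case by (simp add: powr_diff)
    qed
  qed
qed

text \<open>A block above \<open>T\<close> holds O(log T) terms, each
  O(\<open>T powr (- \<beta>)\<close>), so (A) follows with the same \<open>\<beta>\<close> and
  exponent 1 for the logarithm.\<close>

lemma cond_C_imp_cond_A:
  assumes mono: "strict_mono lam" and "cond_C lam r"
  shows "cond_A lam r"
proof -
  obtain \<beta> where \<beta>: "\<beta> > 1/2" and O: "(\<lambda>n. norm (r n)) \<in> O(\<lambda>n. lam n powr (- \<beta>))"
    and card: "(\<lambda>T. real (card {n. T < lam n \<and> lam n \<le> T + 1})) \<in> O(\<lambda>T. ln T)"
    using assms unfolding cond_C_def by auto
  from O obtain C where C: "C > 0" and ev: "\<forall>\<^sub>F n in sequentially. norm (norm (r n)) \<le> C * norm (lam n powr (- \<beta>))"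
    by (elim landau_o.bigE)
  then obtain n0 where n0: "\<And>n. n \<ge> n0 \<Longrightarrow> norm (r n) \<le> C * lam n powr (- \<beta>)"
    by (auto simp: eventually_sequentially)
  have "(\<lambda>T. \<Sum>n\<in>{n. T < lam n \<and> lam n \<le> T + 1}. norm (r n)) \<in>
      O(\<lambda>T. real (card {n. T < lam n \<and> lam n \<le> T + 1}) * T powr (- \<beta>))"
  proof (rule bigoI[of _ C])
    show "\<forall>\<^sub>F T in at_top. norm (\<Sum>n\<in>{n. T < lam n \<and> lam n \<le> T + 1}. norm (r n))
      \<le> C * norm (real (card {n. T < lam n \<and> lam n \<le> T + 1}) * T powr (- \<beta>))"
      using eventually_gt_at_top[of 0] eventually_ge_at_top[of "lam n0"]
    proof eventually_elim
      case (elim T)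
      have "norm (r n) \<le> C * T powr (- \<beta>)" if "T < lam n" for n
      proof -
        \<comment> \<open>The coefficient bound holds for large indices; monotonicity of
          \<open>lam\<close> turns a large frequency into a large index.\<close>
        have "lam n0 < lam n" using elim that by simp
        then have "n0 \<le> n" using mono by (simp add: strict_mono_less)
        then have "norm (r n) \<le> C * lam n powr (- \<beta>)" by (rule n0)
        also have "\<dots> \<le> C * T powr (- \<beta>)"
          using that elim C \<beta> by (intro mult_left_mono powr_mono2') auto
        finally show ?thesis .
      qed
      then have "(\<Sum>n\<in>{n. T < lam n \<and> lam n \<le> T + 1}. norm (r n)) \<le>
        real (card {n. T < lam n \<and> lam n \<le> T + 1}) * (C * T powr (- \<beta>))"
        by (intro sum_bounded_above) auto
      then show ?case by (simp add: sum_nonneg mult_ac)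
    qed
  qed
  also have "(\<lambda>T. real (card {n. T < lam n \<and> lam n \<le> T + 1}) * T powr (- \<beta>)) \<in> O(\<lambda>T. ln T * T powr (- \<beta>))"
    by (intro landau_o.big.mult card) simp
  also have "(\<lambda>T::real. ln T * T powr (- \<beta>)) \<in> O(\<lambda>T. ln T powr 1 / T powr \<beta>)"
  proof (rule bigoI[of _ 1])
    show "\<forall>\<^sub>F T::real in at_top. norm (ln T * T powr (- \<beta>)) \<le> 1 * norm (ln T powr 1 / T powr \<beta>)"
      using eventually_gt_at_top[of 1] by eventually_elim (simp add: powr_minus_divide)
  qed
  finally show ?thesis using \<beta> unfolding cond_A_def by (intro exI[of _ \<beta>] exI[of _ 1]) auto
qed

text \<open>The hypothesis acts at two scales. At length 1 it bounds each block in the dyadic range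
  at \<open>X\<close> by about \<open>X powr (- \<beta>)\<close>; at length \<open>X\<close> it
  bounds their sum by about \<open>X powr (\<alpha> - \<beta>)\<close>. The sum of squares is at
  most the largest block times the sum, hence \<open>X powr (\<alpha> - 2 * \<beta>)\<close> up to
  logarithms.\<close>

lemma cond_B_summable:
  assumes lim: "filterlim lam at_top sequentially" and "cond_B lam r"
  shows "summable (\<lambda>j. (unit_block lam r (real j))\<^sup>2)"
proof -
  obtain \<alpha> \<beta> \<gamma> M S0 where \<alpha>: "\<alpha> > 0" "\<beta> > 0" "\<gamma> \<ge> 0" "\<alpha>\<^sup>2 + \<alpha> / 2 < \<beta>\<^sup>2 + \<beta>"
    and bd: "\<And>S T. S0 \<le> S \<Longrightarrow> 0 < S \<Longrightarrow> S < T \<Longrightarrow>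
        \<bar>\<Sum>n\<in>{n. S < lam n \<and> lam n \<le> T}. norm (r n)\<bar> \<le> M * \<bar>(T - S) powr \<alpha> * ln T powr \<gamma> / S powr \<beta>\<bar>"
    using assms(2) unfolding cond_B_def by blast
  \<comment> \<open>Otherwise \<open>\<alpha>\<^sup>2 + \<alpha> / 2\<close> would be at least
    \<open>4 * \<beta>\<^sup>2 + \<beta>\<close>, against the inequality between the
    exponents.\<close>
  have "\<alpha> < 2 * \<beta>"
  proof (rule ccontr)
    assume "\<not> \<alpha> < 2 * \<beta>"
    then have "2 * \<beta> \<le> \<alpha>" by simp
    then have "(2 * \<beta>)\<^sup>2 \<le> \<alpha>\<^sup>2" using \<alpha> by (intro power_mono) auto
    then have "4 * \<beta>\<^sup>2 \<le> \<alpha>\<^sup>2" by (simp add: power_mult_distrib)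
    then show False using \<alpha> \<open>2 * \<beta> \<le> \<alpha>\<close> zero_le_power2[of \<beta>] by linarith
  qed
  \<comment> \<open>Each of the two scales contributes a factor of order
    \<open>X powr \<eta>\<close> for its logarithm; a quarter of the gap leaves
    \<open>e = - (2 * \<beta> - \<alpha>) / 2\<close>.\<close>
  define \<eta> where "\<eta> = (2 * \<beta> - \<alpha>) / 4"
  have \<eta>: "\<eta> > 0" using \<open>\<alpha> < 2 * \<beta>\<close> by (simp add: \<eta>_def)
  define e where "e = \<alpha> - 2 * \<beta> + 2 * \<eta>"
  have e: "e < 0" using \<open>\<alpha> < 2 * \<beta>\<close> by (simp add: e_def \<eta>_def field_simps)
  define M' where "M' = \<bar>M\<bar>"
  have bd': "(\<Sum>n\<in>{n. S < lam n \<and> lam n \<le> T}. norm (r n)) \<le> M' * ((T - S) powr \<alpha> * ln T powr \<gamma> / S powr \<beta>)"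
    if "S0 \<le> S" "0 < S" "S < T" for S T
  proof -
    have "(\<Sum>n\<in>{n. S < lam n \<and> lam n \<le> T}. norm (r n)) \<le> M * \<bar>(T - S) powr \<alpha> * ln T powr \<gamma> / S powr \<beta>\<bar>"
      using bd[OF that] by linarith
    also have "\<dots> \<le> M' * ((T - S) powr \<alpha> * ln T powr \<gamma> / S powr \<beta>)"
      unfolding M'_def by (intro mult_mono) (auto simp: abs_mult)
    finally show ?thesis .
  qed
  have lim2: "filterlim (\<lambda>i. (2::real) ^ i) at_top sequentially" by real_asymp
  have "\<forall>\<^sub>F i in sequentially. S0 \<le> 2 ^ i"
    using lim2 by (simp add: filterlim_at_top)
  moreover have "\<forall>\<^sub>F i in sequentially. ln (2 ^ Suc i) powr \<gamma> \<le> (2 ^ Suc i :: real) powr \<eta>"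
    by (rule eventually_compose_filterlim[OF eventually_ln_powr_le_powr[OF \<eta>]])
       (rule filterlim_compose[OF lim2 filterlim_Suc])
  ultimately obtain i0 where i0: "\<And>i. i \<ge> i0 \<Longrightarrow> S0 \<le> 2 ^ i"
      "\<And>i. i \<ge> i0 \<Longrightarrow> ln (2 ^ Suc i) powr \<gamma> \<le> (2 ^ Suc i :: real) powr \<eta>"
    by (auto simp: eventually_sequentially dest: le_trans) (metis nat_le_linear le_trans)
  show ?thesis
  proof (rule summable_dyadic_blocks)
    show "0 \<le> 2 powr e" "2 powr e < 1" using e by (auto simp: powr_less_one)
    fix i assume i: "i \<ge> i0"
    define X where "X = (2::real) ^ i"
    have X: "X > 0" "S0 \<le> X" using i0(1)[OF i] by (simp_all add: X_def)
    define L where "L = (2 * X) powr \<eta>"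
    have L: "ln (2 * X) powr \<gamma> \<le> L" using i0(2)[OF i] by (simp add: L_def X_def)
    have single: "unit_block lam r (real j) \<le> M' * (L / X powr \<beta>)" if "j \<in> {2^i..<2^Suc i}" for j
    proof -
      have "real (2 ^ i) \<le> real j" "real (j + 1) \<le> real (2 ^ Suc i)"
        using that by (auto simp del: of_nat_add of_nat_power power_Suc simp add: of_nat_le_iff)
      then have j: "X \<le> real j" "real j + 1 \<le> 2 * X"
        by (simp_all add: X_def)
      have "unit_block lam r (real j) \<le> M' * ((real j + 1 - real j) powr \<alpha> * ln (real j + 1) powr \<gamma> / real j powr \<beta>)"
        unfolding unit_block_def using j X by (intro bd') auto
      also have "\<dots> = M' * (ln (real j + 1) powr \<gamma> / real j powr \<beta>)" by simp
      also have "\<dots> \<le> M' * (ln (2 * X) powr \<gamma> / X powr \<beta>)"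
        using j X \<alpha> by (intro mult_left_mono frac_le powr_mono2) (auto simp: M'_def)
      also have "\<dots> \<le> M' * (L / X powr \<beta>)"
        using L by (intro mult_left_mono divide_right_mono) (auto simp: M'_def)
      finally show ?thesis .
    qed
    have "(\<Sum>j\<in>{2^i..<2^Suc i}. (unit_block lam r (real j))\<^sup>2) \<le>
        (\<Sum>j\<in>{2^i..<2^Suc i}. M' * (L / X powr \<beta>) * unit_block lam r (real j))"
      unfolding power2_eq_square by (intro sum_mono mult_right_mono single unit_block_nonneg)
    also have "\<dots> = M' * (L / X powr \<beta>) * (\<Sum>n\<in>{n. real (2^i) < lam n \<and> lam n \<le> real (2^Suc i)}. norm (r n))"
      unfolding sum_distrib_left[symmetric] unit_block_def by (subst sum_unit_blocks[OF lim]) auto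
    also have "(\<Sum>n\<in>{n. real (2^i) < lam n \<and> lam n \<le> real (2^Suc i)}. norm (r n))
       = (\<Sum>n\<in>{n. X < lam n \<and> lam n \<le> 2 * X}. norm (r n))" by (simp add: X_def)
    also have "M' * (L / X powr \<beta>) * \<dots> \<le> M' * (L / X powr \<beta>) * (M' * ((2 * X - X) powr \<alpha> * ln (2 * X) powr \<gamma> / X powr \<beta>))"
      using X by (intro mult_left_mono bd') (auto simp: M'_def L_def)
    also have "\<dots> \<le> M' * (L / X powr \<beta>) * (M' * ((2 * X - X) powr \<alpha> * L / X powr \<beta>))"
      using L X by (intro mult_left_mono divide_right_mono) (auto simp: M'_def L_def)
    also have "\<dots> = M'\<^sup>2 * (2 powr \<eta>)\<^sup>2 * (X powr \<alpha> * (X powr \<eta> * X powr \<eta>) / (X powr \<beta> * X powr \<beta>))"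
      using X by (simp add: L_def powr_mult power2_eq_square)
    also have "X powr \<alpha> * (X powr \<eta> * X powr \<eta>) / (X powr \<beta> * X powr \<beta>) = X powr e"
      by (simp add: e_def algebra_simps flip: powr_add powr_diff)
    also have "\<dots> = (2 powr e) ^ i" by (simp add: X_def two_power_powr)
    finally show "(\<Sum>j\<in>{2^i..<2^Suc i}. (unit_block lam r (real j))\<^sup>2) \<le> M'\<^sup>2 * (2 powr \<eta>)\<^sup>2 * (2 powr e) ^ i" .
  qed auto
qed

text \<open>Cauchy--Schwarz within a block costs the number of its terms, which is O(log X). In the
  dyadic range at \<open>X\<close> the weight \<open>(lam n)\<^sup>2\<close> is at least
  \<open>X\<^sup>2\<close>, so the hypothesis gives \<open>X powr (\<theta> - 2)\<close> up to a
  logarithm for the whole range.\<close>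

lemma cond_D_summable:
  assumes lim: "filterlim lam at_top sequentially" and "cond_D lam r"
  shows "summable (\<lambda>j. (unit_block lam r (real j))\<^sup>2)"
proof -
  obtain \<theta> where \<theta>: "0 \<le> \<theta>" "\<theta> < 3 - sqrt 3"
    and card: "(\<lambda>T. real (card {n. T < lam n \<and> lam n \<le> T + 1})) \<in> O(\<lambda>T. ln T)"
    and O: "(\<lambda>T. \<Sum>n\<in>{n. lam n \<le> T}. (lam n)\<^sup>2 * (norm (r n))\<^sup>2) \<in> O(\<lambda>T. T powr \<theta>)"
    using assms(2) unfolding cond_D_def by auto
  have "1 < sqrt 3" by (simp add: real_less_rsqrt)
  then have "\<theta> < 2" using \<theta> by linarith
  \<comment> \<open>Half of the gap pays for the number of frequencies in a block and leaves
    \<open>e = - (2 - \<theta>) / 2\<close>.\<close>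
  define \<eta> where "\<eta> = (2 - \<theta>) / 2"
  have \<eta>: "\<eta> > 0" using \<open>\<theta> < 2\<close> by (simp add: \<eta>_def)
  define e where "e = \<theta> + \<eta> - 2"
  have e: "e < 0" using \<open>\<theta> < 2\<close> by (simp add: e_def \<eta>_def field_simps)
  obtain C1 where C1: "C1 > 0" and ev1: "\<forall>\<^sub>F T in at_top. norm (real (card {n. T < lam n \<and> lam n \<le> T + 1})) \<le> C1 * norm (ln T)"
    using card by (elim landau_o.bigE)
  obtain C2 where C2: "C2 > 0" and ev2: "\<forall>\<^sub>F T in at_top. norm (\<Sum>n\<in>{n. lam n \<le> T}. (lam n)\<^sup>2 * (norm (r n))\<^sup>2) \<le> C2 * norm (T powr \<theta>)"
    using O by (elim landau_o.bigE)
  have "\<forall>\<^sub>F T in at_top. real (card {n. T < lam n \<and> lam n \<le> T + 1}) \<le> C1 * T powr \<eta>"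
    using ev1 eventually_ln_powr_le_powr[OF \<eta>, of 1] eventually_gt_at_top[of 1]
  proof eventually_elim
    case (elim T)
    then have "real (card {n. T < lam n \<and> lam n \<le> T + 1}) \<le> C1 * (ln T powr 1)" by simp
    also have "\<dots> \<le> C1 * T powr \<eta>" using elim C1 by (intro mult_left_mono) auto
    finally show ?case .
  qed
  moreover have "\<forall>\<^sub>F T in at_top. (\<Sum>n\<in>{n. lam n \<le> T}. (lam n)\<^sup>2 * (norm (r n))\<^sup>2) \<le> C2 * T powr \<theta>"
    using ev2 by eventually_elim (simp add: abs_le_iff)
  ultimately have "\<forall>\<^sub>F T in at_top. real (card {n. T < lam n \<and> lam n \<le> T + 1}) \<le> C1 * T powr \<eta> \<and>
      (\<Sum>n\<in>{n. lam n \<le> T}. (lam n)\<^sup>2 * (norm (r n))\<^sup>2) \<le> C2 * T powr \<theta>"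
    by eventually_elim auto
  then obtain T0 where T0: "\<And>T. T \<ge> T0 \<Longrightarrow> real (card {n. T < lam n \<and> lam n \<le> T + 1}) \<le> C1 * T powr \<eta>"
      "\<And>T. T \<ge> T0 \<Longrightarrow> (\<Sum>n\<in>{n. lam n \<le> T}. (lam n)\<^sup>2 * (norm (r n))\<^sup>2) \<le> C2 * T powr \<theta>"
    by (auto simp: eventually_at_top_linorder)
  have lim2: "filterlim (\<lambda>i. (2::real) ^ i) at_top sequentially" by real_asymp
  then have "\<forall>\<^sub>F i in sequentially. T0 \<le> 2 ^ i"
    by (simp add: filterlim_at_top)
  then obtain i0 where i0: "\<And>i. i \<ge> i0 \<Longrightarrow> T0 \<le> 2 ^ i"
    by (auto simp: eventually_sequentially)
  show ?thesis
  proof (rule summable_dyadic_blocks)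
    show "0 \<le> 2 powr e" "2 powr e < 1" using e by (auto simp: powr_less_one)
    fix i assume i: "i \<ge> i0"
    define X where "X = (2::real) ^ i"
    have X: "X > 0" "T0 \<le> X" "X \<ge> 1"
      using i0(1)[OF i] by (simp_all add: X_def)
    define a where "a j = (\<Sum>n\<in>{n. real j < lam n \<and> lam n \<le> real j + 1}. (lam n)\<^sup>2 * (norm (r n))\<^sup>2)" for j
    have single: "(unit_block lam r (real j))\<^sup>2 \<le> C1 * (2 * X) powr \<eta> / X\<^sup>2 * a j" if "j \<in> {2^i..<2^Suc i}" for j
    proof -
      have "real (2 ^ i) \<le> real j" "real (j + 1) \<le> real (2 ^ Suc i)"
        using that by (auto simp del: of_nat_add of_nat_power power_Suc simp add: of_nat_le_iff)
      then have j: "X \<le> real j" "real j + 1 \<le> 2 * X"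
        by (simp_all add: X_def)
      let ?B = "{n. real j < lam n \<and> lam n \<le> real j + 1}"
      have "(unit_block lam r (real j))\<^sup>2 \<le> (\<Sum>n\<in>?B. (norm (r n))\<^sup>2) * real (card ?B)"
        unfolding unit_block_def by (rule sum_squared_le_sum_of_squares)
      also have "\<dots> \<le> (a j / X\<^sup>2) * (C1 * (2 * X) powr \<eta>)"
      proof (rule mult_mono)
        have "(norm (r n))\<^sup>2 \<le> (lam n)\<^sup>2 * (norm (r n))\<^sup>2 / X\<^sup>2" if "n \<in> ?B" for n
        proof -
          have "X\<^sup>2 \<le> (lam n)\<^sup>2" using that j X by (intro power_mono) auto
          then have "X\<^sup>2 * (norm (r n))\<^sup>2 \<le> (lam n)\<^sup>2 * (norm (r n))\<^sup>2" by (rule mult_right_mono) simp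
          then show ?thesis using X by (simp add: field_simps)
        qed
        then show "(\<Sum>n\<in>?B. (norm (r n))\<^sup>2) \<le> a j / X\<^sup>2"
          unfolding a_def sum_divide_distrib by (rule sum_mono)
        have "real (card ?B) \<le> C1 * real j powr \<eta>" using j X by (intro T0) auto
        also have "\<dots> \<le> C1 * (2 * X) powr \<eta>" using j X C1 \<eta> by (intro mult_left_mono powr_mono2) auto
        finally show "real (card ?B) \<le> C1 * (2 * X) powr \<eta>" .
      qed (auto simp: a_def intro!: sum_nonneg divide_nonneg_nonneg)
      finally show ?thesis by (simp add: mult_ac)
    qed
    have "(\<Sum>j\<in>{2^i..<2^Suc i}. (unit_block lam r (real j))\<^sup>2) \<le> (\<Sum>j\<in>{2^i..<2^Suc i}. C1 * (2 * X) powr \<eta> / X\<^sup>2 * a j)"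
      by (intro sum_mono single)
    also have "\<dots> = C1 * (2 * X) powr \<eta> / X\<^sup>2 * (\<Sum>n\<in>{n. real (2^i) < lam n \<and> lam n \<le> real (2^Suc i)}. (lam n)\<^sup>2 * (norm (r n))\<^sup>2)"
      unfolding sum_distrib_left[symmetric] a_def by (subst sum_unit_blocks[OF lim]) auto
    also have "\<dots> \<le> C1 * (2 * X) powr \<eta> / X\<^sup>2 * (\<Sum>n\<in>{n. lam n \<le> 2 * X}. (lam n)\<^sup>2 * (norm (r n))\<^sup>2)"
      using C1 by (intro mult_left_mono sum_mono2 finite_frequencies_le[OF lim]) (auto simp: X_def)
    also have "\<dots> \<le> C1 * (2 * X) powr \<eta> / X\<^sup>2 * (C2 * (2 * X) powr \<theta>)"
      using C1 X by (intro mult_left_mono T0) auto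
    also have "\<dots> = C1 * C2 * 2 powr \<eta> * 2 powr \<theta> * (X powr \<theta> * X powr \<eta> / X powr 2)"
      using X by (simp add: powr_mult powr_numeral)
    also have "X powr \<theta> * X powr \<eta> / X powr 2 = X powr e"
      unfolding e_def powr_diff powr_add by simp
    also have "\<dots> = (2 powr e) ^ i" by (simp add: X_def two_power_powr)
    finally show "(\<Sum>j\<in>{2^i..<2^Suc i}. (unit_block lam r (real j))\<^sup>2) \<le> C1 * C2 * 2 powr \<eta> * 2 powr \<theta> * (2 powr e) ^ i" .
  qed auto
qed

section \<open>Approximation in density\<close>

text \<open>One \<open>e\<close> bounds both the error and the density of the exceptional set, and
  \<open>Y\<close> is large depending on \<open>T\<close>. A set outside
  \<open>sets lebesgue\<close> has \<open>emeasure\<close> 0, so measurability has to be supplied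
  wherever the bound is used.\<close>

definition approximable_in_density :: "(real \<Rightarrow> 'a::real_normed_vector) \<Rightarrow> (real \<Rightarrow> real \<Rightarrow> 'a) \<Rightarrow> bool" where
  "approximable_in_density phi P \<longleftrightarrow> (\<forall>e>0. \<forall>\<^sub>F T in at_top. \<forall>\<^sub>F Y in at_top.
     emeasure lebesgue {y\<in>{0..Y}. e \<le> norm (phi y - P T y)} \<le> ennreal (e * Y))"

text \<open>Chebyshev's inequality for a function known to be measurable on \<open>A\<close> only:
  the indicator is put inside the square before Markov's inequality is applied.\<close>

lemma markov_square:
  fixes f :: "'a \<Rightarrow> real"
  assumes [measurable]: "(\<lambda>y. indicator A y * f y) \<in> borel_measurable M" "A \<in> sets M" and "e > 0" "B \<ge> 0"
    and le: "(\<integral>\<^sup>+y\<in>A. ennreal ((f y)\<^sup>2) \<partial>M) \<le> ennreal B"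
  shows "emeasure M {y\<in>A. e \<le> \<bar>f y\<bar>} \<le> ennreal (B / e\<^sup>2)"
proof -
  let ?g = "\<lambda>y. ennreal ((indicator A y * f y)\<^sup>2)"
  have eq: "{y\<in>A. e \<le> \<bar>f y\<bar>} = {y\<in>A. 1 \<le> ennreal (1 / e\<^sup>2) * ?g y}"
  proof -
    have "e \<le> \<bar>f y\<bar> \<longleftrightarrow> 1 \<le> ennreal (1 / e\<^sup>2) * ?g y" if "y \<in> A" for y
    proof -
      have "e \<le> \<bar>f y\<bar> \<longleftrightarrow> e\<^sup>2 \<le> (f y)\<^sup>2"
        using \<open>e > 0\<close> by (metis abs_le_square_iff abs_of_pos)
      also have "\<dots> \<longleftrightarrow> 1 \<le> 1 / e\<^sup>2 * (f y)\<^sup>2" using \<open>e > 0\<close> by (simp add: field_simps)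
      also have "\<dots> \<longleftrightarrow> 1 \<le> ennreal (1 / e\<^sup>2) * ?g y"
        using that by (simp add: ennreal_mult[symmetric] del: ennreal_1 add: ennreal_1[symmetric])
      finally show ?thesis .
    qed
    then show ?thesis by blast
  qed
  have "emeasure M {y\<in>A. e \<le> \<bar>f y\<bar>} \<le> ennreal (1 / e\<^sup>2) * (\<integral>\<^sup>+y\<in>A. ?g y \<partial>M)"
    unfolding eq by (rule nn_integral_Markov_inequality) auto
  also have "(\<integral>\<^sup>+y\<in>A. ?g y \<partial>M) = (\<integral>\<^sup>+y\<in>A. ennreal ((f y)\<^sup>2) \<partial>M)"
    by (intro nn_integral_cong) (auto simp: indicator_def)
  also have "ennreal (1 / e\<^sup>2) * \<dots> \<le> ennreal (1 / e\<^sup>2) * ennreal B"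
    by (rule mult_left_mono[OF le]) simp
  also have "\<dots> = ennreal (B / e\<^sup>2)" using \<open>B \<ge> 0\<close> by (simp add: ennreal_mult[symmetric])
  finally show ?thesis .
qed

text \<open>The bound is uniform over finite sets beyond \<open>N\<close>, since the blocks met
  below \<open>exp Y\<close> vary with \<open>Y\<close>.\<close>

lemma summable_tail_sums_le:
  fixes f :: "nat \<Rightarrow> real"
  assumes "summable f" "\<And>j. f j \<ge> 0" "d > 0"
  obtains N where "\<And>J. finite J \<Longrightarrow> J \<subseteq> {N..} \<Longrightarrow> sum f J \<le> d"
proof -
  obtain N where N: "\<And>n. n \<ge> N \<Longrightarrow> norm (\<Sum>i. f (i + n)) < d"
    using suminf_exist_split[OF assms(3,1)] by auto
  have "sum f J \<le> d" if "finite J" "J \<subseteq> {N..}" for J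
  proof -
    have "sum f J = (\<Sum>i\<in>(\<lambda>j. j - N) ` J. f (i + N))"
      using that by (intro sum.reindex_cong[symmetric, of "\<lambda>j. j - N", OF _ refl])
        (auto simp: subset_iff intro!: inj_on_diff_nat)
    also have "\<dots> \<le> (\<Sum>i. f (i + N))"
      using assms that by (intro sum_le_suminf) (auto simp: summable_iff_shift)
    also have "\<dots> \<le> d" using N[of N] by simp
    finally show ?thesis .
  qed
  then show thesis using that by blast
qed

lemma trig_sum_split:
  assumes lim: "filterlim lam at_top sequentially" and "T \<le> X"
  shows "trig_sum lam r {n. lam n \<le> X} y = trig_sum lam r {n. lam n \<le> T} y + trig_sum lam r {n. T < lam n \<and> lam n \<le> X} y"
proof -
  have "{n. lam n \<le> X} = {n. lam n \<le> T} \<union> {n. T < lam n \<and> lam n \<le> X}" using assms(2) by auto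
  then show ?thesis
    unfolding trig_sum_def
    by (simp add: sum.union_disjoint finite_frequencies_le[OF lim] finite_frequencies_block[OF lim] disjoint_iff)
qed

text \<open>At \<open>X = exp Y\<close> the expansion leaves, besides the terms up to
  \<open>T\<close>, the frequencies between \<open>T\<close> and \<open>exp Y\<close> and the error
  term. Both are small in mean square over the interval, the former uniformly in \<open>Y\<close> by
  the sieve, and Chebyshev's inequality with threshold \<open>e / 2\<close> treats each. The initial
  interval up to \<open>y0\<close> is discarded.\<close>

lemma approximable_in_density_of_expansion:
  fixes phi :: "real \<Rightarrow> real"
  assumes pos: "\<And>n. lam n > 0" and lim: "filterlim lam at_top sequentially"
    and summ: "summable (\<lambda>j. (unit_block lam r (real j))\<^sup>2)"
    and y0: "y0 \<ge> 0"
    and expan: "\<And>y X. y \<ge> y0 \<Longrightarrow> X \<ge> X0 \<Longrightarrow> phi y = c + Re (trig_sum lam r {n. lam n \<le> X} y) + E y X"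
    and meas: "\<And>X. X \<ge> X0 \<Longrightarrow> set_borel_measurable lebesgue {y0..} (\<lambda>y. E y X)"
    and int: "\<forall>\<^sub>F Y in at_top. set_integrable lebesgue {y0..Y} (\<lambda>y. \<bar>E y (exp Y)\<bar>\<^sup>2)"
    and E: "((\<lambda>Y. (1 / Y) * (LINT y:{y0..Y}|lebesgue. \<bar>E y (exp Y)\<bar>\<^sup>2)) \<longlongrightarrow> 0) at_top"
  shows "approximable_in_density phi (\<lambda>T y. c + Re (trig_sum lam r {n. lam n \<le> T} y))"
  unfolding approximable_in_density_def
proof (intro allI impI)
  fix e :: real assume e: "e > 0"
  \<comment> \<open>Chebyshev with threshold \<open>e / 2\<close> turns \<open>108 * d * Y\<close>
    into \<open>432 * d * Y / e ^ 2\<close>, which is to equal \<open>e * Y / 3\<close>. In the same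
    way \<open>e ^ 3 / 12\<close> below yields another third.\<close>
  define d where "d = e ^ 3 / 1296"
  have d: "d > 0" using e by (simp add: d_def)
  obtain N where N: "\<And>J. finite J \<Longrightarrow> J \<subseteq> {N..} \<Longrightarrow> (\<Sum>j\<in>J. (unit_block lam r (real j))\<^sup>2) \<le> d"
    using summable_tail_sums_le[OF summ _ d] by auto
  show "\<forall>\<^sub>F T in at_top. \<forall>\<^sub>F Y in at_top.
     emeasure lebesgue {y\<in>{0..Y}. e \<le> norm (phi y - (c + Re (trig_sum lam r {n. lam n \<le> T} y)))} \<le> ennreal (e * Y)"
    using eventually_ge_at_top[of "real N"]
  proof eventually_elim
    fix T assume T: "real N \<le> T"
    have small: "\<forall>\<^sub>F Y in at_top. (1 / Y) * (LINT y:{y0..Y}|lebesgue. \<bar>E y (exp Y)\<bar>\<^sup>2) < e ^ 3 / 12"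
      using e by (intro order_tendstoD(2)[OF E]) simp
    have exp_large: "\<forall>\<^sub>F Y :: real in at_top. max X0 T \<le> exp Y"
      using exp_at_top unfolding filterlim_at_top by blast
    show "\<forall>\<^sub>F Y in at_top.
     emeasure lebesgue {y\<in>{0..Y}. e \<le> norm (phi y - (c + Re (trig_sum lam r {n. lam n \<le> T} y)))} \<le> ennreal (e * Y)"
      \<comment> \<open>The threshold \<open>3 * y0 / e\<close> makes the discarded interval at most
        a third of \<open>e * Y\<close>.\<close>
      using small exp_large int eventually_ge_at_top[of 1] eventually_ge_at_top[of "3 * y0 / e"]
    proof eventually_elim
      case (elim Y)
      define F where "F = {n. T < lam n \<and> lam n \<le> exp Y}"
      have F: "finite F" unfolding F_def by (rule finite_frequencies_block[OF lim])
      define J where "J = (\<lambda>n. nat \<lceil>lam n\<rceil> - 1) ` F"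
      \<comment> \<open>Frequencies above \<open>T \<ge> N\<close> lie in blocks numbered at least
        \<open>N\<close>, where the tail bound holds.\<close>
      have J: "finite J" "J \<subseteq> {N..}" using F T unfolding J_def F_def by (auto, linarith)
      have "(\<integral>\<^sup>+y\<in>{0..Y}. ennreal ((norm (trig_sum lam r F y))\<^sup>2) \<partial>lborel)
          \<le> ennreal (Y * (108 * (\<Sum>j\<in>J. (unit_block lam r (real j))\<^sup>2)))"
        using elim J by (intro mean_square_trig_sum_le F pos finite_frequencies_block[OF lim]) (auto simp: J_def)
      also have "\<dots> \<le> ennreal (Y * (108 * d))"
        using elim N[OF J] by (intro ennreal_leI mult_left_mono) auto
      finally have tr: "(\<integral>\<^sup>+y\<in>{0..Y}. ennreal ((norm (trig_sum lam r F y))\<^sup>2) \<partial>lebesgue) \<le> ennreal (Y * (108 * d))"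
        by (simp add: nn_integral_completion)
      have set1: "emeasure lebesgue {y\<in>{0..Y}. e / 2 \<le> \<bar>norm (trig_sum lam r F y)\<bar>} \<le> ennreal (Y * (108 * d) / (e / 2)\<^sup>2)"
        using e d elim by (intro markov_square tr) (auto intro!: measurable_completion)
      \<comment> \<open>\<open>E\<close> is measurable only on \<open>{y0..}\<close>, so the
        indicator is kept throughout.\<close>
      have "set_borel_measurable lebesgue {y0..} (\<lambda>y. E y (exp Y))" using elim by (intro meas) auto
      then have "(\<lambda>y. indicator {y0..Y} y * (indicator {y0..} y * E y (exp Y))) \<in> borel_measurable lebesgue"
        unfolding set_borel_measurable_def real_scaleR_def
        by (rule borel_measurable_times[OF borel_measurable_indicator, rotated]) simp
      also have "(\<lambda>y. indicator {y0..Y} y * (indicator {y0..} y * E y (exp Y))) = (\<lambda>y. indicator {y0..Y} y * E y (exp Y))"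
        by (auto simp: indicator_def fun_eq_iff)
      finally have Em: "(\<lambda>y. indicator {y0..Y} y * E y (exp Y)) \<in> borel_measurable lebesgue" .
      have Eint: "(\<integral>\<^sup>+y\<in>{y0..Y}. ennreal ((E y (exp Y))\<^sup>2) \<partial>lebesgue) \<le> ennreal (Y * (e ^ 3 / 12))"
      proof -
        have "(\<integral>\<^sup>+y\<in>{y0..Y}. ennreal ((E y (exp Y))\<^sup>2) \<partial>lebesgue) = (\<integral>\<^sup>+y. ennreal (indicator {y0..Y} y *\<^sub>R \<bar>E y (exp Y)\<bar>\<^sup>2) \<partial>lebesgue)"
          by (intro nn_integral_cong) (auto simp: indicator_def)
        also have "\<dots> = ennreal (LINT y:{y0..Y}|lebesgue. \<bar>E y (exp Y)\<bar>\<^sup>2)"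
          using elim(3) unfolding set_integrable_def set_lebesgue_integral_def
          by (intro nn_integral_eq_integral) auto
        also have "\<dots> \<le> ennreal (Y * (e ^ 3 / 12))"
          using elim by (intro ennreal_leI) (simp add: field_simps)
        finally show ?thesis .
      qed
      have set2: "emeasure lebesgue {y\<in>{y0..Y}. e / 2 \<le> \<bar>E y (exp Y)\<bar>} \<le> ennreal (Y * (e ^ 3 / 12) / (e / 2)\<^sup>2)"
        using e elim by (intro markov_square Eint Em) auto
      have sub: "{y\<in>{0..Y}. e \<le> norm (phi y - (c + Re (trig_sum lam r {n. lam n \<le> T} y)))}
        \<subseteq> {0..y0} \<union> {y\<in>{0..Y}. e / 2 \<le> \<bar>norm (trig_sum lam r F y)\<bar>} \<union> {y\<in>{y0..Y}. e / 2 \<le> \<bar>E y (exp Y)\<bar>}"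
      proof
        fix y assume y: "y \<in> {y\<in>{0..Y}. e \<le> norm (phi y - (c + Re (trig_sum lam r {n. lam n \<le> T} y)))}"
        show "y \<in> {0..y0} \<union> {y\<in>{0..Y}. e / 2 \<le> \<bar>norm (trig_sum lam r F y)\<bar>} \<union> {y\<in>{y0..Y}. e / 2 \<le> \<bar>E y (exp Y)\<bar>}"
        proof (cases "y \<le> y0")
          case False
          then have "phi y - (c + Re (trig_sum lam r {n. lam n \<le> T} y)) = Re (trig_sum lam r F y) + E y (exp Y)"
            using expan[of y "exp Y"] trig_sum_split[OF lim, of T "exp Y" r y] elim by (simp add: F_def)
          then have "e \<le> norm (trig_sum lam r F y) + \<bar>E y (exp Y)\<bar>"
            using y abs_Re_le_cmod[of "trig_sum lam r F y"] by auto
          then show ?thesis using y False by auto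
        qed (use y in auto)
      qed
      have s0: "{0..y0} \<in> sets lebesgue" by simp
      have s1: "{y\<in>{0..Y}. e / 2 \<le> \<bar>norm (trig_sum lam r F y)\<bar>} \<in> sets lebesgue"
        by (rule sets_completionI_sets) measurable
      have s2: "{y\<in>{y0..Y}. e / 2 \<le> \<bar>E y (exp Y)\<bar>} \<in> sets lebesgue"
      proof -
        have "{y\<in>{y0..Y}. e / 2 \<le> \<bar>E y (exp Y)\<bar>} = {y\<in>space lebesgue. e / 2 \<le> norm (indicator {y0..Y} y * E y (exp Y))}"
          using e by (auto simp: indicator_def split: if_splits)
        also have "\<dots> \<in> sets lebesgue"
          by (rule borel_measurable_le[OF borel_measurable_const measurable_compose[OF Em borel_measurable_norm]])
        finally show ?thesis .
      qed
      have "emeasure lebesgue {y\<in>{0..Y}. e \<le> norm (phi y - (c + Re (trig_sum lam r {n. lam n \<le> T} y)))}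
        \<le> emeasure lebesgue ({0..y0} \<union> {y\<in>{0..Y}. e / 2 \<le> \<bar>norm (trig_sum lam r F y)\<bar>} \<union> {y\<in>{y0..Y}. e / 2 \<le> \<bar>E y (exp Y)\<bar>})"
        by (intro emeasure_mono[OF sub] sets.Un s0 s1 s2)
      also have "\<dots> \<le> emeasure lebesgue {0..y0} + emeasure lebesgue {y\<in>{0..Y}. e / 2 \<le> \<bar>norm (trig_sum lam r F y)\<bar>}
          + emeasure lebesgue {y\<in>{y0..Y}. e / 2 \<le> \<bar>E y (exp Y)\<bar>}"
        by (rule order_trans[OF emeasure_subadditive[OF sets.Un[OF s0 s1] s2] add_right_mono[OF emeasure_subadditive[OF s0 s1]]])
      also have "\<dots> \<le> ennreal y0 + ennreal (Y * (108 * d) / (e / 2)\<^sup>2) + ennreal (Y * (e ^ 3 / 12) / (e / 2)\<^sup>2)"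
        using y0 by (intro add_mono set1 set2) simp
      also have "\<dots> = ennreal (y0 + Y * (108 * d) / (e / 2)\<^sup>2 + Y * (e ^ 3 / 12) / (e / 2)\<^sup>2)"
        using y0 e d elim by (simp flip: ennreal_plus)
      also have "\<dots> \<le> ennreal (e * Y)"
      proof (rule ennreal_leI)
        have "Y * (108 * d) / (e / 2)\<^sup>2 = e * Y / 3" "Y * (e ^ 3 / 12) / (e / 2)\<^sup>2 = e * Y / 3"
          using e by (simp_all add: d_def field_simps power2_eq_square power3_eq_cube)
        moreover have "y0 \<le> e * Y / 3" using elim e by (simp add: field_simps)
        ultimately show "y0 + Y * (108 * d) / (e / 2)\<^sup>2 + Y * (e ^ 3 / 12) / (e / 2)\<^sup>2 \<le> e * Y" by simp
      qed
      finally show ?case .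
    qed
  qed
qed

lemma approximable_in_density_vec:
  fixes phi :: "real \<Rightarrow> real ^ 'l"
  assumes "\<And>k. approximable_in_density (\<lambda>y. phi y $ k) (\<lambda>T y. P T y $ k)"
    and "\<And>T k. (\<lambda>y. indicator {0..} y * (phi y $ k - P T y $ k)) \<in> borel_measurable lebesgue"
  shows "approximable_in_density phi P"
  unfolding approximable_in_density_def
proof (intro allI impI)
  fix e :: real assume e: "e > 0"
  \<comment> \<open>An error of at least \<open>e\<close> forces some coordinate to err by at least
    \<open>d\<close>; the same factor \<open>CARD('l)\<close> pays for the union of the exceptional
    sets.\<close>
  define d where "d = e / real CARD('l)"
  have d: "d > 0" "d * real CARD('l) = e" using e by (auto simp: d_def)
  have "\<forall>\<^sub>F T in at_top. \<forall>k. \<forall>\<^sub>F Y in at_top. emeasure lebesgue {y\<in>{0..Y}. d \<le> norm (phi y $ k - P T y $ k)} \<le> ennreal (d * Y)"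
    using assms d unfolding approximable_in_density_def by (intro eventually_all_finite) auto
  then show "\<forall>\<^sub>F T in at_top. \<forall>\<^sub>F Y in at_top. emeasure lebesgue {y\<in>{0..Y}. e \<le> norm (phi y - P T y)} \<le> ennreal (e * Y)"
  proof eventually_elim
    case (elim T)
    then have "\<forall>\<^sub>F Y in at_top. \<forall>k. emeasure lebesgue {y\<in>{0..Y}. d \<le> norm (phi y $ k - P T y $ k)} \<le> ennreal (d * Y)"
      by (intro eventually_all_finite) auto
    then show ?case using eventually_ge_at_top[of 0]
    proof eventually_elim
      case (elim Y)
      let ?A = "\<lambda>k. {y\<in>{0..Y}. d \<le> norm (phi y $ k - P T y $ k)}"
      have sets: "?A k \<in> sets lebesgue" for k
      proof -
        have "?A k = {0..Y} \<inter> {y\<in>space lebesgue. d \<le> norm (indicator {0..} y * (phi y $ k - P T y $ k))}"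
          by (auto simp: indicator_def)
        also have "\<dots> \<in> sets lebesgue"
          using borel_measurable_le[OF borel_measurable_const measurable_compose[OF assms(2)[where T=T and k=k] borel_measurable_norm]]
          by (intro sets.Int) auto
        finally show ?thesis .
      qed
      have "{y\<in>{0..Y}. e \<le> norm (phi y - P T y)} \<subseteq> (\<Union>k. ?A k)"
      proof
        fix y assume y: "y \<in> {y\<in>{0..Y}. e \<le> norm (phi y - P T y)}"
        show "y \<in> (\<Union>k. ?A k)"
        proof (rule ccontr)
          assume "y \<notin> (\<Union>k. ?A k)"
          then have "\<bar>(phi y - P T y) $ k\<bar> < d" for k using y by (auto simp: not_le)
          then have "(\<Sum>k\<in>(UNIV :: 'l set). \<bar>(phi y - P T y) $ k\<bar>) < (\<Sum>k\<in>(UNIV :: 'l set). d)"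
            by (intro sum_strict_mono) auto
          then show False using norm_le_l1_cart[of "phi y - P T y"] y d by (simp add: mult.commute)
        qed
      qed
      then have "emeasure lebesgue {y\<in>{0..Y}. e \<le> norm (phi y - P T y)} \<le> emeasure lebesgue (\<Union>k. ?A k)"
        by (intro emeasure_mono sets.finite_UN sets finite)
      also have "\<dots> \<le> (\<Sum>k\<in>UNIV. emeasure lebesgue (?A k))"
        using sets by (intro emeasure_subadditive_finite finite) blast
      also have "\<dots> \<le> (\<Sum>k\<in>(UNIV :: 'l set). ennreal (d * Y))"
        using elim(1) by (intro sum_mono) blast
      also have "\<dots> = ennreal (e * Y)"
      proof -
        have "(\<Sum>k\<in>(UNIV :: 'l set). ennreal (d * Y)) = ennreal (\<Sum>k\<in>(UNIV :: 'l set). d * Y)"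
          using d(1) elim(2) by (intro sum_ennreal) simp
        also have "(\<Sum>k\<in>(UNIV :: 'l set). d * Y) = (d * real CARD('l)) * Y" by simp
        finally show ?thesis unfolding d(2) .
      qed
      finally show ?case .
    qed
  qed
qed

section \<open>Almost periodic functions and their mean values\<close>

text \<open>Bohr's almost periodic functions with spectrum in \<open>L\<close>. Being generated
  inductively, they inherit a property that holds for characters and survives sums, multiples and
  uniform limits. Keeping \<open>L\<close> visible is what lets independence of frequencies
  act.\<close>

inductive almost_periodic :: "real set \<Rightarrow> (real \<Rightarrow> complex) \<Rightarrow> bool" for L where
  char: "\<mu> \<in> L \<Longrightarrow> almost_periodic L (\<lambda>y. cis (\<mu> * y))"
| add: "almost_periodic L F \<Longrightarrow> almost_periodic L G \<Longrightarrow> almost_periodic L (\<lambda>y. F y + G y)"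
| cmult: "almost_periodic L F \<Longrightarrow> almost_periodic L (\<lambda>y. a * F y)"
| limit: "(\<And>e. e > 0 \<Longrightarrow> \<exists>G. almost_periodic L G \<and> (\<forall>y. norm (F y - G y) \<le> e)) \<Longrightarrow> almost_periodic L F"

lemma almost_periodic_bounded:
  assumes "almost_periodic L F"
  obtains B where "B > 0" "\<And>y. norm (F y) \<le> B"
proof -
  have "\<exists>B>0. \<forall>y. norm (F y) \<le> B"
    using assms
  proof induction
    case (char \<mu>)
    show ?case by (intro exI[of _ 1]) auto
  next
    case (add F G)
    then obtain B C where "B > 0" "C > 0" "\<And>y. norm (F y) \<le> B" "\<And>y. norm (G y) \<le> C" by blast
    then show ?case by (intro exI[of _ "B + C"]) (auto intro: norm_triangle_mono)
  next
    case (cmult F a)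
    then obtain B where "B > 0" "\<And>y. norm (F y) \<le> B" by blast
    then show ?case by (intro exI[of _ "norm a * B + 1"])
      (auto simp: norm_mult add_nonneg_pos intro!: mult_left_mono add_increasing2)
  next
    case (limit F)
    from limit[of 1] obtain G B where "B > 0" "\<And>y. norm (F y - G y) \<le> 1" "\<And>y. norm (G y) \<le> B" by auto
    then have "norm (F y) \<le> B + 1" for y
      using norm_triangle_sub[of "F y" "G y"] by (smt (verit))
    then show ?case using \<open>B > 0\<close> by (intro exI[of _ "B + 1"]) auto
  qed
  then show thesis using that by blast
qed

lemma almost_periodic_continuous:
  assumes "almost_periodic L F"
  shows "continuous_on S F"
proof -
  have "continuous_on UNIV F"
    using assms
  proof induction
    case (limit F)
    have "\<exists>G. continuous_on UNIV G \<and> (\<forall>y. norm (F y - G y) \<le> inverse (real (Suc n)))" for n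
      using limit[of "inverse (real (Suc n))"] by auto
    then obtain G where G: "\<And>n. continuous_on UNIV (G n)" "\<And>n y. norm (F y - G n y) \<le> inverse (real (Suc n))"
      by metis
    have "uniform_limit UNIV G F sequentially"
      unfolding uniform_limit_iff
    proof (intro allI impI)
      fix e :: real assume "e > 0"
      then have "\<forall>\<^sub>F n in sequentially. inverse (real (Suc n)) < e"
        using LIMSEQ_inverse_real_of_nat by (rule order_tendstoD(2)[rotated])
      then show "\<forall>\<^sub>F n in sequentially. \<forall>x\<in>UNIV. dist (G n x) (F x) < e"
        by eventually_elim (metis G(2) dist_commute dist_norm order_le_less_trans)
    qed
    then show ?case using G(1) by (intro uniform_limit_theorem[of _ G sequentially]) auto
  qed (auto intro!: continuous_intros)
  then show ?thesis by (rule continuous_on_subset) auto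
qed

text \<open>Frequencies matter only for two characters, whose product is the character at the sum.
  Linearity and uniform limits in each factor do the rest; a limit in \<open>F\<close> uses that
  \<open>G\<close> is bounded.\<close>

lemma almost_periodic_mult:
  assumes F: "almost_periodic L1 F" and G: "almost_periodic L2 G"
    and L: "\<And>a b. a \<in> L1 \<Longrightarrow> b \<in> L2 \<Longrightarrow> a + b \<in> L"
  shows "almost_periodic L (\<lambda>y. F y * G y)"
  using F
proof induction
  case (char \<mu>)
  show ?case using G
  proof induction
    case (char \<nu>)
    have "almost_periodic L (\<lambda>y. cis ((\<mu> + \<nu>) * y))"
      using L \<open>\<mu> \<in> L1\<close> char by (intro almost_periodic.char)
    then show ?case by (simp add: cis_mult distrib_right)
  next
    case (add G H)
    then show ?case by (simp add: distrib_left almost_periodic.add)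
  next
    case (cmult G a)
    from almost_periodic.cmult[OF cmult.IH, of a] show ?case by (simp add: mult_ac)
  next
    case (limit G)
    show ?case
    proof (rule almost_periodic.limit)
      fix e :: real assume "e > 0"
      from limit[OF this] obtain H where H: "almost_periodic L (\<lambda>y. cis (\<mu> * y) * H y)" "\<And>y. norm (G y - H y) \<le> e"
        by blast
      then have "norm (cis (\<mu> * y) * G y - cis (\<mu> * y) * H y) \<le> e" for y
        by (simp add: norm_mult flip: right_diff_distrib)
      with H(1) show "\<exists>K. almost_periodic L K \<and> (\<forall>y. norm (cis (\<mu> * y) * G y - K y) \<le> e)" by blast
    qed
  qed
next
  case (add F H)
  then show ?case by (simp add: distrib_right almost_periodic.add)
next
  case (cmult F a)
  from almost_periodic.cmult[OF cmult.IH, of a] show ?case by (simp add: mult_ac)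
next
  case (limit F)
  obtain B where B: "B > 0" "\<And>y. norm (G y) \<le> B" using almost_periodic_bounded[OF G] by blast
  show ?case
  proof (rule almost_periodic.limit)
    fix e :: real assume "e > 0"
    then have "e / B > 0" using B by simp
    from limit[OF this] obtain H where H: "almost_periodic L (\<lambda>y. H y * G y)" "\<And>y. norm (F y - H y) \<le> e / B"
      by blast
    have "norm (F y * G y - H y * G y) \<le> e" for y
    proof -
      have "norm (F y * G y - H y * G y) = norm (F y - H y) * norm (G y)"
        by (simp add: norm_mult flip: left_diff_distrib)
      also have "\<dots> \<le> e / B * B" using H(2) B by (intro mult_mono) (auto intro: less_imp_le order_trans[OF norm_ge_zero])
      finally show ?thesis using B by simp
    qed
    with H(1) show "\<exists>K. almost_periodic L K \<and> (\<forall>y. norm (F y * G y - K y) \<le> e)" by blast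
  qed
qed

lemma almost_periodic_const: "0 \<in> L \<Longrightarrow> almost_periodic L (\<lambda>y. a)"
  using almost_periodic.cmult[OF almost_periodic.char[of 0 L], of a] by simp

lemma almost_periodic_sum:
  assumes "0 \<in> L" "\<And>i. i \<in> I \<Longrightarrow> almost_periodic L (F i)"
  shows "almost_periodic L (\<lambda>y. \<Sum>i\<in>I. F i y)"
  using assms(2)
proof (induction I rule: infinite_finite_induct)
  case (insert i I)
  then show ?case by (simp add: almost_periodic.add)
qed (auto intro: almost_periodic_const assms(1))

lemma almost_periodic_Re_cis:
  assumes "\<mu> \<in> L" "- \<mu> \<in> L"
  shows "almost_periodic L (\<lambda>y. complex_of_real (Re (z * cis (\<mu> * y))))"
proof -
  have "almost_periodic L (\<lambda>y. (z / 2) * cis (\<mu> * y) + (cnj z / 2) * cis (- \<mu> * y))"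
    using assms by (intro almost_periodic.intros)
  also have "(\<lambda>y. (z / 2) * cis (\<mu> * y) + (cnj z / 2) * cis (- \<mu> * y)) = (\<lambda>y. complex_of_real (Re (z * cis (\<mu> * y))))"
    by (auto simp: fun_eq_iff complex_eq_iff field_simps)
  finally show ?thesis .
qed

text \<open>\<open>P\<close> stays in a ball, and \<open>f\<close> has to be approximated by
  polynomials there only, so \<open>f\<close> may be unbounded. Closure of \<open>L\<close> under
  addition, with 0 for constants, keeps polynomials in the coordinates of \<open>P\<close> within
  the class.\<close>

lemma almost_periodic_compose_continuous:
  fixes P :: "real \<Rightarrow> 'a::euclidean_space" and f :: "'a \<Rightarrow> real"
  assumes L: "0 \<in> L" "\<And>a b. a \<in> L \<Longrightarrow> b \<in> L \<Longrightarrow> a + b \<in> L"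
    and P: "\<And>b. b \<in> Basis \<Longrightarrow> almost_periodic L (\<lambda>y. complex_of_real (P y \<bullet> b))"
    and f: "continuous_on UNIV f"
  shows "almost_periodic L (\<lambda>y. complex_of_real (f (P y)))"
proof (rule almost_periodic.limit)
  fix e :: real assume e: "e > 0"
  have poly: "almost_periodic L (\<lambda>y. complex_of_real (g (P y)))" if "real_polynomial_function g" for g
    using that
  proof induction
    case (linear g)
    interpret bounded_linear g by fact
    have g_eq: "g x = (\<Sum>b\<in>Basis. g b * (x \<bullet> b))" for x
    proof -
      have "g x = g (\<Sum>b\<in>Basis. (x \<bullet> b) *\<^sub>R b)" by (simp add: euclidean_representation)
      also have "\<dots> = (\<Sum>b\<in>Basis. g b * (x \<bullet> b))" by (simp add: sum scaleR mult.commute)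
      finally show ?thesis .
    qed
    have "(\<lambda>y. complex_of_real (g (P y))) = (\<lambda>y. \<Sum>b\<in>Basis. complex_of_real (g b) * complex_of_real (P y \<bullet> b))"
      by (rule ext, subst g_eq) simp
    moreover have "almost_periodic L (\<lambda>y. \<Sum>b\<in>Basis. complex_of_real (g b) * complex_of_real (P y \<bullet> b))"
      by (intro almost_periodic_sum almost_periodic.cmult L P)
    ultimately show ?case by simp
  next
    case (mult g h)
    then show ?case using almost_periodic_mult[OF mult.IH] L by simp
  qed (auto intro: almost_periodic_const almost_periodic.add L)
  have "\<exists>B. \<forall>y. \<bar>P y \<bullet> b\<bar> \<le> B" if "b \<in> Basis" for b
    using almost_periodic_bounded[OF P[OF that]] by (metis norm_of_real)
  then obtain B where B: "\<And>b y. b \<in> Basis \<Longrightarrow> \<bar>P y \<bullet> b\<bar> \<le> B b" by metis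
  define R where "R = (\<Sum>b\<in>Basis. B b)"
  have "norm (P y) \<le> R" for y
    unfolding R_def using norm_le_l1[of "P y"] B by (meson order_trans sum_mono)
  then have PR: "P y \<in> cball 0 R" for y by simp
  obtain g where g: "real_polynomial_function g" "\<And>x. x \<in> cball 0 R \<Longrightarrow> \<bar>f x - g x\<bar> < e"
    using Stone_Weierstrass_real_polynomial_function[of "cball 0 R" f e] e continuous_on_subset[OF f]
    by auto
  have "norm (complex_of_real (f (P y)) - complex_of_real (g (P y))) \<le> e" for y
    using g(2)[OF PR[of y]] by (simp flip: of_real_diff)
  with poly[OF g(1)] show "\<exists>G. almost_periodic L G \<and> (\<forall>y. norm (complex_of_real (f (P y)) - G y) \<le> e)"
    by blast
qed

lemma almost_periodic_exp_real:
  assumes L: "0 \<in> L" "\<And>a b. a \<in> L \<Longrightarrow> b \<in> L \<Longrightarrow> a + b \<in> L"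
    and P: "almost_periodic L (\<lambda>y. complex_of_real (p y))"
  shows "almost_periodic L (\<lambda>y. exp (- \<i> * complex_of_real (p y)))"
proof -
  have "almost_periodic L (\<lambda>y. complex_of_real (cos (p y)) + (- \<i>) * complex_of_real (sin (p y)))"
  proof (intro almost_periodic.add almost_periodic.cmult)
    have comp: "almost_periodic L (\<lambda>y. complex_of_real (f (p y)))" if "continuous_on UNIV f" for f :: "real \<Rightarrow> real"
      using P by (intro almost_periodic_compose_continuous[where f = f and P = p] L that) auto
    show "almost_periodic L (\<lambda>y. complex_of_real (cos (p y)))" "almost_periodic L (\<lambda>y. complex_of_real (sin (p y)))"
      by (rule comp, rule continuous_on_cos continuous_on_sin, rule continuous_on_id)+
  qed
  also have "(\<lambda>y. complex_of_real (cos (p y)) + (- \<i>) * complex_of_real (sin (p y))) = (\<lambda>y. exp (- \<i> * complex_of_real (p y)))"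
  proof
    fix y
    have "exp (- \<i> * complex_of_real (p y)) = cis (- p y)" by (simp add: cis_conv_exp)
    then show "complex_of_real (cos (p y)) + (- \<i>) * complex_of_real (sin (p y)) = exp (- \<i> * complex_of_real (p y))"
      by (simp add: complex_eq_iff)
  qed
  finally show ?thesis .
qed

section \<open>Averages and mean values\<close>

definition average :: "(real \<Rightarrow> 'b::{banach, second_countable_topology}) \<Rightarrow> real \<Rightarrow> 'b" where
  "average F Y = (1 / Y) *\<^sub>R (LINT y:{0..Y}|lebesgue. F y)"

text \<open>\<open>Lim\<close> is unspecified when the averages diverge;
  \<open>average_tendsto_mean_value\<close> supplies the limit for the almost periodic
  class.\<close>

definition mean_value :: "(real \<Rightarrow> complex) \<Rightarrow> complex" where
  "mean_value F = Lim at_top (average F)"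

lemma set_integrable_continuous_lebesgue:
  fixes F :: "real \<Rightarrow> 'b::{banach, second_countable_topology}"
  assumes "continuous_on {0..Y} F"
  shows "set_integrable lebesgue {0..Y} F"
proof -
  have "set_integrable lborel {0..Y} F"
    using borel_integrable_atLeastAtMost'[OF assms] .
  then show ?thesis
    unfolding set_integrable_def by (subst integrable_completion) (auto dest: borel_measurable_integrable)
qed

lemma average_add:
  assumes "set_integrable lebesgue {0..Y} F" "set_integrable lebesgue {0..Y} G"
  shows "average (\<lambda>y. F y + G y) Y = average F Y + average G Y"
  using assms unfolding average_def by (simp add: set_integral_add scaleR_add_right)

lemma average_cmult:
  fixes F :: "real \<Rightarrow> complex"
  shows "average (\<lambda>y. a * F y) Y = a * average F Y"
  unfolding average_def by simp

lemma norm_average_le: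
  fixes F :: "real \<Rightarrow> 'b::{banach, second_countable_topology}"
  assumes "set_integrable lebesgue {0..Y} F" "\<And>y. norm (F y) \<le> B" "Y > 0"
  shows "norm (average F Y) \<le> B"
proof -
  have "norm (LINT y:{0..Y}|lebesgue. F y) \<le> (LINT y:{0..Y}|lebesgue. B)"
  proof -
    have "norm (LINT y:{0..Y}|lebesgue. F y) \<le> (\<integral>y. norm (indicator {0..Y} y *\<^sub>R F y) \<partial>lebesgue)"
      unfolding set_lebesgue_integral_def by (rule integral_norm_bound)
    also have "\<dots> \<le> (LINT y:{0..Y}|lebesgue. B)"
      unfolding set_lebesgue_integral_def
    proof (rule integral_mono)
      show "integrable lebesgue (\<lambda>y. norm (indicator {0..Y} y *\<^sub>R F y))"
        using assms(1) unfolding set_integrable_def by (rule integrable_norm)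
      show "integrable lebesgue (\<lambda>y. indicator {0..Y} y *\<^sub>R B)"
        using set_integrable_continuous_lebesgue[of Y "\<lambda>_. B"] by (simp add: set_integrable_def)
    qed (use assms(2) in \<open>auto simp: indicator_def\<close>)
    finally show ?thesis .
  qed
  also have "\<dots> = B * Y" using assms by (simp add: set_lebesgue_integral_def)
  finally show ?thesis using assms by (simp add: average_def field_simps)
qed

text \<open>A Cauchy criterion at infinity. Completeness speaks of sequences, so the limit is taken
  along the integers and then shown to be the limit along the reals.\<close>

lemma tendsto_of_uniform_approximation:
  fixes A :: "real \<Rightarrow> 'b::banach"
  assumes "\<And>e. e > 0 \<Longrightarrow> \<exists>B m. (B \<longlongrightarrow> m) at_top \<and> (\<forall>\<^sub>F Y in at_top. norm (A Y - B Y) \<le> e)"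
  shows "\<exists>l. (A \<longlongrightarrow> l) at_top"
proof -
  have osc: "\<exists>Y0. \<forall>Y\<ge>Y0. \<forall>Z\<ge>Y0. dist (A Y) (A Z) < e" if e: "e > 0" for e
  proof -
    \<comment> \<open>Two steps from \<open>A\<close> to \<open>B\<close> and two from
      \<open>B\<close> to \<open>m\<close> add up to \<open>4 * e / 5\<close>, below
      \<open>e\<close>.\<close>
    from e have "e / 5 > 0" by simp
    from assms[OF this] obtain B m where B: "(B \<longlongrightarrow> m) at_top" "\<forall>\<^sub>F Y in at_top. norm (A Y - B Y) \<le> e / 5"
      by blast
    have "\<forall>\<^sub>F Y in at_top. dist (B Y) m < e / 5" using B(1) e by (intro tendstoD) auto
    with B(2) have "\<forall>\<^sub>F Y in at_top. dist (A Y) m < 2 * e / 5"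
    proof eventually_elim
      case (elim Y)
      then show ?case using dist_triangle[of "A Y" m "B Y"] by (simp add: dist_norm)
    qed
    then obtain Y0 where Y0: "\<And>Y. Y \<ge> Y0 \<Longrightarrow> dist (A Y) m < 2 * e / 5" by (auto simp: eventually_at_top_linorder)
    have "dist (A Y) (A Z) < e" if "Y \<ge> Y0" "Z \<ge> Y0" for Y Z
      using Y0[OF that(1)] Y0[OF that(2)] dist_triangle2[of "A Y" "A Z" m] e by linarith
    then show ?thesis by blast
  qed
  have "Cauchy (\<lambda>n. A (real n))"
    unfolding Cauchy_def
  proof (intro allI impI)
    fix e :: real assume "e > 0"
    from osc[OF this] obtain Y0 where Y0: "\<And>Y Z. Y \<ge> Y0 \<Longrightarrow> Z \<ge> Y0 \<Longrightarrow> dist (A Y) (A Z) < e" by blast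
    obtain N where "Y0 \<le> real N" using real_arch_simple by blast
    then have "dist (A (real m)) (A (real n)) < e" if "m \<ge> N" "n \<ge> N" for m n
      using that by (intro Y0) linarith+
    then show "\<exists>M. \<forall>m\<ge>M. \<forall>n\<ge>M. dist (A (real m)) (A (real n)) < e" by blast
  qed
  then obtain l where l: "(\<lambda>n. A (real n)) \<longlonglongrightarrow> l" by (auto simp: Cauchy_convergent_iff convergent_def)
  have "(A \<longlongrightarrow> l) at_top"
  proof (rule tendstoI)
    fix e :: real assume "e > 0"
    then have "e / 2 > 0" by simp
    from osc[OF this] obtain Y0 where Y0: "\<And>Y Z. Y \<ge> Y0 \<Longrightarrow> Z \<ge> Y0 \<Longrightarrow> dist (A Y) (A Z) < e / 2" by blast
    have "\<forall>\<^sub>F n in sequentially. dist (A (real n)) l < e / 2" using l \<open>e / 2 > 0\<close> by (rule tendstoD)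
    moreover have "\<forall>\<^sub>F n in sequentially. Y0 \<le> real n"
      using filterlim_real_sequentially unfolding filterlim_at_top by blast
    ultimately have "\<forall>\<^sub>F n in sequentially. dist (A (real n)) l < e / 2 \<and> Y0 \<le> real n" by eventually_elim auto
    then obtain n where n: "dist (A (real n)) l < e / 2" "Y0 \<le> real n"
      using eventually_happens'[OF sequentially_bot] by blast
    show "\<forall>\<^sub>F Y in at_top. dist (A Y) l < e"
      using eventually_ge_at_top[of Y0]
    proof eventually_elim
      case (elim Y)
      show ?case using Y0[OF elim n(2)] n(1) dist_triangle[of "A Y" l "A (real n)"] by linarith
    qed
  qed
  then show ?thesis by blast
qed

text \<open>A character of nonzero frequency has a bounded primitive, so its average is
  O(1/Y).\<close>

lemma average_cis:
  "(average (\<lambda>y. cis (\<mu> * y)) \<longlongrightarrow> (if \<mu> = 0 then 1 else 0)) at_top"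
proof (cases "\<mu> = 0")
  case True
  have "\<forall>\<^sub>F Y in at_top. average (\<lambda>y. cis (\<mu> * y)) Y = 1"
    using eventually_gt_at_top[of 0]
    by eventually_elim (simp add: True average_def set_lebesgue_integral_def scaleR_conv_of_real)
  then show ?thesis using True by (simp add: tendsto_eventually)
next
  case False
  have ev: "\<forall>\<^sub>F Y in at_top. norm (average (\<lambda>y. cis (\<mu> * y)) Y) \<le> (2 / \<bar>\<mu>\<bar>) / Y"
    using eventually_gt_at_top[of 0]
  proof eventually_elim
    case (elim Y)
    have "((\<lambda>y. cis (\<mu> * y)) has_integral (cis (\<mu> * Y) / (\<i> * \<mu>) - cis (\<mu> * 0) / (\<i> * \<mu>))) {0..Y}"
    proof (rule fundamental_theorem_of_calculus)
      show "((\<lambda>y. cis (\<mu> * y) / (\<i> * \<mu>)) has_vector_derivative cis (\<mu> * y)) (at y within {0..Y})" for y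
      proof -
        have "((\<lambda>z. exp (\<i> * \<mu> * z) / (\<i> * \<mu>)) has_field_derivative exp (\<i> * \<mu> * complex_of_real y)) (at (complex_of_real y))"
          using False by (auto intro!: derivative_eq_intros)
        from has_vector_derivative_real_field[OF this] show ?thesis
          by (simp add: cis_conv_exp mult_ac)
      qed
    qed (use elim in auto)
    then have "integral {0..Y} (\<lambda>y. cis (\<mu> * y)) = cis (\<mu> * Y) / (\<i> * \<mu>) - cis (\<mu> * 0) / (\<i> * \<mu>)"
      by (rule integral_unique)
    moreover have "(LINT y:{0..Y}|lebesgue. cis (\<mu> * y)) = integral {0..Y} (\<lambda>y. cis (\<mu> * y))"
      by (intro set_lebesgue_integral_eq_integral set_integrable_continuous_lebesgue continuous_intros)
    ultimately have "(LINT y:{0..Y}|lebesgue. cis (\<mu> * y)) = (cis (\<mu> * Y) - 1) / (\<i> * \<mu>)"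
      by (simp add: diff_divide_distrib)
    then have "norm (LINT y:{0..Y}|lebesgue. cis (\<mu> * y)) = norm (cis (\<mu> * Y) - 1) / \<bar>\<mu>\<bar>"
      by (simp add: norm_divide norm_mult)
    also have "\<dots> \<le> 2 / \<bar>\<mu>\<bar>"
      using norm_triangle_ineq4[of "cis (\<mu> * Y)" 1] by (intro divide_right_mono) auto
    finally show ?case using elim by (simp add: average_def field_simps)
  qed
  have "((\<lambda>Y. (2 / \<bar>\<mu>\<bar>) / Y) \<longlongrightarrow> 0) at_top"
    by (intro tendsto_divide_0[OF tendsto_const] filterlim_at_top_imp_at_infinity filterlim_ident)
  then show ?thesis using False Lim_null_comparison[OF ev] by simp
qed

lemma set_integrable_almost_periodic:
  "almost_periodic L F \<Longrightarrow> set_integrable lebesgue {0..Y} F"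
  by (intro set_integrable_continuous_lebesgue almost_periodic_continuous)

lemma set_integrable_diff_almost_periodic:
  "almost_periodic L F \<Longrightarrow> almost_periodic L' G \<Longrightarrow> set_integrable lebesgue {0..Y} (\<lambda>y. F y - G y)"
  by (intro set_integrable_continuous_lebesgue continuous_on_diff almost_periodic_continuous)

lemma norm_average_diff_le:
  assumes F: "almost_periodic L F" and G: "almost_periodic L' G" and le: "\<And>y. norm (F y - G y) \<le> e" and Y: "Y > 0"
  shows "norm (average F Y - average G Y) \<le> e"
proof -
  have "average (\<lambda>y. F y - G y) Y = average F Y - average G Y"
    unfolding average_def
    by (simp add: set_integral_diff set_integrable_almost_periodic[OF F] set_integrable_almost_periodic[OF G] scaleR_diff_right)
  then show ?thesis
    using norm_average_le[OF set_integrable_diff_almost_periodic[OF F G] le Y] by simp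
qed

text \<open>In the limit case the averages of \<open>F\<close> and of an approximant differ by at
  most \<open>e\<close> for every \<open>Y > 0\<close>, so convergence passes to uniform
  limits.\<close>

lemma average_tendsto_mean_value:
  assumes "almost_periodic L F"
  shows "(average F \<longlongrightarrow> mean_value F) at_top"
proof -
  have "\<exists>m. (average F \<longlongrightarrow> m) at_top"
    using assms
  proof induction
    case (char \<mu>)
    show ?case using average_cis by blast
  next
    case (add F G)
    then obtain m n where "(average F \<longlongrightarrow> m) at_top" "(average G \<longlongrightarrow> n) at_top" by blast
    then have "((\<lambda>Y. average F Y + average G Y) \<longlongrightarrow> m + n) at_top" by (rule tendsto_add)
    then show ?case
      using average_add[OF set_integrable_almost_periodic[OF add.hyps(1)] set_integrable_almost_periodic[OF add.hyps(2)]]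
      by auto
  next
    case (cmult F a)
    then obtain m where "(average F \<longlongrightarrow> m) at_top" by blast
    then have "((\<lambda>Y. a * average F Y) \<longlongrightarrow> a * m) at_top" by (rule tendsto_mult_left)
    then show ?case by (auto simp: average_cmult[abs_def])
  next
    case (limit F)
    have F: "almost_periodic L F" using limit by (intro almost_periodic.limit) blast
    show ?case
    proof (rule tendsto_of_uniform_approximation)
      fix e :: real assume "e > 0"
      from limit[OF this] obtain G m where G: "almost_periodic L G" "(average G \<longlongrightarrow> m) at_top" "\<And>y. norm (F y - G y) \<le> e"
        by blast
      have "\<forall>\<^sub>F Y in at_top. norm (average F Y - average G Y) \<le> e"
        using eventually_gt_at_top[of 0] by eventually_elim (rule norm_average_diff_le[OF F G(1,3)])
      with G(2) show "\<exists>B m. (B \<longlongrightarrow> m) at_top \<and> (\<forall>\<^sub>F Y in at_top. norm (average F Y - B Y) \<le> e)" by blast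
    qed
  qed
  then show ?thesis unfolding mean_value_def by (metis tendsto_Lim trivial_limit_at_top_linorder)
qed

lemma mean_value_eqI:
  "(average F \<longlongrightarrow> m) at_top \<Longrightarrow> mean_value F = m"
  unfolding mean_value_def by (intro tendsto_Lim) auto

lemma mean_value_cis: "mean_value (\<lambda>y. cis (\<mu> * y)) = (if \<mu> = 0 then 1 else 0)"
  by (rule mean_value_eqI[OF average_cis])

lemma mean_value_add:
  assumes "almost_periodic L F" "almost_periodic L' G"
  shows "mean_value (\<lambda>y. F y + G y) = mean_value F + mean_value G"
proof (rule mean_value_eqI)
  have "((\<lambda>Y. average F Y + average G Y) \<longlongrightarrow> mean_value F + mean_value G) at_top"
    using assms by (intro tendsto_add average_tendsto_mean_value)
  moreover have "average (\<lambda>y. F y + G y) = (\<lambda>Y. average F Y + average G Y)"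
    using average_add[OF set_integrable_almost_periodic[OF assms(1)] set_integrable_almost_periodic[OF assms(2)]]
    by (rule ext)
  ultimately show "(average (\<lambda>y. F y + G y) \<longlongrightarrow> mean_value F + mean_value G) at_top"
    by simp
qed

lemma mean_value_cmult:
  assumes "almost_periodic L F"
  shows "mean_value (\<lambda>y. a * F y) = a * mean_value F"
proof (rule mean_value_eqI)
  have "((\<lambda>Y. a * average F Y) \<longlongrightarrow> a * mean_value F) at_top"
    using assms by (intro tendsto_mult_left average_tendsto_mean_value)
  then show "(average (\<lambda>y. a * F y) \<longlongrightarrow> a * mean_value F) at_top"
    by (simp add: average_cmult[abs_def])
qed

lemma norm_mean_value_diff_le:
  assumes "almost_periodic L F" "almost_periodic L' G" "\<And>y. norm (F y - G y) \<le> e"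
  shows "norm (mean_value F - mean_value G) \<le> e"
proof (rule tendsto_upperbound)
  show "((\<lambda>Y. norm (average F Y - average G Y)) \<longlongrightarrow> norm (mean_value F - mean_value G)) at_top"
    by (intro tendsto_norm tendsto_diff average_tendsto_mean_value[OF assms(1)] average_tendsto_mean_value[OF assms(2)])
  show "\<forall>\<^sub>F Y in at_top. norm (average F Y - average G Y) \<le> e"
    using eventually_gt_at_top[of 0] by eventually_elim (rule norm_average_diff_le[OF assms])
qed simp

section \<open>Multiplicativity over independent frequencies\<close>

lemma eq_of_uniform_approximation:
  fixes a b :: "'a::real_normed_vector"
  assumes "\<And>e. e > 0 \<Longrightarrow> norm (a - b) \<le> C * e"
  shows "a = b"
proof (rule ccontr)
  assume "a \<noteq> b"
  then have pos: "norm (a - b) > 0" by simp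
  \<comment> \<open>The summand 1 avoids division by 0 when \<open>C = 0\<close>; the factor 2
    brings the bound down to half of \<open>norm (a - b)\<close>.\<close>
  define e where "e = norm (a - b) / (2 * (\<bar>C\<bar> + 1))"
  have "e > 0" using pos by (simp add: e_def)
  then have "norm (a - b) \<le> C * e" by (rule assms)
  also have "\<dots> \<le> (\<bar>C\<bar> + 1) * e" using \<open>e > 0\<close> by (intro mult_right_mono) auto
  also have "\<dots> = norm (a - b) / 2" by (simp add: e_def field_simps)
  finally show False using pos by simp
qed

text \<open>The product of two characters has mean 1 exactly when the frequencies cancel, and
  \<open>indep\<close> allows this only if both vanish. Both sides are bilinear and continuous for
  uniform convergence, so the identity spreads to the generated classes.\<close>

lemma mean_value_mult_independent:
  assumes F: "almost_periodic L1 F" and G: "almost_periodic L2 G"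
    and indep: "\<And>a b. a \<in> L1 \<Longrightarrow> b \<in> L2 \<Longrightarrow> a + b = 0 \<Longrightarrow> a = 0 \<and> b = 0"
  shows "mean_value (\<lambda>y. F y * G y) = mean_value F * mean_value G"
proof -
  \<comment> \<open>Products must only possess mean values here, so their frequencies are left
    unrestricted.\<close>
  note ap = almost_periodic_mult[where L = UNIV, simplified]
  show ?thesis
    using F
  proof induction
    case (char \<mu>)
    then have \<mu>: "almost_periodic L1 (\<lambda>y. cis (\<mu> * y))" by (rule almost_periodic.char)
    show ?case using G
    proof induction
      case (char \<nu>)
      have "(\<lambda>y. cis (\<mu> * y) * cis (\<nu> * y)) = (\<lambda>y. cis ((\<mu> + \<nu>) * y))" by (simp add: cis_mult distrib_right)
      then show ?case using indep[OF \<open>\<mu> \<in> L1\<close> char] by (auto simp: mean_value_cis)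
    next
      case (add G H)
      then show ?case
        by (simp add: distrib_left mean_value_add[OF ap[OF \<mu> add.hyps(1)] ap[OF \<mu> add.hyps(2)]] mean_value_add[OF add.hyps])
    next
      case (cmult G a)
      have "(\<lambda>y. cis (\<mu> * y) * (a * G y)) = (\<lambda>y. a * (cis (\<mu> * y) * G y))" by (simp add: mult_ac)
      then show ?case
        using cmult by (simp add: mean_value_cmult[OF ap[OF \<mu> cmult.hyps]] mean_value_cmult[OF cmult.hyps])
    next
      case (limit G)
      have G: "almost_periodic L2 G" using limit by (intro almost_periodic.limit) blast
      show ?case
      proof (rule eq_of_uniform_approximation[where C = "1 + norm (mean_value (\<lambda>y. cis (\<mu> * y)))"])
        fix e :: real assume "e > 0"
        from limit[OF this] obtain H where H: "almost_periodic L2 H" "\<And>y. norm (G y - H y) \<le> e"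
           "mean_value (\<lambda>y. cis (\<mu> * y) * H y) = mean_value (\<lambda>y. cis (\<mu> * y)) * mean_value H" by blast
        have "norm (mean_value (\<lambda>y. cis (\<mu> * y) * G y) - mean_value (\<lambda>y. cis (\<mu> * y) * H y)) \<le> e"
          using H(2) by (intro norm_mean_value_diff_le[OF ap[OF \<mu> G] ap[OF \<mu> H(1)]])
            (simp add: norm_mult flip: right_diff_distrib)
        moreover have "norm (mean_value (\<lambda>y. cis (\<mu> * y)) * mean_value H - mean_value (\<lambda>y. cis (\<mu> * y)) * mean_value G)
            \<le> norm (mean_value (\<lambda>y. cis (\<mu> * y))) * e"
          using norm_mean_value_diff_le[OF H(1) G, of e] H(2)
          by (simp add: norm_mult norm_minus_commute mult_left_mono flip: right_diff_distrib)
        ultimately show "norm (mean_value (\<lambda>y. cis (\<mu> * y) * G y) - mean_value (\<lambda>y. cis (\<mu> * y)) * mean_value G)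
            \<le> (1 + norm (mean_value (\<lambda>y. cis (\<mu> * y)))) * e"
          unfolding distrib_right using H(3) by (simp add: norm_diff_triangle_le)
      qed
    qed
  next
    case (add F H)
    then show ?case
      by (simp add: distrib_right mean_value_add[OF ap[OF add.hyps(1) G] ap[OF add.hyps(2) G]] mean_value_add[OF add.hyps])
  next
    case (cmult F a)
    have "(\<lambda>y. a * F y * G y) = (\<lambda>y. a * (F y * G y))" by (simp add: mult_ac)
    then show ?case
      using cmult by (simp add: mean_value_cmult[OF ap[OF cmult.hyps G]] mean_value_cmult[OF cmult.hyps])
  next
    case (limit F)
    have F: "almost_periodic L1 F" using limit by (intro almost_periodic.limit) blast
    obtain B where B: "B > 0" "\<And>y. norm (G y) \<le> B" using almost_periodic_bounded[OF G] by blast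
    show ?case
    proof (rule eq_of_uniform_approximation[where C = "B + norm (mean_value G)"])
      fix e :: real assume "e > 0"
      from limit[OF this] obtain H where H: "almost_periodic L1 H" "\<And>y. norm (F y - H y) \<le> e"
         "mean_value (\<lambda>y. H y * G y) = mean_value H * mean_value G" by blast
      have "norm (F y * G y - H y * G y) \<le> B * e" for y
      proof -
        have "norm (F y * G y - H y * G y) = norm (G y) * norm (F y - H y)"
          by (metis left_diff_distrib mult.commute norm_mult)
        also have "\<dots> \<le> B * e" using H(2) B by (intro mult_mono) auto
        finally show ?thesis .
      qed
      then have "norm (mean_value (\<lambda>y. F y * G y) - mean_value (\<lambda>y. H y * G y)) \<le> B * e"
        by (intro norm_mean_value_diff_le[OF ap[OF F G] ap[OF H(1) G]])
      moreover have "norm (mean_value H * mean_value G - mean_value F * mean_value G) \<le> norm (mean_value G) * e"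
      proof -
        have "norm (mean_value H * mean_value G - mean_value F * mean_value G) = norm (mean_value G) * norm (mean_value H - mean_value F)"
          by (metis left_diff_distrib mult.commute norm_mult)
        also have "\<dots> \<le> norm (mean_value G) * e"
          using norm_mean_value_diff_le[OF H(1) F, of e] H(2) by (intro mult_left_mono) (auto simp: norm_minus_commute)
        finally show ?thesis .
      qed
      ultimately show "norm (mean_value (\<lambda>y. F y * G y) - mean_value F * mean_value G) \<le> (B + norm (mean_value G)) * e"
        unfolding distrib_right using H(3) by (simp add: norm_diff_triangle_le)
    qed
  qed
qed

text \<open>A shift multiplies a character by \<open>cis (\<mu> * a)\<close>, which is 1 in the only
  case of nonzero mean. Both claims share one induction, since additivity of the means of shifted
  functions presupposes their almost periodicity.\<close>

lemma almost_periodic_shift: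
  assumes "almost_periodic L F"
  shows "almost_periodic L (\<lambda>y. F (y + a)) \<and> mean_value (\<lambda>y. F (y + a)) = mean_value F"
  using assms
proof induction
  case (char \<mu>)
  have eq: "(\<lambda>y. cis (\<mu> * (y + a))) = (\<lambda>y. cis (\<mu> * a) * cis (\<mu> * y))"
    by (simp add: cis_mult distrib_left add.commute)
  have ap: "almost_periodic L (\<lambda>y. cis (\<mu> * y))" using char by (rule almost_periodic.char)
  show ?case unfolding eq mean_value_cmult[OF ap] mean_value_cis
    using almost_periodic.cmult[OF ap] by simp
next
  case (add F G)
  then show ?case
    using mean_value_add[of L "\<lambda>y. F (y + a)" L "\<lambda>y. G (y + a)"] mean_value_add[of L F L G]
    by (simp add: almost_periodic.add)
next
  case (cmult F c)
  then show ?case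
    using mean_value_cmult[of L "\<lambda>y. F (y + a)" c] mean_value_cmult[of L F c]
    by (simp add: almost_periodic.cmult)
next
  case (limit F)
  have F: "almost_periodic L F" using limit by (intro almost_periodic.limit) blast
  have Fa: "almost_periodic L (\<lambda>y. F (y + a))"
  proof (rule almost_periodic.limit)
    fix e :: real assume "e > 0"
    from limit[OF this] obtain G where "almost_periodic L (\<lambda>y. G (y + a))" "\<forall>y. norm (F y - G y) \<le> e" by blast
    then show "\<exists>G. almost_periodic L G \<and> (\<forall>y. norm (F (y + a) - G y) \<le> e)" by (intro exI[of _ "\<lambda>y. G (y + a)"]) auto
  qed
  have "mean_value (\<lambda>y. F (y + a)) = mean_value F"
  proof (rule eq_of_uniform_approximation[where C = 2])
    fix e :: real assume "e > 0"
    from limit[OF this] obtain G where G: "almost_periodic L G" "\<And>y. norm (F y - G y) \<le> e"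
      "almost_periodic L (\<lambda>y. G (y + a))" "mean_value (\<lambda>y. G (y + a)) = mean_value G" by blast
    have "norm (mean_value (\<lambda>y. F (y + a)) - mean_value (\<lambda>y. G (y + a))) \<le> e"
      by (rule norm_mean_value_diff_le[OF Fa G(3)]) (rule G(2))
    moreover have "norm (mean_value G - mean_value F) \<le> e"
      using G(2) by (intro norm_mean_value_diff_le[OF G(1) F]) (simp add: norm_minus_commute)
    ultimately show "norm (mean_value (\<lambda>y. F (y + a)) - mean_value F) \<le> 2 * e"
      using G(4) norm_diff_triangle_le[of "mean_value (\<lambda>y. F (y + a))" "mean_value G" e "mean_value F" e] by simp
  qed
  with Fa show ?case by blast
qed

section \<open>Periodic functions and the Bessel factor\<close>

lemma integral_cis_period:
  "((\<lambda>t. cis (of_int j * (2 * pi * t))) has_integral (if j = 0 then 1 else 0)) {0..1}"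
proof (cases "j = 0")
  case True
  then show ?thesis using has_integral_const_real[of "1::complex" 0 1] by simp
next
  case False
  define w where "w = \<i> * (of_int j * (2 * complex_of_real pi))"
  have w: "w \<noteq> 0" using False by (simp add: w_def)
  have "((\<lambda>t. exp (w * complex_of_real t)) has_integral (exp (w * complex_of_real 1) / w - exp (w * complex_of_real 0) / w)) {0..1}"
  proof (rule fundamental_theorem_of_calculus)
    show "((\<lambda>t. exp (w * complex_of_real t) / w) has_vector_derivative exp (w * complex_of_real t)) (at t within {0..1})" for t
    proof -
      have "((\<lambda>z. exp (w * z) / w) has_field_derivative exp (w * complex_of_real t)) (at (complex_of_real t))"
        using w by (auto intro!: derivative_eq_intros)
      from has_vector_derivative_real_field[OF this] show ?thesis by simp
    qed
  qed simp
  moreover have "exp w = 1"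
    using exp_integer_2pi[of "of_int j"] by (simp add: w_def mult_ac)
  moreover have "(\<lambda>t. exp (w * complex_of_real t)) = (\<lambda>t. cis (of_int j * (2 * pi * t)))"
    by (simp add: w_def cis_conv_exp mult_ac fun_eq_iff)
  ultimately show ?thesis using False by simp
qed

text \<open>Frequencies that are integer multiples of \<open>\<mu>\<close> make
  \<open>2 * pi / \<mu>\<close> a period, so the mean is that over one period rescaled to [0,1]. For
  characters this is orthogonality; both sides respect sums, multiples and uniform limits.\<close>

lemma mean_value_periodic:
  assumes \<mu>: "\<mu> \<noteq> 0" and F: "almost_periodic {of_int j * \<mu> | j. True} F"
  shows "mean_value F = integral {0..1} (\<lambda>t. F (2 * pi * t / \<mu>))"
proof -
  let ?L = "{of_int j * \<mu> | j. True}"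
  have int: "(\<lambda>t. G (2 * pi * t / \<mu>)) integrable_on {0..1}" if "almost_periodic ?L G" for G
  proof (rule integrable_continuous_interval)
    show "continuous_on {0..1} (\<lambda>t. G (2 * pi * t / \<mu>))"
      using \<mu> by (intro continuous_on_compose2[OF almost_periodic_continuous[OF that, of UNIV]] continuous_intros) auto
  qed
  show ?thesis
    using F
  proof induction
    case (char \<nu>)
    then obtain j where j: "\<nu> = of_int j * \<mu>" by blast
    have "(\<lambda>t. cis (\<nu> * (2 * pi * t / \<mu>))) = (\<lambda>t. cis (of_int j * (2 * pi * t)))"
      using \<mu> by (simp add: j mult_ac)
    then show ?case using integral_unique[OF integral_cis_period[of j]] \<mu> by (simp add: mean_value_cis j)
  next
    case (add F G)
    then show ?case
      by (simp add: mean_value_add[OF add.hyps] Henstock_Kurzweil_Integration.integral_add[OF int[OF add.hyps(1)] int[OF add.hyps(2)]])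
  next
    case (cmult F a)
    then show ?case by (simp add: mean_value_cmult[OF cmult.hyps])
  next
    case (limit F)
    have F: "almost_periodic ?L F" using limit by (intro almost_periodic.limit) blast
    show ?case
    proof (rule eq_of_uniform_approximation[where C = 2])
      fix e :: real assume e: "e > 0"
      from limit[OF this] obtain G where G: "almost_periodic ?L G" "\<And>y. norm (F y - G y) \<le> e"
        "mean_value G = integral {0..1} (\<lambda>t. G (2 * pi * t / \<mu>))" by blast
      have "norm (integral {0..1} (\<lambda>t. G (2 * pi * t / \<mu>)) - integral {0..1} (\<lambda>t. F (2 * pi * t / \<mu>)))
          = norm (integral {0..1} (\<lambda>t. G (2 * pi * t / \<mu>) - F (2 * pi * t / \<mu>)))"
        by (simp add: Henstock_Kurzweil_Integration.integral_diff[OF int[OF G(1)] int[OF F]])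
      also have "\<dots> \<le> integral {0..1::real} (\<lambda>t. e)"
        using G(2) by (intro integral_norm_bound_integral integrable_diff int[OF G(1)] int[OF F]) (auto simp: norm_minus_commute)
      finally have "norm (mean_value G - integral {0..1} (\<lambda>t. F (2 * pi * t / \<mu>))) \<le> e" using G(3) by simp
      with norm_mean_value_diff_le[OF F G(1,2)]
      show "norm (mean_value F - integral {0..1} (\<lambda>t. F (2 * pi * t / \<mu>))) \<le> 2 * e"
        using norm_diff_triangle_le[of "mean_value F" "mean_value G" e _ e] by simp
    qed
  qed
qed

lemma almost_periodic_exp_Re_cis:
  "almost_periodic {of_int j * \<mu> | j. True} (\<lambda>y. exp (- \<i> * complex_of_real (Re (z * cis (\<mu> * y)))))"
proof (intro almost_periodic_exp_real almost_periodic_Re_cis)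
  show "0 \<in> {of_int j * \<mu> | j. True}" by (auto intro: exI[of _ 0])
  show "\<mu> \<in> {of_int j * \<mu> | j. True}" by (auto intro: exI[of _ 1])
  show "- \<mu> \<in> {of_int j * \<mu> | j. True}" by (auto intro: exI[of _ "-1"])
  fix a b assume "a \<in> {of_int j * \<mu> | j. True}" "b \<in> {of_int j * \<mu> | j. True}"
  then obtain i j where "a = of_int i * \<mu>" "b = of_int j * \<mu>" by blast
  then have "a + b = of_int (i + j) * \<mu>" by (simp add: distrib_right)
  then show "a + b \<in> {of_int j * \<mu> | j. True}" by blast
qed

text \<open>The argument of \<open>z\<close> amounts to a translation by
  \<open>Arg z / \<mu>\<close>, invisible to the mean; with the real amplitude \<open>norm z\<close>
  the average over a period is the integral defining \<open>J0\<close>.\<close>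

lemma mean_value_exp_Re_cis:
  assumes \<mu>: "\<mu> \<noteq> 0"
  shows "mean_value (\<lambda>y. exp (- \<i> * complex_of_real (Re (z * cis (\<mu> * y))))) = J0 (norm z)"
proof -
  define H where "H y = exp (- \<i> * complex_of_real (Re (complex_of_real (norm z) * cis (\<mu> * y))))" for y
  have H: "almost_periodic {of_int j * \<mu> | j. True} H"
    unfolding H_def by (rule almost_periodic_exp_Re_cis)
  have "(\<lambda>y. exp (- \<i> * complex_of_real (Re (z * cis (\<mu> * y))))) = (\<lambda>y. H (y + Arg z / \<mu>))"
  proof
    fix y
    have "z * cis (\<mu> * y) = complex_of_real (norm z) * cis (Arg z) * cis (\<mu> * y)"
      using rcis_cmod_Arg[of z] by (simp add: rcis_def)
    also have "\<dots> = complex_of_real (norm z) * cis (\<mu> * (y + Arg z / \<mu>))"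
      using \<mu> by (simp add: mult.assoc cis_mult distrib_left add.commute)
    finally show "exp (- \<i> * complex_of_real (Re (z * cis (\<mu> * y)))) = H (y + Arg z / \<mu>)"
      by (simp add: H_def)
  qed
  then have "mean_value (\<lambda>y. exp (- \<i> * complex_of_real (Re (z * cis (\<mu> * y))))) = mean_value H"
    using almost_periodic_shift[OF H] by simp
  also have "\<dots> = integral {0..1} (\<lambda>t. H (2 * pi * t / \<mu>))" by (rule mean_value_periodic[OF \<mu> H])
  also have "\<dots> = J0 (norm z)" using \<mu> by (simp add: J0_def H_def)
  finally show ?thesis .
qed

text \<open>The induction carries along the possible frequencies, the integer combinations of
  \<open>A\<close>. A new \<open>x\<close> adds its own multiples, and independence excludes
  cancellation between the two kinds.\<close>

lemma mean_value_prod_independent: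
  assumes "finite A" "Q_linearly_independent A"
  shows "almost_periodic {\<Sum>x\<in>A. of_int (n x) * x | n :: real \<Rightarrow> int. True} (\<lambda>y. \<Prod>x\<in>A. exp (- \<i> * complex_of_real (Re (z x * cis (x * y))))) \<and>
    mean_value (\<lambda>y. \<Prod>x\<in>A. exp (- \<i> * complex_of_real (Re (z x * cis (x * y))))) = (\<Prod>x\<in>A. J0 (norm (z x)))"
  using assms
proof (induction A rule: finite_induct)
  case empty
  have "mean_value (\<lambda>y. 1) = 1" using mean_value_cis[of 0] by simp
  then show ?case using almost_periodic_const[of "{0}" 1] by simp
next
  case (insert x A)
  let ?F = "\<lambda>x y. exp (- \<i> * complex_of_real (Re (z x * cis (x * y))))"
  have zero: "j = 0 \<and> (\<forall>a\<in>A. n a = 0)" if "of_int j * x + (\<Sum>a\<in>A. of_int (n a) * a) = 0" for j and n :: "real \<Rightarrow> int"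
  proof -
    define q where "q a = (if a = x then rat_of_int j else rat_of_int (n a))" for a
    have "(\<Sum>a\<in>A. real_of_rat (q a) * a) = (\<Sum>a\<in>A. of_int (n a) * a)"
      using insert.hyps by (intro sum.cong) (auto simp: q_def)
    then have "(\<Sum>a\<in>insert x A. real_of_rat (q a) * a) = 0"
      using that insert.hyps by (simp add: q_def)
    then have "\<forall>a\<in>insert x A. q a = 0"
      using insert.prems insert.hyps unfolding Q_linearly_independent_def by (metis finite_insert order_refl)
    then show ?thesis using insert.hyps by (auto simp: q_def split: if_splits)
  qed
  \<comment> \<open>If \<open>x\<close> were 0, coefficient 1 at \<open>x\<close> and 0 elsewhere
    would be a nontrivial relation.\<close>
  have "x \<noteq> 0" using zero[of 1 "\<lambda>_. 0"] by auto
  have "Q_linearly_independent A"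
    using insert.prems unfolding Q_linearly_independent_def by blast
  note IH = insert.IH[OF this]
  note x = almost_periodic_exp_Re_cis[of x "z x"]
  have "almost_periodic {\<Sum>x\<in>insert x A. of_int (n x) * x | n :: real \<Rightarrow> int. True} (\<lambda>y. ?F x y * (\<Prod>x\<in>A. ?F x y))"
  proof (rule almost_periodic_mult[OF x IH[THEN conjunct1]])
    fix a b assume "a \<in> {of_int j * x | j. True}" "b \<in> {\<Sum>x\<in>A. of_int (n x) * x | n :: real \<Rightarrow> int. True}"
    then obtain j n where jn: "a = of_int j * x" "b = (\<Sum>x\<in>A. of_int (n x) * x)" by blast
    have "a + b = (\<Sum>y\<in>insert x A. of_int ((n(x := j)) y) * y)"
      using insert.hyps by (auto simp: jn intro!: sum.cong)
    then show "a + b \<in> {\<Sum>x\<in>insert x A. of_int (n x) * x | n :: real \<Rightarrow> int. True}" by blast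
  qed
  moreover have "mean_value (\<lambda>y. ?F x y * (\<Prod>x\<in>A. ?F x y)) = mean_value (?F x) * mean_value (\<lambda>y. \<Prod>x\<in>A. ?F x y)"
  proof (rule mean_value_mult_independent[OF x IH[THEN conjunct1]])
    fix a b assume "a \<in> {of_int j * x | j. True}" "b \<in> {\<Sum>x\<in>A. of_int (n x) * x | n :: real \<Rightarrow> int. True}" and ab: "a + b = 0"
    then obtain j n where jn: "a = of_int j * x" "b = (\<Sum>x\<in>A. of_int (n x) * x)" by blast
    then have "j = 0" using zero[of j n] ab by simp
    then show "a = 0 \<and> b = 0" using jn ab by simp
  qed
  ultimately show ?case
    using insert.hyps IH mean_value_exp_Re_cis[OF \<open>x \<noteq> 0\<close>, of "z x"] by simp
qed

section \<open>Prokhorov's theorem in Euclidean space\<close>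

text \<open>With digits at most \<open>D\<close>, the base \<open>2 * D + 2\<close> leaves gaps as in the Cantor set, so nearby sums
  have the same leading digits.\<close>

definition digit_sum :: "real \<Rightarrow> (nat \<Rightarrow> nat) \<Rightarrow> real" where
  "digit_sum B a = (\<Sum>i. real (a i) / B ^ Suc i)"

context
  fixes B :: real and D :: nat
  assumes B: "B = 2 * real D + 2"
begin

lemma digit_sum_summable:
  assumes "\<And>i. a i \<le> D"
  shows "summable (\<lambda>i. real (a i) / B ^ Suc i)"
proof (rule summable_comparison_test')
  have "summable (\<lambda>i. real D * (1 / B) ^ Suc i)"
    using B by (intro summable_mult summable_ignore_initial_segment[where k=1, simplified] summable_geometric) simp
  then show "summable (\<lambda>i. real D * (1 / B) ^ Suc i)" .
  show "norm (real (a i) / B ^ Suc i) \<le> real D * (1 / B) ^ Suc i" for i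
    using assms[of i] B by (simp add: power_divide divide_right_mono del: power_Suc)
qed

lemma digit_sum_nonneg: "(\<And>i. a i \<le> D) \<Longrightarrow> 0 \<le> digit_sum B a"
  unfolding digit_sum_def using B by (intro suminf_nonneg digit_sum_summable) auto

lemma digit_sum_rec:
  assumes "\<And>i. a i \<le> D"
  shows "digit_sum B a = (real (a 0) + digit_sum B (a \<circ> Suc)) / B"
proof -
  have "digit_sum B a = (\<Sum>i. real (a (Suc i)) / B ^ Suc (Suc i)) + real (a 0) / B"
    unfolding digit_sum_def using suminf_split_head[OF digit_sum_summable[of a]] assms by simp
  also have "(\<Sum>i. real (a (Suc i)) / B ^ Suc (Suc i)) = (\<Sum>i. (real (a (Suc i)) / B ^ Suc i) / B)"
    by (simp add: field_simps)
  also have "\<dots> = digit_sum B (a \<circ> Suc) / B"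
    unfolding digit_sum_def using digit_sum_summable[of "a \<circ> Suc"] assms
    by (subst suminf_divide) auto
  finally show ?thesis by (simp add: add_divide_distrib)
qed

text \<open>All digits equal to \<open>D\<close> give \<open>D / (B - 1)\<close>, and
  \<open>B - 1 = 2 * D + 1\<close>; this fixes the choice of the base.\<close>

lemma digit_sum_le_half:
  assumes "\<And>i. a i \<le> D"
  shows "digit_sum B a \<le> 1 / 2"
proof -
  have geo: "(\<lambda>i. real D * (1 / B) ^ Suc i) sums (real D * ((1 / B) * (1 / (1 - 1 / B))))"
    using B sums_mult[OF sums_mult[OF geometric_sums[of "1 / B"], of "1 / B"], of "real D"]
    by simp
  have "digit_sum B a \<le> (\<Sum>i. real D * (1 / B) ^ Suc i)"
    unfolding digit_sum_def
    using B assms by (intro suminf_le digit_sum_summable sums_summable[OF geo])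
      (auto simp: power_divide intro!: divide_right_mono)
  also have "\<dots> = real D * ((1 / B) * (1 / (1 - 1 / B)))"
    using geo by (rule sums_unique[symmetric])
  also have "\<dots> = real D / (B - 1)"
    using B by (simp add: field_simps)
  also have "\<dots> \<le> 1 / 2"
    using B by (simp add: field_simps)
  finally show ?thesis .
qed

text \<open>Digit sums lie in [0,1/2], so a difference below 1/2 forces equal integer parts.
  Multiplication by \<open>B\<close> moves the first digit into the integer part; \<open>p\<close>
  and \<open>q\<close> occur in the statement so that the induction hypothesis covers the
  result.\<close>

lemma nat_add_digit_sum_eq:
  assumes "\<And>i. a i \<le> D" "\<And>i. b i \<le> D"
    and "\<bar>(real p + digit_sum B a) - (real q + digit_sum B b)\<bar> < 1 / (2 * B ^ N)"
  shows "p = q \<and> (\<forall>i<N. a i = b i)"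
  using assms
proof (induction N arbitrary: p q a b)
  case 0
  then have "\<bar>(real p + digit_sum B a) - (real q + digit_sum B b)\<bar> < 1 / 2" by simp
  then have "\<bar>real p - real q\<bar> < 1"
    using digit_sum_nonneg[of a, OF 0(1)] digit_sum_nonneg[of b, OF 0(2)] digit_sum_le_half[of a, OF 0(1)] digit_sum_le_half[of b, OF 0(2)]
    by linarith
  then show ?case by auto
next
  case (Suc N)
  have Bpos: "B > 0" using B by simp
  have "1 \<le> B ^ Suc N" using B by (intro one_le_power) simp
  then have "1 / (2 * B ^ Suc N) \<le> 1 / 2" by (intro divide_left_mono) auto
  then have "\<bar>(real p + digit_sum B a) - (real q + digit_sum B b)\<bar> < 1 / 2"
    using Suc.prems(3) by simp
  then have "\<bar>real p - real q\<bar> < 1"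
    using digit_sum_nonneg[of a, OF Suc.prems(1)] digit_sum_nonneg[of b, OF Suc.prems(2)]
      digit_sum_le_half[of a, OF Suc.prems(1)] digit_sum_le_half[of b, OF Suc.prems(2)] by linarith
  then have pq: "p = q" by auto
  have "\<bar>(real (a 0) + digit_sum B (a \<circ> Suc)) - (real (b 0) + digit_sum B (b \<circ> Suc))\<bar> / B
      = \<bar>digit_sum B a - digit_sum B b\<bar>"
    unfolding digit_sum_rec[of a, OF Suc.prems(1)] digit_sum_rec[of b, OF Suc.prems(2)]
    using Bpos by (simp flip: diff_divide_distrib)
  also have "\<dots> < 1 / (2 * B ^ N) / B"
    using Suc.prems(3) pq by (simp add: mult_ac)
  finally have "\<bar>(real (a 0) + digit_sum B (a \<circ> Suc)) - (real (b 0) + digit_sum B (b \<circ> Suc))\<bar> < 1 / (2 * B ^ N)"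
    using Bpos divide_less_cancel by (metis less_asym)
  from Suc.IH[OF _ _ this] Suc.prems have "a 0 = b 0" "\<forall>i<N. a (Suc i) = b (Suc i)"
    by auto
  with pq show ?case
    by (auto simp: less_Suc_eq_0_disj)
qed

end

section \<open>Coding of points by dyadic cubes\<close>

definition dyadic_cell :: "nat \<Rightarrow> real ^ 'n \<Rightarrow> 'n \<Rightarrow> int" where
  "dyadic_cell N x = (\<lambda>k. \<lfloor>2 ^ N * x $ k\<rfloor>)"

lemma measurable_dyadic_cell [measurable]:
  "dyadic_cell N \<in> measurable borel (count_space (UNIV :: ('n::finite \<Rightarrow> int) set))"
proof -
  have "dyadic_cell N -` {v} = (\<Inter>k. (\<lambda>x. \<lfloor>2 ^ N * x $ k\<rfloor>) -` {v k})" for v :: "'n \<Rightarrow> int"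
    by (auto simp: dyadic_cell_def fun_eq_iff)
  moreover have "(\<lambda>x :: real ^ 'n. \<lfloor>2 ^ N * x $ k\<rfloor>) -` {j} \<in> sets borel" for k j
    by (rule measurable_sets_borel[of _ "count_space UNIV"]) auto
  ultimately show ?thesis
    by (subst measurable_count_space_eq2_countable) auto
qed

text \<open>The next binary digits of all coordinates, coded as one number: they select the subcube
  of the level \<open>i\<close> cube that contains \<open>x\<close>. There are finitely many codes,
  hence a common bound for the digits.\<close>

definition dyadic_digit :: "nat \<Rightarrow> real ^ 'n \<Rightarrow> nat" where
  "dyadic_digit i x = to_nat (\<lambda>k. odd (dyadic_cell (Suc i) x k))"

lemma measurable_dyadic_digit [measurable]:
  "(dyadic_digit i :: real ^ 'n::finite \<Rightarrow> nat) \<in> measurable borel (count_space UNIV)"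
proof -
  have "(\<lambda>v :: 'n \<Rightarrow> int. to_nat (\<lambda>k. odd (v k))) \<circ> dyadic_cell (Suc i) \<in> measurable borel (count_space UNIV)"
    by (rule measurable_comp[OF measurable_dyadic_cell]) simp
  then show ?thesis by (simp add: dyadic_digit_def[abs_def] o_def)
qed

lemma dyadic_digit_le: "dyadic_digit i (x :: real ^ 'n::finite) \<le> Max (range (to_nat :: ('n \<Rightarrow> bool) \<Rightarrow> nat))"
  unfolding dyadic_digit_def by (intro Max_ge) auto

text \<open>Halving and rounding down the coordinates of a cell gives its parent, so a cell is
  recovered from its parent and the parities of its coordinates.\<close>

lemma dyadic_cell_eqI:
  assumes "dyadic_cell 0 x = dyadic_cell 0 y" "\<forall>i<N. dyadic_digit i x = dyadic_digit i (y :: real ^ 'n::finite)"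
  shows "dyadic_cell N x = dyadic_cell N y"
  using assms(2)
proof (induction N)
  case 0
  then show ?case using assms(1) by simp
next
  case (Suc N)
  have split: "dyadic_cell (Suc N) z k = 2 * dyadic_cell N z k + (if odd (dyadic_cell (Suc N) z k) then 1 else 0)"
    for z :: "real ^ 'n" and k
  proof -
    have "\<lfloor>2 ^ Suc N * z $ k\<rfloor> div 2 = \<lfloor>2 ^ N * z $ k\<rfloor>"
      using floor_divide_real_eq_div[of 2 "2 ^ Suc N * z $ k"] by simp
    then have "dyadic_cell N z k = dyadic_cell (Suc N) z k div 2"
      by (simp add: dyadic_cell_def)
    then show ?thesis
      using odd_two_times_div_two_succ[of "dyadic_cell (Suc N) z k"] by auto
  qed
  have "(\<lambda>k. odd (dyadic_cell (Suc N) x k)) = (\<lambda>k. odd (dyadic_cell (Suc N) y k))"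
    using Suc.prems by (auto simp: dyadic_digit_def)
  then have "odd (dyadic_cell (Suc N) x k) = odd (dyadic_cell (Suc N) y k)" for k
    by metis
  moreover have "dyadic_cell N x = dyadic_cell N y"
    using Suc by simp
  ultimately have "2 * dyadic_cell N x k + (if odd (dyadic_cell (Suc N) x k) then 1 else 0) =
      2 * dyadic_cell N y k + (if odd (dyadic_cell (Suc N) y k) then 1 else 0)" for k
    by simp
  then show ?case
    unfolding split[symmetric] by (rule ext)
qed

lemma dyadic_cell_eq_dist:
  fixes x y :: "real ^ 'n::finite"
  assumes "dyadic_cell N x = dyadic_cell N y"
  shows "dist x y \<le> real CARD('n) / 2 ^ N"
proof -
  have "\<bar>x $ k - y $ k\<bar> \<le> 1 / 2 ^ N" for k
  proof -
    have "\<lfloor>2 ^ N * x $ k\<rfloor> = \<lfloor>2 ^ N * y $ k\<rfloor>"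
      using assms by (auto simp: dyadic_cell_def dest: fun_cong)
    then have "\<bar>2 ^ N * x $ k - 2 ^ N * y $ k\<bar> \<le> 1" by linarith
    then have "2 ^ N * \<bar>x $ k - y $ k\<bar> \<le> 1"
      by (simp add: abs_mult flip: right_diff_distrib)
    then show ?thesis by (simp add: field_simps)
  qed
  then have "(\<Sum>k\<in>UNIV. \<bar>(x - y) $ k\<bar>) \<le> real CARD('n) * (1 / 2 ^ N)"
    by (intro sum_bounded_above) auto
  then show ?thesis
    using norm_le_l1_cart[of "x - y"] by (simp add: dist_norm)
qed

text \<open>The integer part codes the unit cube of \<open>x\<close>, the digits its dyadic
  subdivisions. Measures are pushed forward along \<open>s\<close>, which has to be Borel; test
  functions are pulled back along \<open>g\<close>, which has to be continuous. Boundedness of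
  \<open>s\<close> on balls carries tightness to the line.\<close>

lemma borel_section_uniformly_continuous_inverse:
  obtains s :: "real ^ 'n::finite \<Rightarrow> real" and g :: "real \<Rightarrow> real ^ 'n"
  where "s \<in> borel_measurable borel" "continuous_on UNIV g" "\<And>x. g (s x) = x"
    "\<And>R. bounded (s ` cball 0 R)"
proof -
  define D where "D = Max (range (to_nat :: ('n \<Rightarrow> bool) \<Rightarrow> nat))"
  define B where "B = 2 * real D + 2"
  define s where "s x = real (to_nat (dyadic_cell 0 x)) + digit_sum B (\<lambda>i. dyadic_digit i x)" for x :: "real ^ 'n"
  have dig: "dyadic_digit i x \<le> D" for i and x :: "real ^ 'n"
    unfolding D_def by (rule dyadic_digit_le)
  have meas: "s \<in> borel_measurable borel"
    unfolding s_def digit_sum_def by measurable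
  have close: "dist x y \<le> real CARD('n) / 2 ^ N" if "\<bar>s x - s y\<bar> < 1 / (2 * B ^ N)" for x y N
  proof (rule dyadic_cell_eq_dist, rule dyadic_cell_eqI)
    have *: "to_nat (dyadic_cell 0 x) = to_nat (dyadic_cell 0 y) \<and> (\<forall>i<N. dyadic_digit i x = dyadic_digit i y)"
      using that unfolding s_def by (intro nat_add_digit_sum_eq[OF B_def]) (auto intro: dig)
    then show "dyadic_cell 0 x = dyadic_cell 0 y" "\<forall>i<N. dyadic_digit i x = dyadic_digit i y" by auto
  qed
  have small: "\<exists>N. real CARD('n) / 2 ^ N < e" if "e > 0" for e :: real
  proof -
    have "(\<lambda>N. real CARD('n) / 2 ^ N) \<longlonglongrightarrow> 0"
      by (intro tendsto_divide_0[OF tendsto_const] filterlim_realpow_sequentially_gt1) simp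
    then have "\<forall>\<^sub>F N in sequentially. real CARD('n) / 2 ^ N < e"
      using that by (rule order_tendstoD)
    then show ?thesis by (auto simp: eventually_sequentially)
  qed
  have uc: "\<exists>d>0. \<forall>x y. \<bar>s x - s y\<bar> < d \<longrightarrow> dist x y < e" if "e > 0" for e
  proof -
    obtain N where "real CARD('n) / 2 ^ N < e" using small[OF \<open>e > 0\<close>] by blast
    then have "\<bar>s x - s y\<bar> < 1 / (2 * B ^ N) \<Longrightarrow> dist x y < e" for x y
      using close[of x y N] by linarith
    moreover have "1 / (2 * B ^ N) > 0" by (simp add: B_def)
    ultimately show ?thesis by blast
  qed
  have "inj s"
  proof (rule injI, rule ccontr)
    fix x y assume "s x = s y" "x \<noteq> y"
    then have "dist x y < dist x y" using uc[of "dist x y"] by (metis abs_zero diff_self zero_less_dist_iff)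
    then show False by simp
  qed
  then have inv: "inv s (s x) = x" for x by simp
  have inv_uc: "uniformly_continuous_on (range s) (inv s)"
    unfolding uniformly_continuous_on_def
  proof (intro allI impI)
    fix e :: real assume "e > 0"
    from uc[OF this] obtain d where d: "d > 0" "\<forall>x y. \<bar>s x - s y\<bar> < d \<longrightarrow> dist x y < e" by blast
    show "\<exists>d>0. \<forall>x\<in>range s. \<forall>x'\<in>range s. dist x' x < d \<longrightarrow> dist (inv s x') (inv s x) < e"
      using d by (intro exI[of _ d]) (auto simp: inv dist_real_def)
  qed
  \<comment> \<open>Uniform continuity gives an extension to the closure of the range; from this
    closed set Dugundji's theorem extends to the line.\<close>
  obtain h where h: "uniformly_continuous_on (closure (range s)) h" "\<And>x. x \<in> range s \<Longrightarrow> inv s x = h x"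
    by (rule uniformly_continuous_on_extension_on_closure[OF inv_uc]) iprover
  obtain g where g: "continuous_on UNIV g" "\<And>x. x \<in> closure (range s) \<Longrightarrow> g x = h x"
    by (rule Dugundji[of UNIV UNIV "closure (range s)" h])
      (use uniformly_continuous_imp_continuous[OF h(1)] in auto)
  have "g (s x) = x" for x
    using g(2)[of "s x"] h(2)[of "s x"] closure_subset[of "range s"] inv[of x] by auto
  moreover have "bounded (s ` cball 0 R)" for R
  proof -
    \<comment> \<open>A ball meets finitely many unit cubes, so their codes are bounded; the digits
      add at most 1/2.\<close>
    have "dyadic_cell 0 x \<in> (UNIV :: 'n set) \<rightarrow>\<^sub>E {-\<lceil>R\<rceil>-1..\<lceil>R\<rceil>}" if "x \<in> cball 0 R" for x
    proof -
      have cell: "-\<lceil>R\<rceil>-1 \<le> \<lfloor>x $ k\<rfloor> \<and> \<lfloor>x $ k\<rfloor> \<le> \<lceil>R\<rceil>" for k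
        using that component_le_norm_cart[of x k] by simp linarith
      then show ?thesis by (simp add: dyadic_cell_def PiE_def Pi_def)
    qed
    then have "dyadic_cell 0 ` cball 0 R \<subseteq> (UNIV :: 'n set) \<rightarrow>\<^sub>E {-\<lceil>R\<rceil>-1..\<lceil>R\<rceil>}" by blast
    then have fin: "finite (dyadic_cell 0 ` cball (0 :: real ^ 'n) R)"
      by (rule finite_subset) (auto intro: finite_PiE)
    define m where "m = Max (to_nat ` dyadic_cell 0 ` cball (0 :: real ^ 'n) R)"
    have "norm (s x) \<le> real m + 1 / 2" if "x \<in> cball 0 R" for x
    proof -
      have "to_nat (dyadic_cell 0 x) \<le> m"
        unfolding m_def using fin that by (intro Max_ge) auto
      then show ?thesis
        unfolding s_def using digit_sum_nonneg[OF B_def, of "\<lambda>i. dyadic_digit i x"] digit_sum_le_half[OF B_def, of "\<lambda>i. dyadic_digit i x"] dig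
        by auto
    qed
    then show ?thesis unfolding bounded_iff by blast
  qed
  ultimately show thesis using that meas g(1) by blast
qed

text \<open>The limit \<open>\<nu>\<close> on the line may charge points outside the range of
  \<open>s\<close>. As \<open>g\<close> is continuous everywhere, the image of \<open>\<nu>\<close>
  under \<open>g\<close> still makes sense, and \<open>g (s x) = x\<close> identifies the integrals
  along the sequence.\<close>

theorem tight_imp_weakly_convergent_subsequence:
  fixes M :: "nat \<Rightarrow> (real ^ 'n::finite) measure"
  assumes prob: "\<And>n. prob_space (M n)" and sets [measurable_cong]: "\<And>n. sets (M n) = sets borel"
    and tight: "\<And>e. e > 0 \<Longrightarrow> \<exists>R. \<forall>n. measure (M n) (cball 0 R) > 1 - e"
  obtains r \<mu> where "strict_mono r" "prob_space \<mu>" "sets \<mu> = sets borel"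
    "\<And>f :: real ^ 'n \<Rightarrow> real. continuous_on UNIV f \<Longrightarrow> bounded (range f) \<Longrightarrow>
       (\<lambda>n. \<integral>x. f x \<partial>M (r n)) \<longlonglongrightarrow> (\<integral>x. f x \<partial>\<mu>)"
proof -
  obtain s :: "real ^ 'n \<Rightarrow> real" and g where s [measurable]: "s \<in> borel_measurable borel"
    and g: "continuous_on UNIV g" and gs: "\<And>x. g (s x) = x" and bdd: "\<And>R. bounded (s ` cball 0 R)"
    using borel_section_uniformly_continuous_inverse by blast
  have g_meas [measurable]: "g \<in> borel_measurable borel"
    using g by (rule borel_measurable_continuous_onI)
  define N where "N n = distr (M n) borel s" for n
  have s' [measurable]: "s \<in> borel_measurable (M n)" for n
    by measurable
  have rd: "real_distribution (N n)" for n
    unfolding N_def using prob_space.real_distribution_distr[OF prob s'] .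
  have "tight N"
    unfolding tight_def
  proof (intro conjI allI impI rd)
    fix e :: real assume "e > 0"
    from tight[OF this] obtain R where R: "\<And>n. measure (M n) (cball 0 R) > 1 - e" by blast
    obtain C where C: "\<And>x. x \<in> cball 0 R \<Longrightarrow> \<bar>s x\<bar> \<le> C"
      using bdd[of R] unfolding bounded_iff real_norm_def by blast
    \<comment> \<open>Positive, and larger than \<open>C\<close> so that the values fit into an
      interval open on the left.\<close>
    define C' where "C' = max C 0 + 1"
    have "measure (N n) {- C'<..C'} > 1 - e" for n
    proof -
      interpret Mn: prob_space "M n" by (rule prob)
      have "cball 0 R \<subseteq> s -` {- C'<..C'} \<inter> space (M n)"
        using C sets_eq_imp_space_eq[OF sets] by (fastforce simp: C'_def abs_le_iff)
      then have "measure (M n) (cball 0 R) \<le> measure (M n) (s -` {- C'<..C'} \<inter> space (M n))"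
        by (intro Mn.finite_measure_mono) measurable
      also have "\<dots> = measure (N n) {- C'<..C'}"
        unfolding N_def by (rule measure_distr[symmetric]) auto
      finally show ?thesis using R[of n] by simp
    qed
    moreover have "- C' < C'" by (auto simp: C'_def)
    ultimately show "\<exists>a b. a < b \<and> (\<forall>n. measure (N n) {a<..b} > 1 - e)" by blast
  qed
  from tight_imp_convergent_subsubsequence[OF this strict_mono_id]
  obtain r \<nu> where r: "strict_mono r" "real_distribution \<nu>" "weak_conv_m (N \<circ> r) \<nu>"
    by (auto simp: o_def)
  interpret \<nu>: real_distribution \<nu> by (rule r)
  show thesis
  proof (rule that[OF r(1)])
    show "prob_space (distr \<nu> borel g)" by (rule \<nu>.prob_space_distr) measurable
    show "sets (distr \<nu> borel g) = sets borel" by simp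
    fix f :: "real ^ 'n \<Rightarrow> real" assume f: "continuous_on UNIV f" "bounded (range f)"
    have [measurable]: "f \<in> borel_measurable borel"
      using f(1) by (rule borel_measurable_continuous_onI)
    obtain C where C: "\<And>x. norm (f x) \<le> C" using f(2) unfolding bounded_iff by auto
    have cont: "continuous_on UNIV (\<lambda>x. f (g x))"
      using continuous_on_compose2[OF f(1) g] by simp
    have "(\<lambda>n. integral\<^sup>L ((N \<circ> r) n) (\<lambda>x. f (g x))) \<longlonglongrightarrow> integral\<^sup>L \<nu> (\<lambda>x. f (g x))"
      using cont C rd by (intro weak_conv_imp_integral_bdd_continuous_conv[OF _ r(2) r(3)])
        (auto simp: continuous_on_eq_continuous_at)
    also have "(\<lambda>n. integral\<^sup>L ((N \<circ> r) n) (\<lambda>x. f (g x))) = (\<lambda>n. \<integral>x. f x \<partial>M (r n))"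
      unfolding N_def o_def by (subst integral_distr) (auto simp: gs)
    also have "integral\<^sup>L \<nu> (\<lambda>x. f (g x)) = integral\<^sup>L (distr \<nu> borel g) f"
      by (subst integral_distr) auto
    finally show "(\<lambda>n. \<integral>x. f x \<partial>M (r n)) \<longlonglongrightarrow> (\<integral>x. f x \<partial>distr \<nu> borel g)" .
  qed
qed

section \<open>Existence of the limiting distribution\<close>

lemma finite_measure_le_of_emeasure_le:
  assumes "emeasure M A \<le> ennreal b" "b \<ge> 0"
  shows "emeasure M A < \<infinity>" "measure M A \<le> b"
  using assms le_less_trans[OF assms(1) ennreal_less_top] by (auto simp: measure_def enn2real_leI)

lemma integral_cmult_indicator_lebesgue:
  fixes a :: real
  shows "A \<in> sets lebesgue \<Longrightarrow> (\<integral>y. a * indicator A y \<partial>lebesgue) = a * measure lebesgue A"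
  by simp

text \<open>Nothing is known about \<open>phi\<close> on the negative axis, so measurability is
  asked of its extension by 0 from the half-line.\<close>

locale density_approximation =
  fixes phi :: "real \<Rightarrow> 'a::euclidean_space" and P :: "real \<Rightarrow> real \<Rightarrow> 'a"
  assumes phi_meas: "(\<lambda>y. indicator {0..} y *\<^sub>R phi y) \<in> borel_measurable lebesgue"
    and P_ap: "\<And>T b. b \<in> Basis \<Longrightarrow> almost_periodic UNIV (\<lambda>y. complex_of_real (P T y \<bullet> b))"
    and approx: "approximable_in_density phi P"
begin

lemma P_continuous: "continuous_on UNIV (P T)"
proof -
  have "continuous_on UNIV (\<lambda>y. P T y \<bullet> b)" if "b \<in> Basis" for b
    using continuous_on_Re[OF almost_periodic_continuous[OF P_ap[OF that, of T], of UNIV]] by simp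
  then show ?thesis by (rule continuous_on_componentwise[THEN iffD2, rule_format])
qed

lemma P_measurable: "P T \<in> borel_measurable lebesgue"
  using borel_measurable_continuous_onI[OF P_continuous] by (simp add: measurable_completion)

lemma P_bounded: obtains R where "\<And>y. norm (P T y) \<le> R"
proof -
  have "\<exists>B. \<forall>y. \<bar>P T y \<bullet> b\<bar> \<le> B" if "b \<in> Basis" for b
    using almost_periodic_bounded[OF P_ap[OF that, of T]] by (metis norm_of_real)
  then obtain B where B: "\<And>b y. b \<in> Basis \<Longrightarrow> \<bar>P T y \<bullet> b\<bar> \<le> B b" by metis
  have "norm (P T y) \<le> (\<Sum>b\<in>Basis. B b)" for y
    using norm_le_l1[of "P T y"] B by (meson order_trans sum_mono)
  then show thesis by (rule that)
qed

lemma measurable_compose_phi: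
  assumes "f \<in> borel_measurable borel" "A \<in> sets lebesgue" "A \<subseteq> {0..}"
  shows "(\<lambda>y. indicator A y * (f (phi y) :: real)) \<in> borel_measurable lebesgue"
proof -
  have "(\<lambda>y. indicator A y * f (indicator {0..} y *\<^sub>R phi y)) \<in> borel_measurable lebesgue"
    by (intro borel_measurable_times borel_measurable_indicator assms(2) measurable_compose[OF phi_meas assms(1)])
  also have "(\<lambda>y. indicator A y * f (indicator {0..} y *\<^sub>R phi y)) = (\<lambda>y. indicator A y * f (phi y))"
    using assms(3) by (auto simp: indicator_def fun_eq_iff)
  finally show ?thesis .
qed

lemma sets_large_error: "{y\<in>{0..Y}. e \<le> norm (phi y - P T y)} \<in> sets lebesgue"
proof -
  have "(\<lambda>y. norm (indicator {0..} y *\<^sub>R phi y - P T y)) \<in> borel_measurable lebesgue"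
    by (intro measurable_compose[OF _ borel_measurable_norm] borel_measurable_diff phi_meas P_measurable)
  from borel_measurable_le[OF borel_measurable_const this]
  have "{y\<in>space lebesgue. e \<le> norm (indicator {0..} y *\<^sub>R phi y - P T y)} \<inter> {0..Y} \<in> sets lebesgue"
    by (intro sets.Int) auto
  also have "{y\<in>space lebesgue. e \<le> norm (indicator {0..} y *\<^sub>R phi y - P T y)} \<inter> {0..Y}
     = {y\<in>{0..Y}. e \<le> norm (phi y - P T y)}"
    by (auto simp: indicator_def)
  finally show ?thesis .
qed

text \<open>A single \<open>P T\<close> is bounded, so \<open>phi\<close> can be large only where it
  is far from \<open>P T\<close>.\<close>

lemma density_tight:
  assumes "e > 0"
  obtains R where "R > 0" "\<forall>\<^sub>F Y in at_top. emeasure lebesgue {y\<in>{0..Y}. R \<le> norm (phi y)} \<le> ennreal (e * Y)"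
proof -
  \<comment> \<open>\<open>d \<le> 1\<close> makes \<open>norm (phi y) \<ge> R + 1\<close> force an
    error of at least \<open>d\<close>; \<open>d \<le> e\<close> gives the density claimed.\<close>
  define d where "d = min e 1"
  have d: "d > 0" "d \<le> e" "d \<le> 1" using assms by (auto simp: d_def)
  have "\<forall>\<^sub>F T in at_top. \<forall>\<^sub>F Y in at_top. emeasure lebesgue {y\<in>{0..Y}. d \<le> norm (phi y - P T y)} \<le> ennreal (d * Y)"
    using approx d unfolding approximable_in_density_def by blast
  then obtain T where T: "\<forall>\<^sub>F Y in at_top. emeasure lebesgue {y\<in>{0..Y}. d \<le> norm (phi y - P T y)} \<le> ennreal (d * Y)"
    using eventually_happens'[OF trivial_limit_at_top_linorder] by blast
  obtain R where R: "\<And>y. norm (P T y) \<le> R" using P_bounded by blast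
  have "R \<ge> 0" using order_trans[OF norm_ge_zero R] .
  show thesis
  proof (rule that)
    show "R + 1 > 0" using \<open>R \<ge> 0\<close> by simp
    show "\<forall>\<^sub>F Y in at_top. emeasure lebesgue {y\<in>{0..Y}. R + 1 \<le> norm (phi y)} \<le> ennreal (e * Y)"
      using T eventually_ge_at_top[of 0]
    proof eventually_elim
      case (elim Y)
      have "{y\<in>{0..Y}. R + 1 \<le> norm (phi y)} \<subseteq> {y\<in>{0..Y}. d \<le> norm (phi y - P T y)}"
      proof safe
        fix y assume "R + 1 \<le> norm (phi y)"
        then show "d \<le> norm (phi y - P T y)"
          using R[of y] norm_triangle_ineq2[of "phi y" "P T y"] d by linarith
      qed
      then have "emeasure lebesgue {y\<in>{0..Y}. R + 1 \<le> norm (phi y)} \<le> emeasure lebesgue {y\<in>{0..Y}. d \<le> norm (phi y - P T y)}"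
        by (intro emeasure_mono sets_large_error)
      also have "\<dots> \<le> ennreal (d * Y)" by (rule elim)
      also have "\<dots> \<le> ennreal (e * Y)" using d elim by (intro ennreal_leI mult_right_mono) auto
      finally show ?case .
    qed
  qed
qed

text \<open>Where \<open>phi\<close> is bounded and close to \<open>P T\<close>, uniform continuity
  of \<open>f\<close> on a ball bounds the difference; on the two remaining sets, of small density,
  it is at most \<open>2 * B\<close>. The ball comes from tightness of \<open>phi\<close>, hence is
  the same for all \<open>T\<close>.\<close>

lemma average_diff_le:
  fixes f :: "'a \<Rightarrow> real"
  assumes f: "continuous_on UNIV f" and bdd: "\<And>x. \<bar>f x\<bar> \<le> B" and e: "e > 0"
  shows "\<forall>\<^sub>F T in at_top. \<forall>\<^sub>F Y in at_top. \<bar>average (\<lambda>y. f (phi y)) Y - average (\<lambda>y. f (P T y)) Y\<bar> \<le> e"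
proof -
  have B: "B \<ge> 0" using bdd[of 0] by linarith
  \<comment> \<open>Each exceptional set then costs at most \<open>e * Y / 3\<close>; the summand 1
    covers \<open>B = 0\<close>.\<close>
  define d where "d = e / (3 * (2 * B + 1))"
  have d: "d > 0" "2 * B * d \<le> e / 3"
    using e B by (auto simp: d_def field_simps)
  obtain R where R: "R > 0" "\<forall>\<^sub>F Y in at_top. emeasure lebesgue {y\<in>{0..Y}. R \<le> norm (phi y)} \<le> ennreal (d * Y)"
    using density_tight[OF d(1)] by blast
  have "uniformly_continuous_on (cball 0 (R + 1)) f"
    by (intro compact_uniformly_continuous continuous_on_subset[OF f]) auto
  moreover have "e / 3 > 0" using e by simp
  ultimately obtain h0 where h0: "h0 > 0" "\<forall>x\<in>cball 0 (R + 1). \<forall>x'\<in>cball 0 (R + 1). dist x' x < h0 \<longrightarrow> dist (f x') (f x) < e / 3"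
    unfolding uniformly_continuous_on_def by blast
  \<comment> \<open>\<open>h0\<close> serves uniform continuity, \<open>d\<close> bounds the density
    of large errors, and 1 keeps \<open>P T y\<close> in the enlarged ball.\<close>
  define h where "h = min h0 (min d 1)"
  have h: "h > 0" "h \<le> h0" "h \<le> d" "h \<le> 1" using h0(1) d(1) by (auto simp: h_def)
  have close: "\<bar>f x - f x'\<bar> \<le> e / 3" if "norm x < R" "norm (x - x') < h" for x x'
  proof -
    have "norm x' \<le> R + 1" using that h norm_triangle_ineq2[of x' x] by (simp add: norm_minus_commute)
    then have "x \<in> cball 0 (R + 1)" "x' \<in> cball 0 (R + 1)" "dist x x' < h0"
      using that h by (auto simp: dist_norm)
    then have "dist (f x) (f x') < e / 3" using h0(2) by blast
    then show ?thesis by (simp add: dist_real_def)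
  qed
  have "\<forall>\<^sub>F T in at_top. \<forall>\<^sub>F Y in at_top. emeasure lebesgue {y\<in>{0..Y}. h \<le> norm (phi y - P T y)} \<le> ennreal (h * Y)"
    using approx h(1) unfolding approximable_in_density_def by blast
  then show ?thesis
  proof eventually_elim
    case (elim T)
    show ?case using elim R(2) eventually_gt_at_top[of 0]
    proof eventually_elim
      case (elim Y)
      let ?U = "{y\<in>{0..Y}. h \<le> norm (phi y - P T y)}" and ?V = "{y\<in>{0..Y}. R \<le> norm (phi y)}"
      have U: "?U \<in> sets lebesgue" by (rule sets_large_error)
      have V: "?V \<in> sets lebesgue"
      proof -
        have "(\<lambda>y. norm (indicator {0..} y *\<^sub>R phi y)) \<in> borel_measurable lebesgue"
          by (intro measurable_compose[OF _ borel_measurable_norm] phi_meas)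
        from borel_measurable_le[OF borel_measurable_const this]
        have "{y\<in>space lebesgue. R \<le> norm (indicator {0..} y *\<^sub>R phi y)} \<inter> {0..Y} \<in> sets lebesgue"
          by (intro sets.Int) auto
        also have "{y\<in>space lebesgue. R \<le> norm (indicator {0..} y *\<^sub>R phi y)} \<inter> {0..Y} = ?V"
          by (auto simp: indicator_def)
        finally show ?thesis .
      qed
      have f_meas: "f \<in> borel_measurable borel" by (rule borel_measurable_continuous_onI[OF f])
      have bint: "integrable lebesgue (\<lambda>y. indicator {0..Y} y *\<^sub>R g y)"
        if "(\<lambda>y. indicator {0..Y} y * g y) \<in> borel_measurable lebesgue" "\<And>y. \<bar>g y\<bar> \<le> B" for g :: "real \<Rightarrow> real"
      proof (rule Bochner_Integration.integrable_bound)
        show "integrable lebesgue (\<lambda>y. indicator {0..Y} y * B)"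
          using set_integrable_continuous_lebesgue[of Y "\<lambda>_. B"] by (simp add: set_integrable_def)
      qed (use that B in \<open>auto simp: indicator_def\<close>)
      have int1: "set_integrable lebesgue {0..Y} (\<lambda>y. f (phi y))"
        unfolding set_integrable_def using bdd by (intro bint measurable_compose_phi f_meas) auto
      have int2: "set_integrable lebesgue {0..Y} (\<lambda>y. f (P T y))"
        by (rule set_integrable_continuous_lebesgue, rule continuous_on_compose2[OF f continuous_on_subset[OF P_continuous]]) auto
      have hY: "h * Y \<ge> 0" "d * Y \<ge> 0" using h(1) d(1) \<open>0 < Y\<close> by simp_all
      note mU = finite_measure_le_of_emeasure_le[OF elim(1) hY(1)]
      note mV = finite_measure_le_of_emeasure_le[OF elim(2) hY(2)]
      have intI: "integrable lebesgue (\<lambda>y. indicator {0..Y} y * (e / 3))"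
        using set_integrable_continuous_lebesgue[of Y "\<lambda>_. e / 3"] by (simp add: set_integrable_def)
      have intU: "integrable lebesgue (\<lambda>y. 2 * B * indicator ?U y)" and intV: "integrable lebesgue (\<lambda>y. 2 * B * indicator ?V y)"
        by (intro integrable_mult_right integrable_real_indicator U V mU mV)+
      have "\<bar>(LINT y:{0..Y}|lebesgue. f (phi y)) - (LINT y:{0..Y}|lebesgue. f (P T y))\<bar>
          = norm (LINT y:{0..Y}|lebesgue. f (phi y) - f (P T y))"
        using int1 int2 by (simp add: set_integral_diff)
      also have "\<dots> \<le> (\<integral>y. indicator {0..Y} y * (e / 3) + 2 * B * indicator ?U y + 2 * B * indicator ?V y \<partial>lebesgue)"
        unfolding set_lebesgue_integral_def
      proof (rule Bochner_Integration.integral_norm_bound_integral)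
        show "integrable lebesgue (\<lambda>y. indicator {0..Y} y *\<^sub>R (f (phi y) - f (P T y)))"
          using set_integral_diff(1)[OF int1 int2] by (simp add: set_integrable_def)
        show "integrable lebesgue (\<lambda>y. indicator {0..Y} y * (e / 3) + 2 * B * indicator ?U y + 2 * B * indicator ?V y)"
          by (intro Bochner_Integration.integrable_add intI intU intV)
        fix y
        show "norm (indicator {0..Y} y *\<^sub>R (f (phi y) - f (P T y))) \<le> indicator {0..Y} y * (e / 3) + 2 * B * indicator ?U y + 2 * B * indicator ?V y"
        proof (cases "y \<in> {0..Y} \<and> y \<notin> ?U \<and> y \<notin> ?V")
          case True
          then show ?thesis using close[of "phi y" "P T y"] by (auto simp: not_le)
        next
          case False
          have "\<bar>f (phi y) - f (P T y)\<bar> \<le> 2 * B" using bdd[of "phi y"] bdd[of "P T y"] by linarith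
          then show ?thesis using False B e by (cases "y \<in> {0..Y}"; cases "y \<in> ?U"; cases "y \<in> ?V") (simp_all only: indicator_simps, auto)
        qed
      qed
      also have "\<dots> = Y * (e / 3) + 2 * B * measure lebesgue ?U + 2 * B * measure lebesgue ?V"
      proof -
        have "(\<integral>y. indicator {0..Y} y * (e / 3) \<partial>lebesgue) = Y * (e / 3)"
          using \<open>0 < Y\<close> by simp
        then show ?thesis
          unfolding Bochner_Integration.integral_add[OF Bochner_Integration.integrable_add[OF intI intU] intV]
            Bochner_Integration.integral_add[OF intI intU]
            integral_cmult_indicator_lebesgue[OF U] integral_cmult_indicator_lebesgue[OF V] by (rule arg_cong)
      qed
      also have "\<dots> \<le> Y * (e / 3) + 2 * B * (d * Y) + 2 * B * (d * Y)"
      proof -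
        have "h * Y \<le> d * Y" using h \<open>0 < Y\<close> by simp
        then show ?thesis using B by (intro add_mono mult_left_mono order_refl order_trans[OF mU(2)] mV(2)) simp_all
      qed
      also have "\<dots> = Y * (e / 3) + (2 * B * d) * Y + (2 * B * d) * Y" by simp
      also have "\<dots> \<le> Y * (e / 3) + (e / 3) * Y + (e / 3) * Y"
        using d(2) \<open>0 < Y\<close> by (intro add_mono mult_right_mono order_refl) auto
      also have "\<dots> = e * Y" by (simp add: field_simps)
      finally have *: "\<bar>(LINT y:{0..Y}|lebesgue. f (phi y)) - (LINT y:{0..Y}|lebesgue. f (P T y))\<bar> \<le> e * Y" .
      have "\<bar>average (\<lambda>y. f (phi y)) Y - average (\<lambda>y. f (P T y)) Y\<bar>
         = \<bar>(LINT y:{0..Y}|lebesgue. f (phi y)) - (LINT y:{0..Y}|lebesgue. f (P T y))\<bar> / Y"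
        using \<open>0 < Y\<close> by (simp add: average_def flip: diff_divide_distrib)
      also have "\<dots> \<le> e" using * \<open>0 < Y\<close> by (simp add: field_simps)
      finally show ?case .
    qed
  qed
qed

text \<open>One estimate is read twice: with \<open>T\<close> fixed it makes the averages of
  \<open>f (phi y)\<close> Cauchy up to \<open>e\<close>; after \<open>Y\<close> has gone to
  infinity it brings the mean values for \<open>P T\<close> to the same limit.\<close>

lemma average_compose_tendsto:
  fixes f :: "'a \<Rightarrow> real"
  assumes f: "continuous_on UNIV f" and bdd: "bounded (range f)"
  obtains l where "(average (\<lambda>y. f (phi y)) \<longlongrightarrow> l) at_top"
    "((\<lambda>T. mean_value (\<lambda>y. complex_of_real (f (P T y)))) \<longlongrightarrow> complex_of_real l) at_top"
proof -
  obtain B where B: "\<And>x. \<bar>f x\<bar> \<le> B" using bdd unfolding bounded_iff by auto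
  define m where "m T = mean_value (\<lambda>y. complex_of_real (f (P T y)))" for T
  have ap: "almost_periodic UNIV (\<lambda>y. complex_of_real (f (P T y)))" for T
    by (intro almost_periodic_compose_continuous[where f = f and P = "P T"] P_ap f) auto
  have avg: "average (\<lambda>y. complex_of_real (f (P T y))) Y = complex_of_real (average (\<lambda>y. f (P T y)) Y)" for T Y
    unfolding average_def set_integral_complex_of_real by (simp add: scaleR_conv_of_real)
  have lim_c: "((\<lambda>Y. complex_of_real (average (\<lambda>y. f (P T y)) Y)) \<longlongrightarrow> m T) at_top" for T
    using average_tendsto_mean_value[OF ap[of T]] by (simp add: avg[abs_def] m_def)
  have lim: "(average (\<lambda>y. f (P T y)) \<longlongrightarrow> Re (m T)) at_top" for T
    using tendsto_Re[OF lim_c[of T]] by simp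
  have m_real: "m T = complex_of_real (Re (m T))" for T
    by (rule tendsto_unique[OF _ lim_c tendsto_of_real[OF lim]]) simp
  have close: "\<forall>\<^sub>F T in at_top. \<forall>\<^sub>F Y in at_top. \<bar>average (\<lambda>y. f (phi y)) Y - average (\<lambda>y. f (P T y)) Y\<bar> \<le> e" if "e > 0" for e
    by (rule average_diff_le[OF f B that])
  have "\<exists>l. (average (\<lambda>y. f (phi y)) \<longlongrightarrow> l) at_top"
  proof (rule tendsto_of_uniform_approximation)
    fix e :: real assume "e > 0"
    from eventually_happens'[OF trivial_limit_at_top_linorder close[OF this]]
    obtain T where "\<forall>\<^sub>F Y in at_top. \<bar>average (\<lambda>y. f (phi y)) Y - average (\<lambda>y. f (P T y)) Y\<bar> \<le> e" by blast
    then show "\<exists>B m. (B \<longlongrightarrow> m) at_top \<and> (\<forall>\<^sub>F Y in at_top. norm (average (\<lambda>y. f (phi y)) Y - B Y) \<le> e)"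
      using lim by auto
  qed
  then obtain l where l: "(average (\<lambda>y. f (phi y)) \<longlongrightarrow> l) at_top" by blast
  have "((\<lambda>T. Re (m T)) \<longlongrightarrow> l) at_top"
  proof (rule tendstoI)
    fix e :: real assume "e > 0"
    then have "e / 2 > 0" by simp
    from close[OF this] show "\<forall>\<^sub>F T in at_top. dist (Re (m T)) l < e"
    proof eventually_elim
      case (elim T)
      have "((\<lambda>Y. \<bar>average (\<lambda>y. f (phi y)) Y - average (\<lambda>y. f (P T y)) Y\<bar>) \<longlongrightarrow> \<bar>l - Re (m T)\<bar>) at_top"
        by (intro tendsto_rabs tendsto_diff l lim)
      then have "\<bar>l - Re (m T)\<bar> \<le> e / 2"
        using elim by (rule tendsto_upperbound) simp
      then show ?case using \<open>e > 0\<close> by (simp add: dist_real_def abs_minus_commute)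
    qed
  qed
  then have "((\<lambda>T. complex_of_real (Re (m T))) \<longlongrightarrow> complex_of_real l) at_top" by (rule tendsto_of_real)
  then show thesis using that l m_real by (simp add: m_def)
qed

end

section \<open>Construction of the limiting measure\<close>

lemma integral_uniform_measure_Icc:
  fixes g :: "real \<Rightarrow> real"
  assumes "g \<in> borel_measurable lebesgue" "Y > 0"
  shows "(\<integral>y. g y \<partial>uniform_measure lebesgue {0..Y}) = average g Y"
proof -
  have "uniform_measure lebesgue {0..Y} = density lebesgue (\<lambda>y. ennreal (indicator {0..Y} y / Y))"
    unfolding uniform_measure_def using assms(2)
    by (intro arg_cong2[where f = density] refl ext)
      (auto simp: indicator_def divide_ennreal ennreal_1[symmetric] simp del: ennreal_1)
  then have "(\<integral>y. g y \<partial>uniform_measure lebesgue {0..Y}) = (\<integral>y. (indicator {0..Y} y / Y) *\<^sub>R g y \<partial>lebesgue)"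
    using assms by (simp only:) (intro integral_density borel_measurable_divide borel_measurable_indicator borel_measurable_const, auto)
  also have "\<dots> = (\<integral>y. (1 / Y) * (indicator {0..Y} y * g y) \<partial>lebesgue)" by simp
  also have "\<dots> = average g Y"
    unfolding average_def set_lebesgue_integral_def by (subst integral_mult_right_zero) simp
  finally show ?thesis .
qed

text \<open>Compactness yields a measure along a subsequence. The averages of every test function
  converge anyway, so their full limits must be the integrals against this measure.\<close>

theorem limiting_distribution_exists:
  fixes phi :: "real \<Rightarrow> real ^ 'n::finite"
  assumes "density_approximation phi P"
  shows "\<exists>mu. has_limiting_distribution phi mu"
proof -
  interpret density_approximation phi P by fact
  \<comment> \<open>\<open>Suc n\<close> keeps the interval from degenerating to a point of measure
    0.\<close>
  define U where "U n = uniform_measure lebesgue {0..real (Suc n)}" for n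
  define phi' where "phi' y = indicator {0..} y *\<^sub>R phi y" for y
  have U_sets: "sets (U n) = sets lebesgue" for n by (simp add: U_def)
  have phi'_meas: "phi' \<in> borel_measurable (U n)" for n
    using phi_meas by (simp add: phi'_def[abs_def] measurable_cong_sets[OF U_sets refl])
  define M where "M n = distr (U n) borel phi'" for n
  have U_prob: "prob_space (U n)" for n
    unfolding U_def by (rule prob_space_uniform_measure) auto
  have M_prob: "prob_space (M n)" for n
    unfolding M_def by (rule prob_space.prob_space_distr[OF U_prob phi'_meas])
  have M_sets: "sets (M n) = sets borel" for n by (simp add: M_def)
  have M_int: "(\<integral>x. f x \<partial>M n) = average (\<lambda>y. f (phi y)) (real (Suc n))"
    if f: "f \<in> borel_measurable borel" for f :: "real ^ 'n \<Rightarrow> real" and n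
  proof -
    have "(\<integral>x. f x \<partial>M n) = (\<integral>y. f (phi' y) \<partial>U n)"
      unfolding M_def by (rule integral_distr[OF phi'_meas f])
    also have "\<dots> = average (\<lambda>y. f (phi' y)) (real (Suc n))"
      unfolding U_def using measurable_compose[OF phi_meas f] by (intro integral_uniform_measure_Icc) (auto simp: phi'_def)
    also have "\<dots> = average (\<lambda>y. f (phi y)) (real (Suc n))"
      unfolding average_def by (intro arg_cong2[where f = scaleR] refl set_lebesgue_integral_cong) (auto simp: phi'_def)
    finally show ?thesis .
  qed
  have tight: "\<exists>R. \<forall>n. measure (M n) (cball 0 R) > 1 - e" if "e > 0" for e
  proof -
    have "e / 2 > 0" using that by simp
    from density_tight[OF this] obtain R where R: "R > 0"
      "\<forall>\<^sub>F Y in at_top. emeasure lebesgue {y\<in>{0..Y}. R \<le> norm (phi y)} \<le> ennreal (e / 2 * Y)" by blast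
    have lim: "filterlim (\<lambda>n. real (Suc n)) at_top sequentially"
      by (rule filterlim_compose[OF filterlim_real_sequentially filterlim_Suc])
    obtain N where N: "\<And>n. n \<ge> N \<Longrightarrow> emeasure lebesgue {y\<in>{0..real (Suc n)}. R \<le> norm (phi y)} \<le> ennreal (e / 2 * real (Suc n))"
      using eventually_compose_filterlim[OF R(2) lim] unfolding eventually_sequentially by blast
    have large: "measure (M n) (cball 0 R) > 1 - e" if n: "n \<ge> N" for n
    proof -
      interpret Mn: prob_space "M n" by (rule M_prob)
      let ?V = "{y\<in>{0..real (Suc n)}. R \<le> norm (phi y)}"
      have "emeasure (M n) (- ball 0 R) = emeasure (U n) (phi' -` (- ball 0 R) \<inter> space (U n))"
        unfolding M_def by (rule emeasure_distr[OF phi'_meas]) auto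
      also have "\<dots> = emeasure lebesgue ({0..real (Suc n)} \<inter> (phi' -` (- ball 0 R) \<inter> space (U n))) / emeasure lebesgue {0..real (Suc n)}"
        unfolding U_def using measurable_sets[OF phi'_meas, of "- ball 0 R" n]
        by (intro emeasure_uniform_measure) (auto simp: U_def)
      also have "{0..real (Suc n)} \<inter> (phi' -` (- ball 0 R) \<inter> space (U n)) = ?V"
        by (auto simp: phi'_def U_def not_less)
      also have "emeasure lebesgue ?V / emeasure lebesgue {0..real (Suc n)} \<le> ennreal (e / 2 * real (Suc n)) / ennreal (real (Suc n))"
        using N[OF n] by (simp add: divide_right_mono_ennreal)
      also have "\<dots> = ennreal (e / 2)" using \<open>e > 0\<close> by (subst divide_ennreal) (auto simp: field_simps)
      finally have "measure (M n) (- ball 0 R) \<le> e / 2"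
        using \<open>e > 0\<close> by (intro finite_measure_le_of_emeasure_le) auto
      moreover have "measure (M n) (ball 0 R) = 1 - measure (M n) (- ball 0 R)"
        using Mn.prob_compl[of "- ball 0 R"] sets_eq_imp_space_eq[OF M_sets[of n]] by (simp add: M_sets Diff_eq)
      moreover have "measure (M n) (ball 0 R) \<le> measure (M n) (cball 0 R)"
        by (intro Mn.finite_measure_mono) (auto simp: M_sets)
      ultimately show ?thesis using \<open>e > 0\<close> by linarith
    qed
    \<comment> \<open>The density estimate starts at \<open>N\<close>; each of the first
      \<open>N\<close> measures is tight by itself, and finitely many radii have a maximum.\<close>
    have single: "\<exists>R. measure (M n) (cball 0 R) > 1 - e" for n
    proof -
      interpret Mn: prob_space "M n" by (rule M_prob)
      have "(\<lambda>k. measure (M n) (cball 0 (real k))) \<longlonglongrightarrow> measure (M n) (\<Union>k. cball 0 (real k))"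
        by (intro Mn.finite_Lim_measure_incseq) (auto simp: M_sets incseq_def)
      also have "(\<Union>k. cball 0 (real k)) = space (M n)"
        using sets_eq_imp_space_eq[OF M_sets[of n]] real_arch_simple by auto
      finally have "(\<lambda>k. measure (M n) (cball 0 (real k))) \<longlonglongrightarrow> 1" by (simp add: Mn.prob_space)
      then have "\<forall>\<^sub>F k in sequentially. measure (M n) (cball 0 (real k)) > 1 - e"
        using that by (intro order_tendstoD(1)) auto
      then show ?thesis using eventually_happens'[OF sequentially_bot] by blast
    qed
    then obtain S where S: "\<And>n. measure (M n) (cball 0 (S n)) > 1 - e" by metis
    define R' where "R' = Max (insert R (S ` {..<N}))"
    have "measure (M n) (cball 0 R') > 1 - e" for n
    proof -
      interpret Mn: prob_space "M n" by (rule M_prob)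
      define R0 where "R0 = (if n < N then S n else R)"
      have "R0 \<le> R'" unfolding R'_def R0_def by (intro Max_ge) auto
      then have "measure (M n) (cball 0 R0) \<le> measure (M n) (cball 0 R')"
        by (intro Mn.finite_measure_mono) (auto simp: M_sets)
      moreover have "measure (M n) (cball 0 R0) > 1 - e"
        using S[of n] large[of n] by (simp add: R0_def)
      ultimately show ?thesis by linarith
    qed
    then show ?thesis by blast
  qed
  obtain r mu where mu: "strict_mono r" "prob_space mu" "sets mu = sets borel"
    "\<And>f :: real ^ 'n \<Rightarrow> real. continuous_on UNIV f \<Longrightarrow> bounded (range f) \<Longrightarrow>
       (\<lambda>n. \<integral>x. f x \<partial>M (r n)) \<longlonglongrightarrow> (\<integral>x. f x \<partial>mu)"
    using tight_imp_weakly_convergent_subsequence[of M] M_prob M_sets tight by metis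
  have "has_limiting_distribution phi mu"
    unfolding has_limiting_distribution_def
  proof (intro conjI allI impI mu(2,3))
    fix f :: "real ^ 'n \<Rightarrow> real" assume f: "continuous_on UNIV f \<and> bounded (range f)"
    obtain l where l: "(average (\<lambda>y. f (phi y)) \<longlongrightarrow> l) at_top"
      using average_compose_tendsto f by blast
    have "filterlim (\<lambda>n. real (Suc (r n))) at_top sequentially"
      by (intro filterlim_compose[OF filterlim_real_sequentially] filterlim_compose[OF filterlim_Suc] filterlim_subseq mu(1))
    from filterlim_compose[OF l this] have "(\<lambda>n. \<integral>x. f x \<partial>M (r n)) \<longlonglongrightarrow> l"
      using f by (simp add: M_int borel_measurable_continuous_onI)
    then have "l = (\<integral>x. f x \<partial>mu)" using mu(4)[of f] f by (auto intro: LIMSEQ_unique)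
    with l show "((\<lambda>Y. (1 / Y) * (LINT y:{0..Y}|lebesgue. f (phi y))) \<longlongrightarrow> (\<integral>x. f x \<partial>mu)) at_top"
      by (simp add: average_def[abs_def])
  qed
  then show ?thesis by blast
qed

section \<open>The Fourier transform\<close>

text \<open>\<open>incr_enum\<close> is a choice, so an increasing enumeration has to be exhibited.
  Local finiteness gives each element a finite rank \<open>g x\<close>, strictly increasing in
  \<open>x\<close>; enumerating the ranks transports the order of the naturals.\<close>

lemma incr_enum_locally_finite:
  assumes inf: "infinite S" and fin: "\<And>T. finite {x\<in>S. x \<le> (T::real)}"
  shows "strict_mono (incr_enum S)" "range (incr_enum S) = S"
proof -
  define g where "g x = card {y\<in>S. y < x}" for x
  have fin': "finite {y\<in>S. y < x}" for x
    by (rule finite_subset[OF _ fin[of x]]) auto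
  have g_less: "g x < g x'" if "x \<in> S" "x < x'" for x x'
    unfolding g_def using that by (intro psubset_card_mono fin') auto
  have g_inj: "inj_on g S"
    by (rule inj_onI) (metis g_less less_irrefl linorder_neqE_linordered_idom)
  have infN: "infinite (g ` S)" using inf g_inj by (simp add: finite_image_iff)
  define e where "e n = inv_into S g (enumerate (g ` S) n)" for n
  have e_in: "e n \<in> S" and g_e: "g (e n) = enumerate (g ` S) n" for n
    unfolding e_def using enumerate_in_set[OF infN, of n] by (auto intro: inv_into_into f_inv_into_f)
  have "strict_mono e"
  proof (rule strict_monoI)
    fix m n :: nat assume "m < n"
    then have "g (e m) < g (e n)" unfolding g_e by (rule enumerate_mono[OF _ infN])
    then show "e m < e n" using g_less[OF e_in[of n], of "e m"] by (cases "e n" "e m" rule: linorder_cases) auto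
  qed
  moreover have "range e = S"
  proof
    show "range e \<subseteq> S" using e_in by auto
    show "S \<subseteq> range e"
    proof
      fix x assume x: "x \<in> S"
      then obtain n where "enumerate (g ` S) n = g x" using range_enumerate[OF infN] by (metis image_eqI rangeE)
      then have "e n = x" unfolding e_def using g_inj x by simp
      then show "x \<in> range e" by auto
    qed
  qed
  ultimately have "\<exists>e :: nat \<Rightarrow> real. strict_mono e \<and> range e = S" by blast
  from someI_ex[OF this] show "strict_mono (incr_enum S)" "range (incr_enum S) = S"
    unfolding incr_enum_def by auto
qed

lemma coef_at_lam:
  assumes "strict_mono lam"
  shows "coef_at lam r (lam n) = r n"
proof -
  have "(THE k. lam k = lam n) = n"
    using strict_mono_eq[OF assms] by (intro the_equality) auto
  then show ?thesis by (auto simp: coef_at_def)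
qed

text \<open>\<open>coef_at\<close> is 0 off the range of \<open>lam\<close>, so each component can
  be summed over a frequency set common to all.\<close>

lemma trig_sum_eq_sum_coef_at:
  assumes mono: "strict_mono lam" and A: "finite A" "lam ` F \<subseteq> A" "\<And>n. lam n \<in> A \<Longrightarrow> n \<in> F"
  shows "trig_sum lam r F y = (\<Sum>x\<in>A. coef_at lam r x * cis (x * y))"
proof -
  have "(\<Sum>x\<in>A. coef_at lam r x * cis (x * y)) = (\<Sum>x\<in>lam ` F. coef_at lam r x * cis (x * y))"
  proof (rule sum.mono_neutral_right[OF A(1,2)], rule ballI)
    fix x assume "x \<in> A - lam ` F"
    then have "\<nexists>n. lam n = x" using A(3) by auto
    then show "coef_at lam r x * cis (x * y) = 0" by (simp add: coef_at_def)
  qed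
  also have "\<dots> = (\<Sum>n\<in>F. r n * cis (lam n * y))"
    using mono by (subst sum.reindex) (auto simp: coef_at_lam strict_mono_eq inj_on_def)
  also have "\<dots> = trig_sum lam r F y"
    by (simp add: trig_sum_def cis_conv_exp)
  finally show ?thesis by simp
qed

theorem theorem1p9:
  fixes phi :: "real \<Rightarrow> real ^ 'l"
    and lam :: "'l \<Rightarrow> nat \<Rightarrow> real"
    and r :: "'l \<Rightarrow> nat \<Rightarrow> complex"
    and c :: "'l \<Rightarrow> real"
  assumes lam_pos: "\<And>k n. lam k n > 0"
    and lam_mono: "\<And>k. strict_mono (lam k)"
    and lam_lim: "\<And>k. filterlim (lam k) at_top sequentially"
    and expansion: "\<And>k. \<exists>y0 X0 (E :: real \<Rightarrow> real \<Rightarrow> real).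
       y0 \<ge> 0 \<and> X0 > 0 \<and>
       set_borel_measurable lebesgue {0..y0} (\<lambda>y. phi y $ k) \<and>
       set_integrable lebesgue {0..y0} (\<lambda>y. (phi y $ k)\<^sup>2) \<and>
       (\<forall>y X. y \<ge> y0 \<and> X \<ge> X0 \<longrightarrow>
          phi y $ k = c k + Re (\<Sum>n\<in>{n. lam k n \<le> X}. r k n * exp (\<i> * complex_of_real (lam k n * y)))
                      + E y X) \<and>
       (\<forall>X \<ge> X0. set_borel_measurable lebesgue {y0..} (\<lambda>y. E y X)) \<and>
       (\<forall>\<^sub>F Y in at_top. set_integrable lebesgue {y0..Y} (\<lambda>y. \<bar>E y (exp Y)\<bar>\<^sup>2)) \<and>
       ((\<lambda>Y. (1 / Y) * (LINT y:{y0..Y}|lebesgue. \<bar>E y (exp Y)\<bar>\<^sup>2)) \<longlongrightarrow> 0) at_top"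
    and conds: "\<And>k. cond_A (lam k) (r k) \<or> cond_B (lam k) (r k) \<or> cond_C (lam k) (r k) \<or> cond_D (lam k) (r k)"
  shows "(\<exists>mu. has_limiting_distribution phi mu) \<and>
    (Q_linearly_independent (\<Union>k. range (lam k)) \<longrightarrow>
      (\<forall>mu. has_limiting_distribution phi mu \<longrightarrow>
        (\<forall>\<xi> :: real ^ 'l.
          integrable mu (\<lambda>t. exp (- \<i> * complex_of_real (\<Sum>j\<in>UNIV. \<xi> $ j * t $ j))) \<and>
          ((\<lambda>N. exp (- \<i> * complex_of_real (\<Sum>k\<in>UNIV. c k * \<xi> $ k)) *
                 (\<Prod>m<N. J0 (norm (\<Sum>k\<in>UNIV. coef_at (lam k) (r k) (incr_enum (\<Union>k. range (lam k)) m) * complex_of_real (\<xi> $ k)))))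
            \<longlongrightarrow> (\<integral>t. exp (- \<i> * complex_of_real (\<Sum>j\<in>UNIV. \<xi> $ j * t $ j)) \<partial>mu)) sequentially)))"
proof -
  define P where "P T y = (\<chi> k. c k + Re (trig_sum (lam k) (r k) {n. lam k n \<le> T} y))" for T y
  have summ: "summable (\<lambda>j. (unit_block (lam k) (r k) (real j))\<^sup>2)" for k
    using conds[of k] cond_A_summable cond_B_summable[OF lam_lim] cond_D_summable[OF lam_lim]
      cond_C_imp_cond_A[OF lam_mono] by blast
  have comp: "approximable_in_density (\<lambda>y. phi y $ k) (\<lambda>T y. P T y $ k) \<and>
      (\<lambda>y. indicator {0..} y * phi y $ k) \<in> borel_measurable lebesgue" for k
  proof -
    obtain y0 X0 E where y0: "y0 \<ge> 0"
      and m1: "set_borel_measurable lebesgue {0..y0} (\<lambda>y. phi y $ k)"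
      and expan: "\<And>y X. y \<ge> y0 \<Longrightarrow> X \<ge> X0 \<Longrightarrow> phi y $ k = c k + Re (trig_sum (lam k) (r k) {n. lam k n \<le> X} y) + E y X"
      and m2: "\<And>X. X \<ge> X0 \<Longrightarrow> set_borel_measurable lebesgue {y0..} (\<lambda>y. E y X)"
      and E: "\<forall>\<^sub>F Y in at_top. set_integrable lebesgue {y0..Y} (\<lambda>y. \<bar>E y (exp Y)\<bar>\<^sup>2)"
        "((\<lambda>Y. (1 / Y) * (LINT y:{y0..Y}|lebesgue. \<bar>E y (exp Y)\<bar>\<^sup>2)) \<longlongrightarrow> 0) at_top"
      using expansion[of k] unfolding trig_sum_def by blast
    have "approximable_in_density (\<lambda>y. phi y $ k) (\<lambda>T y. P T y $ k)"
      using approximable_in_density_of_expansion[OF lam_pos lam_lim summ y0 expan m2 E] by (simp add: P_def)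
    moreover have "(\<lambda>y. indicator {0..} y * phi y $ k) \<in> borel_measurable lebesgue"
    proof -
      \<comment> \<open>Beyond \<open>y0\<close> measurability comes from the expansion at the
        single cutoff \<open>X0\<close>, up to \<open>y0\<close> from the hypothesis;
        \<open>{y0<..}\<close> keeps \<open>y0\<close> from being counted twice.\<close>
      define Q where "Q y = c k + Re (trig_sum (lam k) (r k) {n. lam k n \<le> X0} y)" for y
      have "Q \<in> borel_measurable borel" unfolding Q_def by measurable
      then have Q: "Q \<in> borel_measurable lebesgue" by (simp add: measurable_completion)
      have "{y0<..} \<in> sets lebesgue" by simp
      then have "(\<lambda>y. indicator {0..y0} y *\<^sub>R phi y $ k + indicator {y0<..} y * (Q y + indicator {y0..} y *\<^sub>R E y X0)) \<in> borel_measurable lebesgue"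
        using m1 m2[OF order_refl] Q unfolding set_borel_measurable_def
        by (intro borel_measurable_add borel_measurable_times borel_measurable_indicator)
      also have "(\<lambda>y. indicator {0..y0} y *\<^sub>R phi y $ k + indicator {y0<..} y * (Q y + indicator {y0..} y *\<^sub>R E y X0))
         = (\<lambda>y. indicator {0..} y * phi y $ k)"
      proof
        fix y
        show "indicator {0..y0} y *\<^sub>R phi y $ k + indicator {y0<..} y * (Q y + indicator {y0..} y *\<^sub>R E y X0) = indicator {0..} y * phi y $ k"
          using expan[of y X0] y0 unfolding Q_def by (cases "y \<le> y0") (auto simp: indicator_def)
      qed
      finally show ?thesis .
    qed
    ultimately show ?thesis ..
  qed
  have P_comp_cont: "continuous_on UNIV (\<lambda>y. P T y $ k)" for T k
    unfolding P_def by (simp add: continuous_intros)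
  have dens: "density_approximation phi P"
  proof
    show "(\<lambda>y. indicator {0..} y *\<^sub>R phi y) \<in> borel_measurable lebesgue"
      using comp by (subst borel_measurable_euclidean_space) (auto simp: Basis_vec_def inner_axis)
    show "almost_periodic UNIV (\<lambda>y. complex_of_real (P T y \<bullet> b))" if "b \<in> Basis" for T b
    proof -
      obtain k where k: "b = axis k 1" using \<open>b \<in> Basis\<close> by (auto simp: Basis_vec_def)
      have "almost_periodic UNIV (\<lambda>y. complex_of_real (c k) + (\<Sum>n\<in>{n. lam k n \<le> T}. complex_of_real (Re (r k n * cis (lam k n * y)))))"
        by (intro almost_periodic.add almost_periodic_const almost_periodic_sum almost_periodic_Re_cis) auto
      also have "(\<lambda>y. complex_of_real (c k) + (\<Sum>n\<in>{n. lam k n \<le> T}. complex_of_real (Re (r k n * cis (lam k n * y)))))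
         = (\<lambda>y. complex_of_real (P T y \<bullet> b))"
        by (simp add: k P_def inner_axis trig_sum_def cis_conv_exp)
      finally show ?thesis .
    qed
    show "approximable_in_density phi P"
    proof (rule approximable_in_density_vec)
      show "(\<lambda>y. indicator {0..} y * (phi y $ k - P T y $ k)) \<in> borel_measurable lebesgue" for T k
      proof -
        have "(\<lambda>y. indicator {0..} y * P T y $ k) \<in> borel_measurable borel"
          by (intro borel_measurable_times borel_measurable_indicator borel_measurable_continuous_onI P_comp_cont) auto
        then have "(\<lambda>y. indicator {0..} y * P T y $ k) \<in> borel_measurable lebesgue" by (simp add: measurable_completion)
        then show ?thesis unfolding right_diff_distrib using comp by (intro borel_measurable_diff) auto
      qed
    qed (use comp in blast)
  qed
  interpret density_approximation phi P by (rule dens)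
  have "\<exists>mu. has_limiting_distribution phi mu" by (rule limiting_distribution_exists[OF dens])
  moreover have "integrable mu (\<lambda>t. exp (- \<i> * complex_of_real (\<Sum>j\<in>UNIV. \<xi> $ j * t $ j))) \<and>
          ((\<lambda>N. exp (- \<i> * complex_of_real (\<Sum>k\<in>UNIV. c k * \<xi> $ k)) *
                 (\<Prod>m<N. J0 (norm (\<Sum>k\<in>UNIV. coef_at (lam k) (r k) (incr_enum (\<Union>k. range (lam k)) m) * complex_of_real (\<xi> $ k)))))
            \<longlongrightarrow> (\<integral>t. exp (- \<i> * complex_of_real (\<Sum>j\<in>UNIV. \<xi> $ j * t $ j)) \<partial>mu)) sequentially"
    if indep: "Q_linearly_independent (\<Union>k. range (lam k))" and mu: "has_limiting_distribution phi mu" for mu and \<xi> :: "real ^ 'l"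
  proof -
    define S where "S = (\<Union>k. range (lam k))"
    define e where "e = incr_enum S"
    define z where "z x = (\<Sum>k\<in>UNIV. coef_at (lam k) (r k) x * complex_of_real (\<xi> $ k))" for x
    define C where "C = exp (- \<i> * complex_of_real (\<Sum>k\<in>UNIV. c k * \<xi> $ k))"
    have S_fin: "finite {x\<in>S. x \<le> T}" for T
    proof -
      have "{x\<in>S. x \<le> T} = (\<Union>k. lam k ` {n. lam k n \<le> T})" by (auto simp: S_def)
      then show ?thesis using finite_frequencies_le[OF lam_lim] by auto
    qed
    have "infinite S"
    proof -
      have "inj (lam k)" for k using strict_mono_eq[OF lam_mono] by (auto intro: injI)
      then have "infinite (range (lam k))" for k by (simp add: finite_image_iff)
      then show ?thesis unfolding S_def by (meson UNIV_I UN_upper infinite_super)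
    qed
    note e_props = incr_enum_locally_finite[OF this S_fin, folded e_def]
    have e_lim: "filterlim e at_top sequentially"
      unfolding filterlim_at_top
    proof
      fix Z
      \<comment> \<open>The index type is nonempty, and the frequencies of any one component exceed
        every bound.\<close>
      obtain k :: 'l where True by simp
      have "\<forall>\<^sub>F n in sequentially. Z \<le> lam k n" using lam_lim[of k] unfolding filterlim_at_top by blast
      then obtain n where n: "Z \<le> lam k n" using eventually_happens'[OF sequentially_bot] by blast
      have "lam k n \<in> range e" unfolding e_props(2) S_def by blast
      then obtain n0 where "Z \<le> e n0" using n by auto
      then show "\<forall>\<^sub>F n in sequentially. Z \<le> e n"
        unfolding eventually_sequentially using strict_mono_less_eq[OF e_props(1)] by (meson order_trans)
    qed
    \<comment> \<open>Merging the components gives each frequency one coefficient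
      \<open>z x\<close>, so the exponential factors frequency by frequency.\<close>
    have phase: "exp (- \<i> * complex_of_real (\<xi> \<bullet> P T y)) =
        C * (\<Prod>x\<in>{x\<in>S. x \<le> T}. exp (- \<i> * complex_of_real (Re (z x * cis (x * y)))))" for T y
    proof -
      have "\<xi> \<bullet> P T y = (\<Sum>k\<in>UNIV. c k * \<xi> $ k) + (\<Sum>k\<in>UNIV. \<xi> $ k * Re (trig_sum (lam k) (r k) {n. lam k n \<le> T} y))"
        by (simp add: inner_vec_def P_def algebra_simps sum.distrib)
      also have "(\<Sum>k\<in>UNIV. \<xi> $ k * Re (trig_sum (lam k) (r k) {n. lam k n \<le> T} y))
          = (\<Sum>k\<in>UNIV. \<Sum>x\<in>{x\<in>S. x \<le> T}. Re (coef_at (lam k) (r k) x * complex_of_real (\<xi> $ k) * cis (x * y)))"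
      proof (rule sum.cong[OF refl])
        fix k
        have "trig_sum (lam k) (r k) {n. lam k n \<le> T} y = (\<Sum>x\<in>{x\<in>S. x \<le> T}. coef_at (lam k) (r k) x * cis (x * y))"
          by (rule trig_sum_eq_sum_coef_at[OF lam_mono S_fin]) (auto simp: S_def)
        then have "\<xi> $ k * Re (trig_sum (lam k) (r k) {n. lam k n \<le> T} y)
            = Re (complex_of_real (\<xi> $ k) * (\<Sum>x\<in>{x\<in>S. x \<le> T}. coef_at (lam k) (r k) x * cis (x * y)))"
          by (simp del: Re_sum)
        also have "\<dots> = (\<Sum>x\<in>{x\<in>S. x \<le> T}. Re (coef_at (lam k) (r k) x * complex_of_real (\<xi> $ k) * cis (x * y)))"
          unfolding sum_distrib_left Re_sum by (intro sum.cong refl arg_cong[where f = Re]) (simp add: mult_ac)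
        finally show "\<xi> $ k * Re (trig_sum (lam k) (r k) {n. lam k n \<le> T} y)
            = (\<Sum>x\<in>{x\<in>S. x \<le> T}. Re (coef_at (lam k) (r k) x * complex_of_real (\<xi> $ k) * cis (x * y)))" .
      qed
      also have "\<dots> = (\<Sum>x\<in>{x\<in>S. x \<le> T}. Re (z x * cis (x * y)))"
        unfolding z_def sum_distrib_right Re_sum by (rule sum.swap)
      finally have "- \<i> * complex_of_real (\<xi> \<bullet> P T y) = - \<i> * complex_of_real (\<Sum>k\<in>UNIV. c k * \<xi> $ k)
          + (\<Sum>x\<in>{x\<in>S. x \<le> T}. - \<i> * complex_of_real (Re (z x * cis (x * y))))"
        by (simp add: algebra_simps sum_distrib_left sum_negf)
      then show ?thesis unfolding C_def by (simp only: exp_add exp_sum[OF S_fin])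
    qed
    have mean_exp: "mean_value (\<lambda>y. exp (- \<i> * complex_of_real (\<xi> \<bullet> P T y))) = C * (\<Prod>x\<in>{x\<in>S. x \<le> T}. J0 (norm (z x)))" for T
    proof -
      have "Q_linearly_independent {x\<in>S. x \<le> T}"
        using indep unfolding Q_linearly_independent_def S_def by blast
      note prod = mean_value_prod_independent[OF S_fin this, of z]
      show ?thesis
        unfolding phase mean_value_cmult[OF prod[THEN conjunct1]] prod[THEN conjunct2] ..
    qed
    \<comment> \<open>The cutoff \<open>e N\<close> keeps \<open>e 0\<close> up to and including
      \<open>e N\<close>, hence \<open>Suc N\<close> factors.\<close>
    have mean_prod: "mean_value (\<lambda>y. exp (- \<i> * complex_of_real (\<xi> \<bullet> P (e N) y))) = C * (\<Prod>m<Suc N. J0 (norm (z (e m))))" for N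
    proof -
      have "{x\<in>S. x \<le> e N} = e ` {..<Suc N}"
        using e_props strict_mono_less_eq[OF e_props(1)] by (auto simp: less_Suc_eq_le)
      moreover have "inj_on e {..<Suc N}" using strict_mono_eq[OF e_props(1)] by (auto intro: inj_onI)
      ultimately show ?thesis unfolding mean_exp by (simp add: prod.reindex)
    qed
    \<comment> \<open>Weak convergence is stated for real test functions, so the exponential is
      treated through cosine and sine.\<close>
    have exp_split: "exp (- \<i> * complex_of_real t) = complex_of_real (cos t) + (- \<i>) * complex_of_real (sin t)" for t
    proof -
      have "exp (- \<i> * complex_of_real t) = cis (- t)" by (simp add: cis_conv_exp)
      then show ?thesis by (simp add: complex_eq_iff)
    qed
    \<comment> \<open>\<open>mu\<close> is an arbitrary limiting distribution here; the averages
      determine its integrals.\<close>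
    have test: "((\<lambda>T. mean_value (\<lambda>y. complex_of_real (f (P T y)))) \<longlongrightarrow> complex_of_real (\<integral>t. f t \<partial>mu)) at_top"
      if f: "continuous_on UNIV f" "bounded (range f)" for f :: "real ^ 'l \<Rightarrow> real"
    proof -
      obtain l where l: "(average (\<lambda>y. f (phi y)) \<longlongrightarrow> l) at_top"
        "((\<lambda>T. mean_value (\<lambda>y. complex_of_real (f (P T y)))) \<longlongrightarrow> complex_of_real l) at_top"
        using average_compose_tendsto[OF f] by blast
      have "(average (\<lambda>y. f (phi y)) \<longlongrightarrow> (\<integral>t. f t \<partial>mu)) at_top"
        using mu f unfolding has_limiting_distribution_def by (simp add: average_def[abs_def])
      with l(1) have "l = (\<integral>t. f t \<partial>mu)" by (rule tendsto_unique[rotated]) simp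
      with l(2) show ?thesis by simp
    qed
    have cos_cont: "continuous_on UNIV (\<lambda>t. cos (\<xi> \<bullet> t))" and sin_cont: "continuous_on UNIV (\<lambda>t. sin (\<xi> \<bullet> t))"
      by (intro continuous_intros)+
    have cos_bdd: "bounded (range (\<lambda>t. cos (\<xi> \<bullet> t)))" and sin_bdd: "bounded (range (\<lambda>t. sin (\<xi> \<bullet> t)))"
      unfolding bounded_iff by (auto intro!: exI[of _ 1])
    interpret mu: prob_space mu using mu unfolding has_limiting_distribution_def by blast
    have mu_sets: "sets mu = sets borel" using mu unfolding has_limiting_distribution_def by blast
    have meas: "g \<in> borel_measurable mu" if "g \<in> borel_measurable borel" for g :: "real ^ 'l \<Rightarrow> 'b::topological_space"
      using that by (simp add: measurable_cong_sets[OF mu_sets refl])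
    have cos_int: "integrable mu (\<lambda>t. cos (\<xi> \<bullet> t))"
      by (intro mu.integrable_const_bound[of _ 1] meas borel_measurable_continuous_onI cos_cont) auto
    have sin_int: "integrable mu (\<lambda>t. sin (\<xi> \<bullet> t))"
      by (intro mu.integrable_const_bound[of _ 1] meas borel_measurable_continuous_onI sin_cont) auto
    have exp_int: "integrable mu (\<lambda>t. exp (- \<i> * complex_of_real (\<xi> \<bullet> t)))"
      unfolding exp_split by (intro Bochner_Integration.integrable_add integrable_mult_right integrable_of_real cos_int sin_int)
    have fourier: "(\<integral>t. exp (- \<i> * complex_of_real (\<xi> \<bullet> t)) \<partial>mu)
        = complex_of_real (\<integral>t. cos (\<xi> \<bullet> t) \<partial>mu) + (- \<i>) * complex_of_real (\<integral>t. sin (\<xi> \<bullet> t) \<partial>mu)"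
      unfolding exp_split using cos_int sin_int by (simp add: integrable_of_real)
    have ap_f: "almost_periodic UNIV (\<lambda>y. complex_of_real (f (P T y)))" if "continuous_on UNIV f" for f :: "real ^ 'l \<Rightarrow> real" and T
      by (intro almost_periodic_compose_continuous[where f = f and P = "P T"] P_ap that) auto
    have "mean_value (\<lambda>y. exp (- \<i> * complex_of_real (\<xi> \<bullet> P T y)))
        = mean_value (\<lambda>y. complex_of_real (cos (\<xi> \<bullet> P T y))) + (- \<i>) * mean_value (\<lambda>y. complex_of_real (sin (\<xi> \<bullet> P T y)))" for T
      unfolding exp_split
      by (simp only: mean_value_add[OF ap_f[OF cos_cont] almost_periodic.cmult[OF ap_f[OF sin_cont]]] mean_value_cmult[OF ap_f[OF sin_cont]])
    then have "((\<lambda>T. mean_value (\<lambda>y. exp (- \<i> * complex_of_real (\<xi> \<bullet> P T y)))) \<longlongrightarrow> (\<integral>t. exp (- \<i> * complex_of_real (\<xi> \<bullet> t)) \<partial>mu)) at_top"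
      unfolding fourier by (simp only:) (intro tendsto_add tendsto_mult_left test cos_cont sin_cont cos_bdd sin_bdd)
    \<comment> \<open>Sampling the limit in \<open>T\<close> at the frequencies themselves gives
      convergence of the partial products; the shift in their length is removed next.\<close>
    from filterlim_compose[OF this e_lim]
    have "(\<lambda>N. C * (\<Prod>m<Suc N. J0 (norm (z (e m))))) \<longlonglongrightarrow> (\<integral>t. exp (- \<i> * complex_of_real (\<xi> \<bullet> t)) \<partial>mu)"
      unfolding mean_prod .
    then have "(\<lambda>N. C * (\<Prod>m<N. J0 (norm (z (e m))))) \<longlonglongrightarrow> (\<integral>t. exp (- \<i> * complex_of_real (\<xi> \<bullet> t)) \<partial>mu)"
      by (rule filterlim_sequentially_Suc[THEN iffD1])
    with exp_int show ?thesis
      unfolding C_def z_def e_def S_def by (simp only: inner_vec_def inner_real_def)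
  qed
  ultimately show ?thesis by blast
qed

end
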